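(* For every $r\ge3$ there is $\alpha_0=\alpha_0(r)>0$ such that for every constant $\alpha$ with $0<\alpha\le\alpha_0$ there is an algorithm which, given as input an $r$-SAT formula $F$, always correctly decides whether $F$ is satisfiable, outputs an assignment satisfying as many clauses of $F$ as possible and, if $F$ is unsatisfiable, also outputs a minimal unsatisfiable subformula of $F$; and whose expected running time on a random formula $F\in\mathcal F^r_{n,p}$ with $p=\alpha n^{-(r-1)}$ is bounded by a polynomial in $n$.
   Context: An $r$-SAT formula consists of a finite set of variables and a set of clauses, each clause consisting of $r$ literals (variables or negated variables) on $r$ distinct variables of the formula. A clause is satisfied by a True/False assignment of the variables if at least one of its literals is True; the formula is satisfiable if some assignment satisfies all clauses. The random formula $\mathcal F^r_{n,p}$ has $n$ variables, each of the $2^r\binom nr$ possible clauses being present independently with probability $p$. A subformula of $F$ is a formula whose variable and clause sets are subsets of those of $F$; a minimal unsatisfiable subformula is an unsatisfiable subformula having no unsatisfiable proper subformula. *)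

theory Defs
  imports
    "HOL-Probability.Probability"
    "HOL-Probability.Product_PMF"
    "HOL-Computational_Algebra.Polynomial"
    "HOL-Library.List_Lexorder"
begin

section \<open>SAT formulas\<close>

text \<open>A literal is a variable together with the truth value that makes the literal true.\<close>

type_synonym literal = "nat \<times> bool"
type_synonym clause = "literal set"

datatype formula = Formula (vars: "nat set") (clauses: "clause set")

definition all_clauses :: "nat \<Rightarrow> nat set \<Rightarrow> clause set" where
  "all_clauses r V = {c. finite c \<and> card c = r \<and> inj_on fst c \<and> fst ` c \<subseteq> V}"

definition sat_formula :: "nat \<Rightarrow> formula \<Rightarrow> bool" where
  "sat_formula r F \<longleftrightarrow> finite (vars F) \<and> clauses F \<subseteq> all_clauses r (vars F)"

definition satisfies :: "(nat \<Rightarrow> bool) \<Rightarrow> clause \<Rightarrow> bool" where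
  "satisfies \<sigma> c \<longleftrightarrow> (\<exists>(v, b) \<in> c. \<sigma> v = b)"

definition satisfiable :: "formula \<Rightarrow> bool" where
  "satisfiable F \<longleftrightarrow> (\<exists>\<sigma>. \<forall>c \<in> clauses F. satisfies \<sigma> c)"

definition num_satisfied :: "formula \<Rightarrow> (nat \<Rightarrow> bool) \<Rightarrow> nat" where
  "num_satisfied F \<sigma> = card {c \<in> clauses F. satisfies \<sigma> c}"

definition max_sat_assignment :: "formula \<Rightarrow> (nat \<Rightarrow> bool) \<Rightarrow> bool" where
  "max_sat_assignment F \<sigma> \<longleftrightarrow> (\<forall>\<tau>. num_satisfied F \<tau> \<le> num_satisfied F \<sigma>)"

definition subformula :: "nat \<Rightarrow> formula \<Rightarrow> formula \<Rightarrow> bool" where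
  "subformula r G F \<longleftrightarrow> sat_formula r G \<and> vars G \<subseteq> vars F \<and> clauses G \<subseteq> clauses F"

definition minimal_unsat_subformula :: "nat \<Rightarrow> formula \<Rightarrow> formula \<Rightarrow> bool" where
  "minimal_unsat_subformula r G F \<longleftrightarrow>
     subformula r G F \<and> \<not> satisfiable G \<and>
     (\<forall>H. subformula r H G \<and> H \<noteq> G \<longrightarrow> satisfiable H)"

definition random_sat :: "nat \<Rightarrow> nat \<Rightarrow> real \<Rightarrow> formula pmf" where
  "random_sat r n p =
     map_pmf (\<lambda>present. Formula {..<n} {c \<in> all_clauses r {..<n}. present c})
       (Pi_pmf (all_clauses r {..<n}) False (\<lambda>_. bernoulli_pmf p))"


section \<open>Algorithms: random access machine programs\<close>

text \<open>
  The machine has named registers and an indirectly addressable memory, all holding natural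
  numbers. Every elementary operation has unit cost. The only arithmetic operations are addition
  and truncated subtraction (no multiplication), so that the bit length of every number grows by
  at most an additive constant per operation and unit-cost time is polynomially related to Turing
  machine time.
\<close>

datatype aexp =
    Const nat
  | Reg string
  | Mem aexp
  | Plus aexp aexp
  | Minus aexp aexp

datatype com =
    Skip
  | Assign string aexp
  | Store aexp aexp
  | Seq com com
  | Cond aexp com com
  | While aexp com

type_synonym state = "(string \<Rightarrow> nat) \<times> (nat \<Rightarrow> nat)"

fun aval :: "aexp \<Rightarrow> state \<Rightarrow> nat" where
  "aval (Const k) s = k"
| "aval (Reg x) s = fst s x"
| "aval (Mem a) s = snd s (aval a s)"
| "aval (Plus a b) s = aval a s + aval b s"
| "aval (Minus a b) s = aval a s - aval b s"

fun acost :: "aexp \<Rightarrow> nat" where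
  "acost (Const k) = 1"
| "acost (Reg x) = 1"
| "acost (Mem a) = acost a + 1"
| "acost (Plus a b) = acost a + acost b + 1"
| "acost (Minus a b) = acost a + acost b + 1"

text \<open>
  \<open>exec c s t s'\<close>: started in state \<open>s\<close>, program \<open>c\<close> terminates in state \<open>s'\<close> after time \<open>t\<close>.
  A condition counts as true when its value is nonzero.
\<close>

inductive exec :: "com \<Rightarrow> state \<Rightarrow> nat \<Rightarrow> state \<Rightarrow> bool" where
  Skip: "exec Skip s 1 s"
| Assign: "exec (Assign x a) s (acost a + 1) ((fst s)(x := aval a s), snd s)"
| Store: "exec (Store a b) s (acost a + acost b + 1)
            (fst s, (snd s)(aval a s := aval b s))"
| Seq: "exec c s t s' \<Longrightarrow> exec d s' t' s'' \<Longrightarrow> exec (Seq c d) s (t + t') s''"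
| CondTrue: "aval a s \<noteq> 0 \<Longrightarrow> exec c s t s' \<Longrightarrow> exec (Cond a c d) s (acost a + 1 + t) s'"
| CondFalse: "aval a s = 0 \<Longrightarrow> exec d s t s' \<Longrightarrow> exec (Cond a c d) s (acost a + 1 + t) s'"
| WhileFalse: "aval a s = 0 \<Longrightarrow> exec (While a c) s (acost a + 1) s"
| WhileTrue: "aval a s \<noteq> 0 \<Longrightarrow> exec c s t s' \<Longrightarrow> exec (While a c) s' t' s'' \<Longrightarrow>
    exec (While a c) s (acost a + 1 + t + t') s''"

inductive_cases SkipE: "exec Skip s t s'"
inductive_cases AssignE: "exec (Assign x a) s t s'"
inductive_cases StoreE: "exec (Store a b) s t s'"
inductive_cases SeqE: "exec (Seq c d) s t s'"
inductive_cases CondE: "exec (Cond a c d) s t s'"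
inductive_cases WhileE: "exec (While a c) s t s'"

lemma exec_deterministic:
  assumes "exec c s t s'" and "exec c s u s''"
  shows "t = u \<and> s' = s''"
  using assms
proof (induction arbitrary: u s'' rule: exec.induct)
  case Skip
  then show ?case by (elim SkipE) simp
next
  case Assign
  then show ?case by (elim AssignE) simp
next
  case Store
  then show ?case by (elim StoreE) simp
next
  case Seq
  from Seq.prems show ?case by (elim SeqE) (use Seq.IH in blast)
next
  case CondTrue
  from CondTrue.prems CondTrue.hyps show ?case by (elim CondE) (auto dest: CondTrue.IH)
next
  case CondFalse
  from CondFalse.prems CondFalse.hyps show ?case by (elim CondE) (auto dest: CondFalse.IH)
next
  case WhileFalse
  show ?case by (rule WhileE[OF WhileFalse.prems]) (use WhileFalse.hyps in simp_all)
next
  case (WhileTrue a s c t s' t' s1)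
  obtain v w s2
    where "u = acost a + 1 + v + w" and "exec c s v s2" and "exec (While a c) s2 w s''"
    by (rule WhileE[OF WhileTrue.prems]) (use that WhileTrue.hyps in simp_all)
  with WhileTrue.IH show ?case by blast
qed


section \<open>Input and output format\<close>

text \<open>
  A clause is written as the list of its variables in increasing order, each followed by its sign;
  a formula as the number of its variables, its variables in increasing order, the number of its
  clauses, and its clauses in lexicographic order.
\<close>

definition encode_clause :: "clause \<Rightarrow> nat list" where
  "encode_clause c =
     concat (map (\<lambda>v. [v, of_bool ((v, True) \<in> c)]) (sorted_list_of_set (fst ` c)))"

definition encode :: "formula \<Rightarrow> nat list" where
  "encode F =
     card (vars F) # sorted_list_of_set (vars F) @
     card (clauses F) # concat (sorted_list_of_set (encode_clause ` clauses F))"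

definition encode_assignment :: "formula \<Rightarrow> (nat \<Rightarrow> bool) \<Rightarrow> nat list" where
  "encode_assignment F \<sigma> = map (\<lambda>v. of_bool (\<sigma> v)) (sorted_list_of_set (vars F))"

definition initial_state :: "formula \<Rightarrow> state" where
  "initial_state F =
     (\<lambda>_. 0, \<lambda>i. if i < length (encode F) then encode F ! i else 0)"

text \<open>The output is read off the memory from address 0 on.\<close>

definition outputs :: "state \<Rightarrow> nat list \<Rightarrow> bool" where
  "outputs s w \<longleftrightarrow> map (snd s) [0..<length w] = w"

definition correct_output :: "nat \<Rightarrow> formula \<Rightarrow> state \<Rightarrow> bool" where
  "correct_output r F s \<longleftrightarrow>
     (\<exists>\<sigma>. max_sat_assignment F \<sigma> \<and>
        (if satisfiable F then outputs s (1 # encode_assignment F \<sigma>)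
         else \<exists>G. minimal_unsat_subformula r G F \<and>
                outputs s (0 # encode_assignment F \<sigma> @ encode G)))"

definition solves_sat :: "nat \<Rightarrow> com \<Rightarrow> bool" where
  "solves_sat r P \<longleftrightarrow>
     (\<forall>F. sat_formula r F \<longrightarrow> (\<exists>t s. exec P (initial_state F) t s \<and> correct_output r F s))"

text \<open>Well defined for terminating runs, by determinism.\<close>

definition running_time :: "com \<Rightarrow> formula \<Rightarrow> nat" where
  "running_time P F = (THE t. \<exists>s. exec P (initial_state F) t s)"

end

theory Submission
  imports Defs
begin

text \<open>
  Join the variables of every clause. Maximising the number of satisfied clauses by brute force
  inside each connected component \<open>C\<close> takes time polynomial in the input size times \<open>2 ^ |C|\<close>, and
  a minimal unsatisfiable subformula results from trying to delete one clause after the other,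
  which only shrinks the components. If \<open>D\<close> is the degree of the running time in the largest
  loop bound, it therefore suffices to bound the expectation of \<open>x ^ |C|\<close> for \<open>x = 2 ^ D\<close>. For
  small \<open>\<alpha>\<close> the clause hypergraph is subcritical: revealing the clauses that meet the current
  part of a component one at a time gives the bound \<open>x (1 + p K) ^ N\<close>, where \<open>N\<close> bounds the
  number of possible clauses through a variable and \<open>p N K = O(\<alpha>)\<close>.

  Programs are written in a language with bounded loops, arrays and pure sum expressions; its
  semantics is a total function, so that only the loop bounds matter for the running time.
\<close>

section \<open>Reachability under random edges\<close>

text \<open>The constants are chosen backwards. The degree \<open>D\<close> belongs to a program
  that depends on \<open>r\<close> alone; only afterwards is \<alpha> taken small enough to bound
  the \<open>D\<close>-th moment of \<open>2 ^ |C|\<close>. A present edge multiplies the bound by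
  \<open>x ^ (r - 1)\<close> for its new vertices and by \<open>(1 + p K) ^ ((r - 1) N)\<close> for
  the edges that these may bring in. \<open>K\<close> must dominate this product although it occurs
  in it. As \<open>(1 + p K) ^ ((r - 1) N)\<close> is at most \<open>exp (p N K (r - 1))\<close>, an
  \<alpha> that makes the exponent at most 1 allows \<open>K = 3 x ^ (r - 1)\<close>. The largest
  component is handled by a sum: the \<open>D\<close>-th power of the maximal \<open>2 ^ |C|\<close>
  is at most 1 plus the sum over all variables, so linearity of expectation replaces any study of
  the maximum. The number of clauses is replaced by its deterministic bound
  \<open>(2 n) ^ r\<close>, which avoids products of dependent random quantities. The program always
  uses the components of the whole formula, even after deletions: they stay closed for the remaining
  clauses, and one size bound serves all rounds.\<close>

definition closed_under :: "('c \<Rightarrow> 'v set) \<Rightarrow> 'c set \<Rightarrow> 'v set \<Rightarrow> bool" where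
  "closed_under e A T \<longleftrightarrow> (\<forall>c\<in>A. e c \<inter> T \<noteq> {} \<longrightarrow> e c \<subseteq> T)"

text \<open>Edges are labels \<open>c\<close> with vertex sets \<open>e c\<close>, because different
  clauses may have the same variables. A least closed superset, rather than paths, suits the
  revealing of edges one at a time.\<close>

definition reach :: "('c \<Rightarrow> 'v set) \<Rightarrow> 'c set \<Rightarrow> 'v set \<Rightarrow> 'v set" where
  "reach e A S = \<Inter>{T. S \<subseteq> T \<and> closed_under e A T}"

lemma reach_least: "S \<subseteq> T \<Longrightarrow> closed_under e A T \<Longrightarrow> reach e A S \<subseteq> T"
  by (auto simp: reach_def)

lemma reach_superset: "S \<subseteq> reach e A S"
  by (auto simp: reach_def)

lemma closed_under_reach: "closed_under e A (reach e A S)"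
  unfolding closed_under_def
proof (intro ballI impI subsetI)
  fix c v assume c: "c \<in> A" "e c \<inter> reach e A S \<noteq> {}" "v \<in> e c"
  show "v \<in> reach e A S"
    unfolding reach_def
  proof (intro InterI)
    fix T assume "T \<in> {T. S \<subseteq> T \<and> closed_under e A T}"
    with c show "v \<in> T"
      using reach_least[of S T e A] by (auto simp: closed_under_def)
  qed
qed

lemma reach_closed: "closed_under e A S \<Longrightarrow> reach e A S = S"
  using reach_least[of S S e A] reach_superset[of S e A] by blast

text \<open>Every closed set containing \<open>S\<close> must absorb an edge that meets
  \<open>S\<close>, and after that the edge imposes no further condition. A revealed edge can thus
  leave the edge set, which drives the induction below.\<close>

lemma reach_insert:
  assumes "e c \<inter> S \<noteq> {}"
  shows "reach e (insert c A) S = reach e A (S \<union> e c)"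
proof
  have "closed_under e (insert c A) (reach e A (S \<union> e c))"
    using closed_under_reach[of e A "S \<union> e c"] reach_superset[of "S \<union> e c" e A]
    by (auto simp: closed_under_def)
  then show "reach e (insert c A) S \<subseteq> reach e A (S \<union> e c)"
    using reach_superset[of "S \<union> e c" e A] by (intro reach_least) auto
  have "closed_under e (insert c A) (reach e (insert c A) S)"
    by (rule closed_under_reach)
  then show "reach e A (S \<union> e c) \<subseteq> reach e (insert c A) S"
    using assms reach_superset[of S e "insert c A"]
    by (intro reach_least) (auto simp: closed_under_def)
qed

text \<open>Reveal one edge that meets \<open>S\<close>. If it is absent, the bound loses a factor \<open>1 + p K\<close>; if it is
  present, \<open>S\<close> gains at most \<open>q\<close> vertices, each of which is met by at most \<open>N\<close> further edges.\<close>

lemma expectation_reach_le: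
  fixes e :: "'c \<Rightarrow> 'v set" and x K p :: real
  assumes "finite A" "finite S"
    and e: "\<And>c. c \<in> A \<Longrightarrow> finite (e c) \<and> card (e c) \<le> Suc q"
    and N: "\<And>v. card {c \<in> A. v \<in> e c} \<le> N"
    and p: "0 \<le> p" "p \<le> 1" and x: "x \<ge> 1" and K: "K \<ge> 0"
    and K': "x ^ q * (1 + p * K) ^ (q * N) \<le> K"
  shows "measure_pmf.expectation (Pi_pmf A False (\<lambda>_. bernoulli_pmf p))
      (\<lambda>f. x ^ card (reach e {c \<in> A. f c} S)) \<le> x ^ card S * (1 + p * K) ^ card {c \<in> A. e c \<inter> S \<noteq> {}}"
  using assms(1,2) e N
\<comment> \<open>Both \<open>A\<close> and \<open>S\<close> vary: a revealed edge leaves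
  \<open>A\<close>, and its vertices may join \<open>S\<close>.\<close>
proof (induction "card A" arbitrary: A S)
  case 0
  then show ?case
    by (auto simp: closed_under_def reach_closed)
next
  case (Suc k)
  let ?Q = "1 + p * K"
  have Q: "?Q \<ge> 1" using p K by simp
  show ?case
  proof (cases "\<exists>c\<in>A. e c \<inter> S \<noteq> {}")
    case False
    then have "reach e {c \<in> A. f c} S = S" for f
      by (intro reach_closed) (auto simp: closed_under_def)
    then show ?thesis
      using x one_le_power[OF Q] by (simp add: mult_le_cancel_left1)
  next
    case True
    then obtain c where c: "c \<in> A" "e c \<inter> S \<noteq> {}" by blast
    define B where "B = A - {c}"
    have A: "A = insert c B" "c \<notin> B" and B: "finite B" "card B = k"
      using c(1) Suc.hyps(2) Suc.prems(1) by (auto simp: B_def)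
    have NB: "card {d \<in> B. v \<in> e d} \<le> N" for v
      using Suc.prems(4)[of v] card_mono[of "{d \<in> A. v \<in> e d}" "{d \<in> B. v \<in> e d}"] Suc.prems(1)
      by (force simp: B_def)
    let ?S' = "S \<union> e c"
    let ?E = "\<lambda>S. measure_pmf.expectation (Pi_pmf B False (\<lambda>_. bernoulli_pmf p))
      (\<lambda>f. x ^ card (reach e {d \<in> B. f d} S))"
    let ?h = "\<lambda>f. x ^ card (reach e {d \<in> A. f d} S)"
    let ?a = "card {d \<in> B. e d \<inter> S \<noteq> {}}"
    have fin: "finite (e c)" "card (e c) \<le> Suc q" using Suc.prems(3) c(1) by auto
    \<comment> \<open>Given the outcome \<open>b\<close> for \<open>c\<close>, the remaining coins
      form the same kind of product over \<open>B\<close>, started at \<open>S\<close> or at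
      \<open>S\<close> joined with \<open>e c\<close>.\<close>
    have rem: "measure_pmf.expectation (Pi_pmf B False (\<lambda>_. bernoulli_pmf p) \<bind>
          (\<lambda>f. return_pmf (f(c := b)))) ?h = ?E (if b then ?S' else S)" for b
    proof -
      have *: "{d \<in> A. (f(c := b)) d} = (if b then insert c {d \<in> B. f d} else {d \<in> B. f d})" for f
        using A by auto
      have "?h (f(c := b)) = x ^ card (reach e {d \<in> B. f d} (if b then ?S' else S))" for f
        unfolding * using reach_insert[of e c S, OF c(2)] by simp
      then show ?thesis by (simp flip: map_pmf_def)
    qed
    have fin_Pi: "finite (set_pmf (Pi_pmf B False (\<lambda>_. bernoulli_pmf p)))"
      unfolding set_Pi_pmf[OF B(1)] using B(1) by (rule finite_PiE_dflt) simp
    have "measure_pmf.expectation (Pi_pmf A False (\<lambda>_. bernoulli_pmf p)) ?h =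
        (\<Sum>b\<in>UNIV. pmf (bernoulli_pmf p) b *\<^sub>R
          measure_pmf.expectation (Pi_pmf B False (\<lambda>_. bernoulli_pmf p) \<bind>
          (\<lambda>f. return_pmf (f(c := b)))) ?h)"
      unfolding A(1) Pi_pmf_insert'[OF B(1) A(2)]
      by (rule pmf_expectation_bind) (use fin_Pi in simp_all)
    also have "\<dots> = p * ?E ?S' + (1 - p) * ?E S"
      unfolding rem using p by (simp add: UNIV_bool)
    also have "?E ?S' \<le> x ^ card ?S' * ?Q ^ card {d \<in> B. e d \<inter> ?S' \<noteq> {}}"
      using B fin Suc.prems NB by (intro Suc.hyps(1)) (auto simp: B_def)
    also have "\<dots> \<le> x ^ (card S + q) * ?Q ^ (?a + q * N)"
    proof (intro mult_mono power_increasing x Q)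
      \<comment> \<open>One vertex of \<open>e c\<close> already lies in \<open>S\<close>, so at
        most \<open>q\<close> of its at most \<open>q + 1\<close> vertices are new.\<close>
      obtain v where v: "v \<in> e c" "v \<in> S" using c(2) by blast
      have new: "card (e c - S) \<le> q"
        using card_mono[of "e c - {v}" "e c - S"] v fin by (simp add: Diff_mono)
      have "?S' = S \<union> (e c - S)" by auto
      then show "card ?S' \<le> card S + q"
        using card_Un_le[of S "e c - S"] new by simp
      have "{d \<in> B. e d \<inter> ?S' \<noteq> {}} \<subseteq>
          {d \<in> B. e d \<inter> S \<noteq> {}} \<union> (\<Union>v\<in>e c - S. {d \<in> B. v \<in> e d})"
        by auto
      then have "card {d \<in> B. e d \<inter> ?S' \<noteq> {}} \<le>
          card ({d \<in> B. e d \<inter> S \<noteq> {}} \<union> (\<Union>v\<in>e c - S. {d \<in> B. v \<in> e d}))"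
        using B(1) fin(1) by (intro card_mono) auto
      also have "\<dots> \<le> ?a + card (\<Union>v\<in>e c - S. {d \<in> B. v \<in> e d})"
        by (rule card_Un_le)
      also have "card (\<Union>v\<in>e c - S. {d \<in> B. v \<in> e d}) \<le> (\<Sum>v\<in>e c - S. card {d \<in> B. v \<in> e d})"
        using fin(1) by (intro card_UN_le) auto
      also have "\<dots> \<le> card (e c - S) * N"
        using sum_bounded_above[of "e c - S" "\<lambda>v. card {d \<in> B. v \<in> e d}" N] NB by simp
      also have "\<dots> \<le> q * N" using new by simp
      finally show "card {d \<in> B. e d \<inter> ?S' \<noteq> {}} \<le> ?a + q * N" by simp
    qed (use x Q in auto)
    also have "\<dots> = (x ^ card S * ?Q ^ ?a) * (x ^ q * ?Q ^ (q * N))"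
      by (simp add: power_add)
    \<comment> \<open>All that a present edge contributes beyond the bound for an absent one is at
      most the factor \<open>K\<close>; this is the purpose of the hypothesis
      \<open>K'\<close>.\<close>
    also have "\<dots> \<le> (x ^ card S * ?Q ^ ?a) * K"
      using K' x Q by (intro mult_left_mono) auto
    also have "?E S \<le> x ^ card S * ?Q ^ ?a"
      using B Suc.prems NB by (intro Suc.hyps(1)) (auto simp: B_def)
    finally have "measure_pmf.expectation (Pi_pmf A False (\<lambda>_. bernoulli_pmf p)) ?h \<le>
        p * (x ^ card S * ?Q ^ ?a * K) + (1 - p) * (x ^ card S * ?Q ^ ?a)"
      using p by (simp add: mult_left_mono)
    also have "\<dots> = x ^ card S * ?Q ^ ?a * (1 - p + p * K)"
      by (simp add: algebra_simps)
    \<comment> \<open>The mixture \<open>1 - p + p K\<close> is at most \<open>1 + p K\<close>, the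
      factor reserved for \<open>c\<close>, which itself meets \<open>S\<close>.\<close>
    also have "\<dots> \<le> x ^ card S * ?Q ^ ?a * ?Q"
      using p x Q by (intro mult_left_mono) auto
    also have "\<dots> = x ^ card S * ?Q ^ Suc ?a" by simp
    also have "Suc ?a = card {d \<in> A. e d \<inter> S \<noteq> {}}"
    proof -
      have "{d \<in> A. e d \<inter> S \<noteq> {}} = insert c {d \<in> B. e d \<inter> S \<noteq> {}}"
        using A c by auto
      then show ?thesis using B A by simp
    qed
    finally show ?thesis .
  qed
qed

section \<open>Counting clauses and choosing the threshold\<close>

lemma finite_all_clauses: "finite V \<Longrightarrow> finite (all_clauses r V)"
proof (rule finite_subset)
  show "all_clauses r V \<subseteq> Pow (V \<times> UNIV)"
    by (force simp: all_clauses_def)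
qed simp

lemma card_sets_of_size_le:
  assumes "finite X"
  shows "card {c. c \<subseteq> X \<and> card c = k} \<le> card X ^ k"
  using n_subsets[OF assms, of k] binomial_le_pow[of k "card X"]
  by (cases "k \<le> card X") (simp_all add: binomial_eq_0)

text \<open>Overcounting by ignoring that the variables are distinct: a clause is a set of
  \<open>r\<close> among \<open>2 n\<close> literals.\<close>

lemma card_all_clauses_le: "card (all_clauses r {..<n}) \<le> (2 * n) ^ r"
proof -
  have "all_clauses r {..<n} \<subseteq> {c. c \<subseteq> {..<n} \<times> UNIV \<and> card c = r}"
    by (force simp: all_clauses_def)
  then have "card (all_clauses r {..<n}) \<le> card {c. c \<subseteq> {..<n} \<times> (UNIV :: bool set) \<and> card c = r}"
    by (intro card_mono) (auto intro: finite_subset[of _ "Pow ({..<n} \<times> UNIV)"])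
  also have "\<dots> \<le> (2 * n) ^ r"
    using card_sets_of_size_le[of "{..<n} \<times> (UNIV :: bool set)" r]
    by (simp add: card_cartesian_product mult.commute)
  finally show ?thesis .
qed

text \<open>Deleting the literal on \<open>v\<close> leaves a set of \<open>r - 1\<close> among
  \<open>2 n\<close> literals, and the deleted literal has two possible signs; the bound is
  \<open>2 * (2 n) ^ (r - 1)\<close>.\<close>

lemma card_all_clauses_through_le:
  assumes "r \<ge> 1"
  shows "card {c \<in> all_clauses r {..<n}. v \<in> fst ` c} \<le> 2 ^ r * n ^ (r - 1)"
proof -
  let ?D = "{d. d \<subseteq> {..<n} \<times> (UNIV :: bool set) \<and> card d = r - 1}"
  have "{c \<in> all_clauses r {..<n}. v \<in> fst ` c} \<subseteq> (\<lambda>(b, d). insert (v, b) d) ` (UNIV \<times> ?D)"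
  proof
    fix c assume "c \<in> {c \<in> all_clauses r {..<n}. v \<in> fst ` c}"
    then obtain b where b: "(v, b) \<in> c" and c: "finite c" "card c = r" "fst ` c \<subseteq> {..<n}"
      by (auto simp: all_clauses_def)
    then have "c = insert (v, b) (c - {(v, b)})" "c - {(v, b)} \<in> ?D"
      by (auto simp: card_Diff_singleton)
    then show "c \<in> (\<lambda>(b, d). insert (v, b) d) ` (UNIV \<times> ?D)" by blast
  qed
  moreover have fin: "finite ?D"
    by (auto intro: finite_subset[of _ "Pow ({..<n} \<times> UNIV)"])
  ultimately have "card {c \<in> all_clauses r {..<n}. v \<in> fst ` c} \<le> card ((UNIV :: bool set) \<times> ?D)"
    by (intro surj_card_le) auto
  also have "\<dots> = 2 * card ?D" by (simp add: card_cartesian_product)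
  also have "card ?D \<le> (2 * n) ^ (r - 1)"
    using card_sets_of_size_le[of "{..<n} \<times> (UNIV :: bool set)" "r - 1"]
    by (simp add: card_cartesian_product mult.commute)
  finally show ?thesis
    using assms by (cases r) (simp_all add: power_mult_distrib)
qed

text \<open>The denominator is \<open>2 ^ r * K * r\<close> with \<open>x = 2 ^ D\<close> and
  \<open>K = 3 * x ^ (r - 1)\<close>. Since \<open>p N = 2 ^ r * \<alpha>\<close>, staying below it
  means that \<open>p N K r\<close> is at most 1; the factor \<open>r\<close> covers the exponents
  \<open>(r - 1) N\<close> and \<open>N\<close> at once.\<close>

definition threshold :: "nat \<Rightarrow> nat \<Rightarrow> real" where
  "threshold r D = 1 / (2 ^ r * (3 * (2 ^ D) ^ (r - 1)) * real r)"

lemma expectation_component_le: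
  fixes r D n v :: nat and \<alpha> :: real
  assumes "r \<ge> 1" "n \<ge> 1" "0 < \<alpha>" "\<alpha> \<le> threshold r D"
  shows "measure_pmf.expectation (random_sat r n (\<alpha> / real n ^ (r - 1)))
      (\<lambda>F. (2 ^ D) ^ card (reach (image fst) (clauses F) {v})) \<le> 3 * (2 :: real) ^ D"
proof -
  define p where "p = \<alpha> / real n ^ (r - 1)"
  define x where "x = (2 :: real) ^ D"
  define K where "K = 3 * x ^ (r - 1)"
  define N where "N = 2 ^ r * n ^ (r - 1)"
  let ?A = "all_clauses r {..<n}"
  have x: "x \<ge> 1" by (simp add: x_def)
  have K: "K \<ge> 1" using one_le_power[OF x, of "r - 1"] unfolding K_def by linarith
  have pN: "p * real N = 2 ^ r * \<alpha>"
    using assms(2) by (simp add: p_def N_def)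
  have "2 ^ r * \<alpha> * K * real r \<le> 2 ^ r * threshold r D * K * real r"
    using assms(4) K by (intro mult_right_mono mult_left_mono) auto
  also have "\<dots> = 1"
    using assms(1) by (simp add: threshold_def K_def x_def field_simps)
  finally have small: "p * N * K * real r \<le> 1" by (simp add: pN)
  have p0: "0 \<le> p" using assms by (simp add: p_def)
  \<comment> \<open>The bound on \<open>p N K r\<close> already makes \<open>p\<close> a
    probability, as the other three factors are at least 1.\<close>
  have p1: "p \<le> 1"
  proof -
    have "1 \<le> N" using assms(2) by (simp add: N_def)
    then have "p * 1 * 1 * 1 \<le> p * N * K * real r"
      using p0 K assms(1,2) by (intro mult_mono) auto
    with small show ?thesis by simp
  qed
  \<comment> \<open>Used with \<open>k = r - 1\<close> for the condition on \<open>K\<close> and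
    with \<open>k = 1\<close> for the edges through the starting vertex.\<close>
  have pow: "(1 + p * K) ^ (k * N) \<le> 3" if "k \<le> r" for k
  proof -
    have "(1 + p * K) ^ (k * N) \<le> exp (p * K) ^ (k * N)"
      using p0 K by (intro power_mono exp_ge_add_one_self) auto
    also have "\<dots> = exp (p * N * K * real k)"
      by (simp add: exp_of_nat_mult[symmetric] mult_ac)
    also have "\<dots> \<le> exp 1"
      using small that p0 K mult_left_mono[of "real k" "real r" "p * N * K"] by simp
    also have "\<dots> \<le> 3" by (rule exp_le)
    finally show ?thesis .
  qed
  have Suc: "Suc (r - 1) = r" using assms(1) by simp
  have "measure_pmf.expectation (random_sat r n p)
      (\<lambda>F. x ^ card (reach (image fst) (clauses F) {v})) =
    measure_pmf.expectation (Pi_pmf ?A False (\<lambda>_. bernoulli_pmf p))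
      (\<lambda>f. x ^ card (reach (image fst) {c \<in> ?A. f c} {v}))"
    by (simp add: random_sat_def)
  also have "\<dots> \<le> x ^ card {v} * (1 + p * K) ^ card {c \<in> ?A. fst ` c \<inter> {v} \<noteq> {}}"
  proof (rule expectation_reach_le[where q = "r - 1" and N = N])
    show "card {c \<in> ?A. w \<in> fst ` c} \<le> N" for w
      using card_all_clauses_through_le[OF assms(1)] by (simp add: N_def)
    show "x ^ (r - 1) * (1 + p * K) ^ ((r - 1) * N) \<le> K"
      using pow[of "r - 1"] x by (simp add: K_def mult.commute)
    show "finite (fst ` c) \<and> card (fst ` c) \<le> Suc (r - 1)" if "c \<in> ?A" for c
      using that card_image_le[of c fst] by (simp add: all_clauses_def Suc)
  qed (use p0 p1 x K in \<open>auto simp: finite_all_clauses\<close>)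
  also have "\<dots> \<le> x * (1 + p * K) ^ (1 * N)"
  proof -
    have "card {c \<in> ?A. fst ` c \<inter> {v} \<noteq> {}} \<le> N"
      using card_all_clauses_through_le[OF assms(1), of n v] by (simp add: N_def)
    then show ?thesis
      using p0 K x by (auto intro!: mult_left_mono power_increasing)
  qed
  also have "\<dots> \<le> x * 3"
    using pow[of 1] assms(1) x by (intro mult_left_mono) auto
  finally show ?thesis by (simp add: x_def p_def mult.commute)
qed

section \<open>A language of bounded loops and its compilation\<close>

text \<open>\<open>Inp\<close> holds the encoded formula, \<open>Flag\<close> marks the current
  component, \<open>Val\<close> is the assignment, \<open>Act\<close> marks the clauses not deleted,
  \<open>Out\<close> collects the output. \<open>Flag\<close> and \<open>Val\<close> are indexed by
  variables, \<open>Act\<close> by clause positions.\<close>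

datatype arr = Inp | Flag | Val | Act | Out

text \<open>\<open>vI\<close> selects the component; \<open>vU\<close>, \<open>vJ\<close>,
  \<open>vK\<close> run through variables, clauses and positions within a clause; \<open>vL\<close>
  counts closure rounds; \<open>vG\<close> is the clause whose deletion is tried; \<open>vP\<close>
  is the length of the output. In the brute-force search \<open>vM\<close> is the number of
  assignments, \<open>vT\<close> the trial, \<open>vQ\<close> its undecoded digits,
  \<open>vB\<close> the best count and \<open>vR\<close> a trial attaining it. \<open>vD\<close>
  serves conditionals, products and halving.\<close>

datatype var = vB | vD | vG | vI | vJ | vK | vL | vM | vP | vQ | vR | vT | vU

text \<open>\<open>Sum\<close> doubles as multiplication and as conditional: summing a constant
  gives a product, and a bound that is 0 or 1 guards its body.\<close>

datatype ex =
    Cst nat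
  | Var var
  | Arr arr ex
  | Add ex ex
  | Sub ex ex
  | Sum var ex ex

datatype cm =
    Set var ex
  | Put arr ex ex
  | Then cm cm (infixr ";;" 60)
  | For var ex cm

type_synonym st = "(var \<Rightarrow> nat) \<times> (arr \<Rightarrow> nat \<Rightarrow> nat)"

definition setv :: "var \<Rightarrow> nat \<Rightarrow> st \<Rightarrow> st" where
  "setv x i s = ((fst s)(x := i), snd s)"

lemma setv_simps [simp]:
  "fst (setv x i s) = (fst s)(x := i)" "snd (setv x i s) = snd s"
  by (simp_all add: setv_def)

primrec ev :: "ex \<Rightarrow> st \<Rightarrow> nat" where
  "ev (Cst k) s = k"
| "ev (Var x) s = fst s x"
| "ev (Arr a e) s = snd s a (ev e s)"
| "ev (Add e f) s = ev e s + ev f s"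
| "ev (Sub e f) s = ev e s - ev f s"
| "ev (Sum x e f) s = (\<Sum>i<ev e s. ev f (setv x i s))"

primrec loop :: "(nat \<Rightarrow> 'a \<Rightarrow> 'a) \<Rightarrow> nat \<Rightarrow> 'a \<Rightarrow> 'a" where
  "loop f 0 s = s"
| "loop f (Suc n) s = f n (loop f n s)"

primrec den :: "cm \<Rightarrow> st \<Rightarrow> st" where
  "den (Set x e) = (\<lambda>s. setv x (ev e s) s)"
| "den (Put a e f) = (\<lambda>s. (fst s, (snd s)(a := (snd s a)(ev e s := ev f s))))"
| "den (c ;; d) = (\<lambda>s. den d (den c s))"
| "den (For x e c) = (\<lambda>s. loop (\<lambda>i s. den c (setv x i s)) (ev e s) s)"

text \<open>\<open>W\<close> limits every loop bound met during evaluation. This is all that the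
  time bound has to know about a run.\<close>

primrec okE :: "nat \<Rightarrow> ex \<Rightarrow> st \<Rightarrow> bool" where
  "okE W (Cst k) s = True"
| "okE W (Var x) s = True"
| "okE W (Arr a e) s = okE W e s"
| "okE W (Add e f) s = (okE W e s \<and> okE W f s)"
| "okE W (Sub e f) s = (okE W e s \<and> okE W f s)"
| "okE W (Sum x e f) s =
     (okE W e s \<and> ev e s \<le> W \<and> (\<forall>i<ev e s. okE W f (setv x i s)))"

primrec ok :: "nat \<Rightarrow> cm \<Rightarrow> st \<Rightarrow> bool" where
  "ok W (Set x e) = (\<lambda>s. okE W e s)"
| "ok W (Put a e f) = (\<lambda>s. okE W e s \<and> okE W f s)"
| "ok W (c ;; d) = (\<lambda>s. ok W c s \<and> ok W d (den c s))"
| "ok W (For x e c) = (\<lambda>s. okE W e s \<and> ev e s \<le> W \<and>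
     (\<forall>i<ev e s. ok W c (setv x i (loop (\<lambda>i s. den c (setv x i s)) i s))))"

section \<open>Compilation to the random access machine\<close>

fun code :: "arr \<Rightarrow> nat" where
  "code Inp = 0" | "code Flag = 1" | "code Val = 2" | "code Act = 3" | "code Out = 4"

fun vname :: "var \<Rightarrow> string" where
  "vname vB = ''B''" | "vname vD = ''D''" | "vname vG = ''G''" | "vname vI = ''I''"
| "vname vJ = ''J''" | "vname vK = ''K''" | "vname vL = ''L''" | "vname vM = ''M''"
| "vname vP = ''P''" | "vname vQ = ''Q''" | "vname vR = ''R''" | "vname vT = ''T''"
| "vname vU = ''U''"

text \<open>An unbounded supply of registers indexed by nesting depth; the names are built from one
  lower-case letter, which keeps them apart from the program variables and from
  \<open>base\<close>.\<close>

definition temp :: "nat \<Rightarrow> string" where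
  "temp d = CHR ''t'' # replicate d CHR ''t''"

abbreviation base :: string where "base \<equiv> ''base''"

lemma tmp_inj [simp]: "temp d = temp e \<longleftrightarrow> d = e"
  by (auto simp: temp_def dest: arg_cong[where f = length])

lemma vname_inj [simp]: "vname x = vname y \<longleftrightarrow> x = y"
  by (cases x; cases y) auto

lemma tmp_vname [simp]: "temp d \<noteq> vname x" "vname x \<noteq> temp d"
  by (cases x; simp add: temp_def)+

lemma tmp_base [simp]: "temp d \<noteq> base" "base \<noteq> temp d"
  by (simp_all add: temp_def)

lemma vname_base [simp]: "vname x \<noteq> base" "base \<noteq> vname x"
  by (cases x; simp)+

lemma code_less: "code a < 8"
  by (cases a) auto

lemma code_inj: "code a = code b \<longleftrightarrow> a = b"
  by (cases a; cases b) auto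

lemma addr_inj: "8 * i + code a = 8 * j + code b \<longleftrightarrow> i = j \<and> a = b"
proof
  assume eq: "8 * i + code a = 8 * j + code b"
  from eq have "i = j"
    using code_less[of a] code_less[of b] by linarith
  with eq show "i = j \<and> a = b" by (simp add: code_inj)
qed simp

text \<open>Three doublings multiply the index by 8, a power of two above all array codes, so the
  arrays interleave without a multiplication instruction.\<close>

definition addr :: "arr \<Rightarrow> string \<Rightarrow> aexp" where
  "addr a y = (let e = Plus (Reg y) (Reg y); f = Plus e e
     in Plus (Reg base) (Plus (Plus f f) (Const (code a))))"

lemma aval_addr [simp]: "aval (addr a y) s = fst s base + (8 * fst s y + code a)"
  by (simp add: addr_def Let_def)

lemma acost_addr [simp]: "acost (addr a y) = 19"
  by (simp add: addr_def Let_def)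

text \<open>The value ends up in \<open>temp d\<close>, and only temporaries from \<open>d\<close>
  upwards are used. For \<open>Sum\<close> these hold in turn the bound, the accumulator, the
  counter and the saved summation variable, which is restored at the end so that expressions have no
  side effects.\<close>

fun compileE :: "nat \<Rightarrow> ex \<Rightarrow> com" where
  "compileE d (Cst k) = Assign (temp d) (Const k)"
| "compileE d (Var x) = Assign (temp d) (Reg (vname x))"
| "compileE d (Arr a e) = Seq (compileE d e) (Assign (temp d) (Mem (addr a (temp d))))"
| "compileE d (Add e f) = Seq (compileE d e) (Seq (compileE (d + 1) f)
     (Assign (temp d) (Plus (Reg (temp d)) (Reg (temp (d + 1))))))"
| "compileE d (Sub e f) = Seq (compileE d e) (Seq (compileE (d + 1) f)
     (Assign (temp d) (Minus (Reg (temp d)) (Reg (temp (d + 1))))))"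
| "compileE d (Sum x e f) = Seq (compileE d e) (Seq (Assign (temp (d + 1)) (Const 0))
     (Seq (Assign (temp (d + 2)) (Const 0)) (Seq (Assign (temp (d + 3)) (Reg (vname x)))
     (Seq (While (Minus (Reg (temp d)) (Reg (temp (d + 2))))
        (Seq (Assign (vname x) (Reg (temp (d + 2)))) (Seq (compileE (d + 4) f)
        (Seq (Assign (temp (d + 1)) (Plus (Reg (temp (d + 1))) (Reg (temp (d + 4)))))
        (Assign (temp (d + 2)) (Plus (Reg (temp (d + 2))) (Const 1)))))))
     (Seq (Assign (vname x) (Reg (temp (d + 3)))) (Assign (temp d) (Reg (temp (d + 1)))))))))"

text \<open>Bound and counter live in temporaries, so a body may overwrite the loop variable without
  changing the number of rounds, in agreement with \<open>loop\<close>.\<close>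

fun compileC :: "nat \<Rightarrow> cm \<Rightarrow> com" where
  "compileC d (Set x e) = Seq (compileE d e) (Assign (vname x) (Reg (temp d)))"
| "compileC d (Put a e f) = Seq (compileE d e) (Seq (compileE (d + 1) f)
     (Store (addr a (temp d)) (Reg (temp (d + 1)))))"
| "compileC d (c ;; c') = Seq (compileC d c) (compileC d c')"
| "compileC d (For x e c) = Seq (compileE d e) (Seq (Assign (temp (d + 1)) (Const 0))
     (While (Minus (Reg (temp d)) (Reg (temp (d + 1))))
        (Seq (Assign (vname x) (Reg (temp (d + 1)))) (Seq (compileC (d + 2) c)
        (Assign (temp (d + 1)) (Plus (Reg (temp (d + 1))) (Const 1)))))))"

fun timeE :: "ex \<Rightarrow> nat \<Rightarrow> nat" where
  "timeE (Cst k) W = 2"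
| "timeE (Var x) W = 2"
| "timeE (Arr a e) W = timeE e W + 21"
| "timeE (Add e f) W = timeE e W + timeE f W + 4"
| "timeE (Sub e f) W = timeE e W + timeE f W + 4"
| "timeE (Sum x e f) W = timeE e W + W * (timeE f W + 14) + 14"

fun timeC :: "cm \<Rightarrow> nat \<Rightarrow> nat" where
  "timeC (Set x e) W = timeE e W + 2"
| "timeC (Put a e f) W = timeE e W + timeE f W + 21"
| "timeC (c ;; c') W = timeC c W + timeC c' W"
| "timeC (For x e c) W = timeE e W + W * (timeC c W + 10) + 6"

text \<open>Temporaries and memory below \<open>base\<close> are unconstrained, so that evaluating
  an expression preserves the relation.\<close>

definition rel :: "st \<Rightarrow> state \<Rightarrow> bool" where
  "rel s \<sigma> \<longleftrightarrow> (\<forall>x. fst \<sigma> (vname x) = fst s x) \<and>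
     (\<forall>a i. snd \<sigma> (fst \<sigma> base + (8 * i + code a)) = snd s a i)"

lemma exec_Assign: "s' = ((fst s)(x := aval a s), snd s) \<Longrightarrow> t = acost a + 1 \<Longrightarrow> exec (Assign x a) s t s'"
  using exec.Assign by simp

definition keeps :: "nat \<Rightarrow> state \<Rightarrow> state \<Rightarrow> bool" where
  "keeps d \<sigma> \<sigma>' \<longleftrightarrow> snd \<sigma>' = snd \<sigma> \<and> (\<forall>y. (\<forall>j\<ge>d. y \<noteq> temp j) \<longrightarrow> fst \<sigma>' y = fst \<sigma> y)"

lemma keepsD:
  assumes "keeps d \<sigma> \<sigma>'"
  shows "snd \<sigma>' = snd \<sigma>" "fst \<sigma>' (vname x) = fst \<sigma> (vname x)" "fst \<sigma>' base = fst \<sigma> base"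
    "j < d \<Longrightarrow> fst \<sigma>' (temp j) = fst \<sigma> (temp j)"
  using assms by (auto simp: keeps_def)

lemma keeps_trans: "keeps d \<sigma> \<sigma>' \<Longrightarrow> keeps d' \<sigma>' \<sigma>'' \<Longrightarrow> d \<le> d' \<Longrightarrow> keeps d \<sigma> \<sigma>''"
  by (auto simp: keeps_def)

lemma keeps_upd: "d \<le> j \<Longrightarrow> keeps d \<sigma> ((fst \<sigma>)(temp j := k), snd \<sigma>)"
  by (auto simp: keeps_def)

lemma rel_keeps: "rel s \<sigma> \<Longrightarrow> keeps d \<sigma> \<sigma>' \<Longrightarrow> rel s \<sigma>'"
  by (simp add: rel_def keepsD)

lemma rel_setv: "rel s \<sigma> \<Longrightarrow> rel (setv x i s) ((fst \<sigma>)(vname x := i), snd \<sigma>)"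
  by (auto simp: rel_def)

lemma exec_compileE:
  assumes "rel s \<sigma>" "okE W e s"
  shows "\<exists>t \<sigma>'. exec (compileE d e) \<sigma> t \<sigma>' \<and> t \<le> timeE e W \<and> fst \<sigma>' (temp d) = ev e s \<and> keeps d \<sigma> \<sigma>'"
  using assms
proof (induction e arbitrary: d s \<sigma>)
  case (Cst k)
  have "exec (compileE d (Cst k)) \<sigma> 2 ((fst \<sigma>)(temp d := k), snd \<sigma>)"
    by (auto intro: exec_Assign)
  moreover have "keeps d \<sigma> ((fst \<sigma>)(temp d := k), snd \<sigma>)"
    by (simp add: keeps_upd)
  ultimately show ?case
    by (intro exI[of _ 2] exI[of _ "((fst \<sigma>)(temp d := k), snd \<sigma>)"]) simp
next
  case (Var x)
  have "exec (compileE d (Var x)) \<sigma> 2 ((fst \<sigma>)(temp d := fst \<sigma> (vname x)), snd \<sigma>)"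
    by (auto intro: exec_Assign)
  moreover have "keeps d \<sigma> ((fst \<sigma>)(temp d := fst \<sigma> (vname x)), snd \<sigma>)"
    by (simp add: keeps_upd)
  ultimately show ?case using Var
    by (intro exI[of _ 2] exI[of _ "((fst \<sigma>)(temp d := fst \<sigma> (vname x)), snd \<sigma>)"])
      (simp add: rel_def)
next
  case (Arr a e)
  from Arr.IH Arr.prems obtain t \<sigma>1 where 1: "exec (compileE d e) \<sigma> t \<sigma>1" "t \<le> timeE e W" "fst \<sigma>1 (temp d) = ev e s" "keeps d \<sigma> \<sigma>1"
    by (metis okE.simps(3))
  let ?\<sigma>2 = "((fst \<sigma>1)(temp d := ev (Arr a e) s), snd \<sigma>1)"
  have "exec (compileE d (Arr a e)) \<sigma> (t + 21) ?\<sigma>2"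
    unfolding compileE.simps
    by (rule exec.Seq[OF 1(1)], rule exec_Assign)
      (use Arr.prems 1 in \<open>auto simp: rel_def keepsD\<close>)
  moreover have "keeps d \<sigma> ?\<sigma>2"
    using 1(4) keeps_upd keeps_trans by blast
  ultimately show ?case
    using 1(2) by (intro exI[of _ "t + 21"] exI[of _ ?\<sigma>2]) auto
next
  case (Add e f)
  from Add.IH(1) Add.prems obtain t \<sigma>1 where 1: "exec (compileE d e) \<sigma> t \<sigma>1" "t \<le> timeE e W" "fst \<sigma>1 (temp d) = ev e s" "keeps d \<sigma> \<sigma>1"
    by (metis okE.simps(4))
  then have "rel s \<sigma>1" using Add.prems rel_keeps by blast
  with Add.IH(2) Add.prems obtain u \<sigma>2 where 2: "exec (compileE (d + 1) f) \<sigma>1 u \<sigma>2" "u \<le> timeE f W"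
      "fst \<sigma>2 (temp (d + 1)) = ev f s" "keeps (d + 1) \<sigma>1 \<sigma>2"
    by (metis okE.simps(4))
  let ?\<sigma>3 = "((fst \<sigma>2)(temp d := ev (Add e f) s), snd \<sigma>2)"
  have "exec (compileE d (Add e f)) \<sigma> (t + (u + 4)) ?\<sigma>3"
    unfolding compileE.simps
    by (rule exec.Seq[OF 1(1)], rule exec.Seq[OF 2(1)], rule exec_Assign)
      (use 1 2 keepsD(4)[OF 2(4), of d] in auto)
  moreover have "keeps d \<sigma> ?\<sigma>3"
    using keeps_trans[OF keeps_trans[OF 1(4) 2(4)] keeps_upd[of d d]] by simp
  ultimately show ?case
    using 1(2) 2(2) by (intro exI[of _ "t + (u + 4)"] exI[of _ ?\<sigma>3]) auto
next
  case (Sub e f)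
  from Sub.IH(1) Sub.prems obtain t \<sigma>1 where 1: "exec (compileE d e) \<sigma> t \<sigma>1" "t \<le> timeE e W" "fst \<sigma>1 (temp d) = ev e s" "keeps d \<sigma> \<sigma>1"
    by (metis okE.simps(5))
  then have "rel s \<sigma>1" using Sub.prems rel_keeps by blast
  with Sub.IH(2) Sub.prems obtain u \<sigma>2 where 2: "exec (compileE (d + 1) f) \<sigma>1 u \<sigma>2" "u \<le> timeE f W"
      "fst \<sigma>2 (temp (d + 1)) = ev f s" "keeps (d + 1) \<sigma>1 \<sigma>2"
    by (metis okE.simps(5))
  let ?\<sigma>3 = "((fst \<sigma>2)(temp d := ev (Sub e f) s), snd \<sigma>2)"
  have "exec (compileE d (Sub e f)) \<sigma> (t + (u + 4)) ?\<sigma>3"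
    unfolding compileE.simps
    by (rule exec.Seq[OF 1(1)], rule exec.Seq[OF 2(1)], rule exec_Assign)
      (use 1 2 keepsD(4)[OF 2(4), of d] in auto)
  moreover have "keeps d \<sigma> ?\<sigma>3"
    using keeps_trans[OF keeps_trans[OF 1(4) 2(4)] keeps_upd[of d d]] by simp
  ultimately show ?case
    using 1(2) 2(2) by (intro exI[of _ "t + (u + 4)"] exI[of _ ?\<sigma>3]) auto
next
  case (Sum x e f)
  from Sum.IH(1) Sum.prems obtain t \<sigma>1 where 1: "exec (compileE d e) \<sigma> t \<sigma>1" "t \<le> timeE e W" "fst \<sigma>1 (temp d) = ev e s" "keeps d \<sigma> \<sigma>1"
    by (metis okE.simps(6))
  let ?n = "ev e s"
  let ?v = "\<lambda>i. ev f (setv x i s)"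
  \<comment> \<open>Inside the loop the summation variable changes as well, while the bound and the
    saved value stay put.\<close>
  define keepsx where "keepsx \<tau> \<longleftrightarrow> snd \<tau> = snd \<sigma> \<and> fst \<tau> (temp d) = ?n \<and>
    fst \<tau> (temp (d + 3)) = fst s x \<and>
    (\<forall>y. (\<forall>j\<ge>d. y \<noteq> temp j) \<and> y \<noteq> vname x \<longrightarrow> fst \<tau> y = fst \<sigma> y)" for \<tau> :: state
  let ?cond = "Minus (Reg (temp d)) (Reg (temp (d + 2)))"
  let ?body = "Seq (Assign (vname x) (Reg (temp (d + 2)))) (Seq (compileE (d + 4) f)
        (Seq (Assign (temp (d + 1)) (Plus (Reg (temp (d + 1))) (Reg (temp (d + 4)))))
        (Assign (temp (d + 2)) (Plus (Reg (temp (d + 2))) (Const 1)))))"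
  \<comment> \<open>\<open>k\<close> counts the remaining iterations, so the counter stands at
    \<open>?n - k\<close>.\<close>
  have while: "\<exists>u \<tau>'. exec (While ?cond ?body) \<tau> u \<tau>' \<and> u \<le> k * (timeE f W + 14) + 4 \<and>
      fst \<tau>' (temp (d + 1)) = (\<Sum>i<?n. ?v i) \<and> keepsx \<tau>'"
    if "keepsx \<tau>" "fst \<tau> (temp (d + 2)) = ?n - k" "k \<le> ?n" "fst \<tau> (temp (d + 1)) = (\<Sum>i<?n - k. ?v i)"
    for k \<tau>
    using that
  proof (induction k arbitrary: \<tau>)
    case 0
    have "exec (While ?cond ?body) \<tau> (acost ?cond + 1) \<tau>"
      by (rule exec.WhileFalse) (use 0 in \<open>auto simp: keepsx_def\<close>)
    then show ?case using 0 by (intro exI[of _ "acost ?cond + 1"] exI[of _ \<tau>]) simp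
  next
    case (Suc k)
    let ?i = "?n - Suc k"
    have i: "?i < ?n" "Suc ?i = ?n - k" using Suc.prems(3) by auto
    let ?\<tau>1 = "((fst \<tau>)(vname x := ?i), snd \<tau>)"
    have "rel (setv x ?i s) ?\<tau>1"
      using Sum.prems(1) Suc.prems(1) by (auto simp: rel_def keepsx_def)
    moreover have "okE W f (setv x ?i s)" using Sum.prems(2) i by simp
    ultimately obtain u \<tau>2 where 2: "exec (compileE (d + 4) f) ?\<tau>1 u \<tau>2" "u \<le> timeE f W"
        "fst \<tau>2 (temp (d + 4)) = ?v ?i" "keeps (d + 4) ?\<tau>1 \<tau>2"
      using Sum.IH(2) by blast
    let ?\<tau>3 = "((fst \<tau>2)(temp (d + 1) := (\<Sum>i<?n - k. ?v i)), snd \<tau>2)"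
    let ?\<tau>4 = "((fst ?\<tau>3)(temp (d + 2) := ?n - k), snd ?\<tau>3)"
    have t: "fst \<tau>2 (temp (d + j)) = fst \<tau> (temp (d + j))" if "j < 4" for j
      using keepsD(4)[OF 2(4), of "d + j"] that by simp
    have "exec ?body \<tau> (2 + (u + (4 + 4))) ?\<tau>4"
      apply (rule exec.Seq)
       apply (rule exec_Assign[of ?\<tau>1])
        apply (use Suc.prems in simp)
       apply simp
      apply (rule exec.Seq[OF 2(1)])
      apply (rule exec.Seq)
       apply (rule exec_Assign[of ?\<tau>3])
        apply (use Suc.prems(4) 2(3) t[of 1] i in \<open>simp flip: i(2)\<close>)
       apply simp
      apply (rule exec_Assign)
       apply (use Suc.prems(2) t[of 2] i in simp)
      apply simp
      done
    moreover have "keepsx ?\<tau>4"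
      using Suc.prems(1) 2(4) t[of 0] t[of 3] by (auto simp: keepsx_def keeps_def)
    ultimately obtain u' \<tau>' where 3: "exec (While ?cond ?body) ?\<tau>4 u' \<tau>'" "u' \<le> k * (timeE f W + 14) + 4"
      "fst \<tau>' (temp (d + 1)) = (\<Sum>i<?n. ?v i)" "keepsx \<tau>'"
      using Suc.IH[of ?\<tau>4] Suc.prems(3) by auto
    have "exec (While ?cond ?body) \<tau> (acost ?cond + 1 + (2 + (u + (4 + 4))) + u') \<tau>'"
      by (rule exec.WhileTrue[OF _ \<open>exec ?body \<tau> _ ?\<tau>4\<close> 3(1)])
        (use Suc.prems i in \<open>auto simp: keepsx_def\<close>)
    then show ?case using 2(2) 3(2-)
      by (intro exI[of _ "acost ?cond + 1 + (2 + (u + (4 + 4))) + u'"] exI[of _ \<tau>']) simp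
  qed
  let ?\<tau>1 = "((fst \<sigma>1)(temp (d + 1) := 0), snd \<sigma>1)"
  let ?\<tau>2 = "((fst ?\<tau>1)(temp (d + 2) := 0), snd ?\<tau>1)"
  let ?\<tau>3 = "((fst ?\<tau>2)(temp (d + 3) := fst s x), snd ?\<tau>2)"
  have "keepsx ?\<tau>3"
    using 1(3,4) by (auto simp: keepsx_def keeps_def)
  then obtain u \<tau>4 where 4: "exec (While ?cond ?body) ?\<tau>3 u \<tau>4" "u \<le> ?n * (timeE f W + 14) + 4"
      "fst \<tau>4 (temp (d + 1)) = (\<Sum>i<?n. ?v i)" "keepsx \<tau>4"
    using while[of ?\<tau>3 ?n] by auto
  let ?\<tau>5 = "((fst \<tau>4)(vname x := fst s x), snd \<tau>4)"
  let ?\<tau>6 = "((fst ?\<tau>5)(temp d := (\<Sum>i<?n. ?v i)), snd ?\<tau>5)"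
  have "exec (compileE d (Sum x e f)) \<sigma> (t + (2 + (2 + (2 + (u + (2 + 2)))))) ?\<tau>6"
    unfolding compileE.simps
    apply (rule exec.Seq[OF 1(1)])
    apply (rule exec.Seq)
     apply (rule exec_Assign[of ?\<tau>1]; simp)
    apply (rule exec.Seq)
     apply (rule exec_Assign[of ?\<tau>2]; simp)
    apply (rule exec.Seq)
     apply (rule exec_Assign[of ?\<tau>3])
      apply (use Sum.prems(1) 1(4) in \<open>simp add: keepsD rel_def\<close>)
     apply simp
    apply (rule exec.Seq[OF 4(1)])
    apply (rule exec.Seq)
     apply (rule exec_Assign[of ?\<tau>5])
      apply (use 4(4) in \<open>simp add: keepsx_def\<close>)
     apply simp
    apply (rule exec_Assign)
     apply (use 4(3) in simp)
    apply simp
    done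
  moreover have "keeps d \<sigma> ?\<tau>6"
    using 4(4) Sum.prems(1) by (auto simp: keepsx_def keeps_def rel_def)
  moreover have "?n * (timeE f W + 14) \<le> W * (timeE f W + 14)"
    using Sum.prems(2) by (intro mult_right_mono) auto
  with 4(2) have "u \<le> W * (timeE f W + 14) + 4" by linarith
  ultimately show ?case
    using 1(2) by (intro exI[of _ "t + (2 + (2 + (2 + (u + (2 + 2)))))"] exI[of _ ?\<tau>6]) auto
qed

lemma exec_compileC:
  assumes "rel s \<sigma>" "ok W c s"
  shows "\<exists>t \<sigma>'. exec (compileC d c) \<sigma> t \<sigma>' \<and> t \<le> timeC c W \<and> rel (den c s) \<sigma>' \<and>
    fst \<sigma>' base = fst \<sigma> base \<and> (\<forall>j<d. fst \<sigma>' (temp j) = fst \<sigma> (temp j))"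
  using assms
proof (induction c arbitrary: d s \<sigma>)
  case (Set x e)
  then obtain t \<sigma>1 where 1: "exec (compileE d e) \<sigma> t \<sigma>1" "t \<le> timeE e W" "fst \<sigma>1 (temp d) = ev e s" "keeps d \<sigma> \<sigma>1"
    using exec_compileE[of s \<sigma> W e d] by auto
  let ?\<sigma>2 = "((fst \<sigma>1)(vname x := ev e s), snd \<sigma>1)"
  have "exec (compileC d (Set x e)) \<sigma> (t + 2) ?\<sigma>2"
    unfolding compileC.simps by (rule exec.Seq[OF 1(1)], rule exec_Assign) (use 1 in auto)
  moreover have "rel (den (Set x e) s) ?\<sigma>2"
    using Set.prems 1(4) by (simp add: rel_setv rel_keeps)
  ultimately show ?case
    using 1 by (intro exI[of _ "t + 2"] exI[of _ ?\<sigma>2]) (auto simp: keepsD)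
next
  case (Put a e f)
  then obtain t \<sigma>1 where 1: "exec (compileE d e) \<sigma> t \<sigma>1" "t \<le> timeE e W" "fst \<sigma>1 (temp d) = ev e s" "keeps d \<sigma> \<sigma>1"
    using exec_compileE[of s \<sigma> W e d] by auto
  then have "rel s \<sigma>1" using Put.prems rel_keeps by blast
  with Put obtain u \<sigma>2 where 2: "exec (compileE (d + 1) f) \<sigma>1 u \<sigma>2" "u \<le> timeE f W"
      "fst \<sigma>2 (temp (d + 1)) = ev f s" "keeps (d + 1) \<sigma>1 \<sigma>2"
    using exec_compileE[of s \<sigma>1 W f "d + 1"] by auto
  have r: "rel s \<sigma>2" and k: "keeps d \<sigma> \<sigma>2"
    using \<open>rel s \<sigma>1\<close> 2(4) rel_keeps keeps_trans[OF 1(4) 2(4)] by auto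
  have d: "fst \<sigma>2 (temp d) = ev e s" using keepsD(4)[OF 2(4)] 1(3) by simp
  let ?\<sigma>3 = "(fst \<sigma>2, (snd \<sigma>2)(aval (addr a (temp d)) \<sigma>2 := aval (Reg (temp (d + 1))) \<sigma>2))"
  have "exec (compileC d (Put a e f)) \<sigma> (t + (u + (acost (addr a (temp d)) + acost (Reg (temp (d + 1))) + 1))) ?\<sigma>3"
    unfolding compileC.simps
    by (rule exec.Seq[OF 1(1)], rule exec.Seq[OF 2(1)], rule exec.Store)
  moreover have "rel (den (Put a e f) s) ?\<sigma>3"
    using r 2(3) d addr_inj by (auto simp: rel_def)
  ultimately show ?case
    using 1(2) 2(2) keepsD[OF k]
    by (intro exI[of _ "t + (u + (acost (addr a (temp d)) + acost (Reg (temp (d + 1))) + 1))"]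
        exI[of _ ?\<sigma>3]) auto
next
  case (Then c c')
  from Then.IH(1) Then.prems obtain t \<sigma>1 where 1: "exec (compileC d c) \<sigma> t \<sigma>1" "t \<le> timeC c W" "rel (den c s) \<sigma>1"
      "fst \<sigma>1 base = fst \<sigma> base" "\<forall>j<d. fst \<sigma>1 (temp j) = fst \<sigma> (temp j)"
    by (metis ok.simps(3))
  with Then.IH(2) Then.prems obtain u \<sigma>2 where 2: "exec (compileC d c') \<sigma>1 u \<sigma>2" "u \<le> timeC c' W" "rel (den c' (den c s)) \<sigma>2"
      "fst \<sigma>2 base = fst \<sigma>1 base" "\<forall>j<d. fst \<sigma>2 (temp j) = fst \<sigma>1 (temp j)"
    by (metis ok.simps(3))
  have "exec (compileC d (c ;; c')) \<sigma> (t + u) \<sigma>2"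
    using 1(1) 2(1) by (auto intro: exec.Seq)
  then show ?case
    using 1 2 by (intro exI[of _ "t + u"] exI[of _ \<sigma>2]) auto
next
  case (For x e c)
  then obtain t \<sigma>1 where 1: "exec (compileE d e) \<sigma> t \<sigma>1" "t \<le> timeE e W" "fst \<sigma>1 (temp d) = ev e s" "keeps d \<sigma> \<sigma>1"
    using exec_compileE[of s \<sigma> W e d] by auto
  let ?n = "ev e s"
  let ?l = "\<lambda>i. loop (\<lambda>i s. den c (setv x i s)) i s"
  define good where "good i \<tau> \<longleftrightarrow> rel (?l i) \<tau> \<and> fst \<tau> (temp d) = ?n \<and> fst \<tau> base = fst \<sigma> base \<and>
    (\<forall>j<d. fst \<tau> (temp j) = fst \<sigma> (temp j))" for i and \<tau> :: state
  let ?cond = "Minus (Reg (temp d)) (Reg (temp (d + 1)))"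
  let ?body = "Seq (Assign (vname x) (Reg (temp (d + 1)))) (Seq (compileC (d + 2) c)
        (Assign (temp (d + 1)) (Plus (Reg (temp (d + 1))) (Const 1))))"
  have while: "\<exists>u \<tau>'. exec (While ?cond ?body) \<tau> u \<tau>' \<and> u \<le> k * (timeC c W + 10) + 4 \<and> good ?n \<tau>'"
    if "good (?n - k) \<tau>" "fst \<tau> (temp (d + 1)) = ?n - k" "k \<le> ?n"
    for k \<tau>
    using that
  proof (induction k arbitrary: \<tau>)
    case 0
    have "exec (While ?cond ?body) \<tau> (acost ?cond + 1) \<tau>"
      by (rule exec.WhileFalse) (use 0 in \<open>auto simp: good_def\<close>)
    then show ?case using 0 by (intro exI[of _ "acost ?cond + 1"] exI[of _ \<tau>]) simp
  next
    case (Suc k)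
    let ?i = "?n - Suc k"
    have i: "?i < ?n" "Suc ?i = ?n - k" using Suc.prems(3) by auto
    let ?\<tau>1 = "((fst \<tau>)(vname x := ?i), snd \<tau>)"
    have "rel (setv x ?i (?l ?i)) ?\<tau>1"
      using Suc.prems(1) by (simp add: good_def rel_setv)
    moreover have "ok W c (setv x ?i (?l ?i))" using For.prems(2) i by simp
    ultimately obtain u \<tau>2 where 2: "exec (compileC (d + 2) c) ?\<tau>1 u \<tau>2" "u \<le> timeC c W"
        "rel (den c (setv x ?i (?l ?i))) \<tau>2"
        "fst \<tau>2 base = fst ?\<tau>1 base" "\<forall>j<d + 2. fst \<tau>2 (temp j) = fst ?\<tau>1 (temp j)"
      using For.IH by blast
    let ?\<tau>3 = "((fst \<tau>2)(temp (d + 1) := ?n - k), snd \<tau>2)"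
    have "exec ?body \<tau> (2 + (u + 4)) ?\<tau>3"
      apply (rule exec.Seq)
       apply (rule exec_Assign[of ?\<tau>1])
        apply (use Suc.prems in simp)
       apply simp
      apply (rule exec.Seq[OF 2(1)])
      apply (rule exec_Assign)
       apply (use Suc.prems(2) 2(5) i in simp)
      apply simp
      done
    moreover have "good (?n - k) ?\<tau>3"
      using Suc.prems(1) 2(3-5) by (auto simp: good_def rel_def simp flip: i(2))
    ultimately obtain u' \<tau>' where 3: "exec (While ?cond ?body) ?\<tau>3 u' \<tau>'"
        "u' \<le> k * (timeC c W + 10) + 4" "good ?n \<tau>'"
      using Suc.IH[of ?\<tau>3] Suc.prems(3) by auto
    have "exec (While ?cond ?body) \<tau> (acost ?cond + 1 + (2 + (u + 4)) + u') \<tau>'"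
      by (rule exec.WhileTrue[OF _ \<open>exec ?body \<tau> _ ?\<tau>3\<close> 3(1)])
        (use Suc.prems i in \<open>auto simp: good_def\<close>)
    then show ?case using 2(2) 3(2-)
      by (intro exI[of _ "acost ?cond + 1 + (2 + (u + 4)) + u'"] exI[of _ \<tau>']) simp
  qed
  let ?\<tau>1 = "((fst \<sigma>1)(temp (d + 1) := 0), snd \<sigma>1)"
  have "keeps d \<sigma> ?\<tau>1"
    using keeps_trans[OF 1(4) keeps_upd[of d "d + 1"]] by simp
  then have "good 0 ?\<tau>1"
    using 1(3) For.prems(1) rel_keeps[OF For.prems(1)] keepsD[OF 1(4)] by (simp add: good_def)
  then obtain u \<tau>2 where 2: "exec (While ?cond ?body) ?\<tau>1 u \<tau>2" "u \<le> ?n * (timeC c W + 10) + 4" "good ?n \<tau>2"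
    using while[of ?n ?\<tau>1] by auto
  have "exec (compileC d (For x e c)) \<sigma> (t + (2 + u)) \<tau>2"
    unfolding compileC.simps
    apply (rule exec.Seq[OF 1(1)])
    apply (rule exec.Seq)
     apply (rule exec_Assign[of ?\<tau>1]; simp)
    apply (rule 2(1))
    done
  moreover have "?n * (timeC c W + 10) \<le> W * (timeC c W + 10)"
    using For.prems(2) by (intro mult_right_mono) auto
  with 2(2) have "u \<le> W * (timeC c W + 10) + 4" by linarith
  ultimately show ?case
    using 1(2) 2(3) by (intro exI[of _ "t + (2 + u)"] exI[of _ \<tau>2]) (auto simp: good_def)
qed

section \<open>Polynomial bounds for compiled programs\<close>

definition poly_bounded :: "(nat \<Rightarrow> nat) \<Rightarrow> bool" where
  "poly_bounded f \<longleftrightarrow> (\<exists>C D. \<forall>W. f W \<le> C * (W + 1) ^ D)"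

lemma poly_bounded_const: "poly_bounded (\<lambda>W. c)"
  unfolding poly_bounded_def by (intro exI[of _ c] exI[of _ 0]) simp

lemma poly_bounded_id: "poly_bounded (\<lambda>W. W)"
  unfolding poly_bounded_def by (intro exI[of _ 1]) simp

lemma poly_bounded_mult:
  assumes "poly_bounded f" "poly_bounded g"
  shows "poly_bounded (\<lambda>W. f W * g W)"
proof -
  from assms obtain C D C' D' where "\<And>W. f W \<le> C * (W + 1) ^ D" "\<And>W. g W \<le> C' * (W + 1) ^ D'"
    unfolding poly_bounded_def by blast
  then have "f W * g W \<le> (C * C') * (W + 1) ^ (D + D')" for W
    using mult_mono[of "f W" "C * (W + 1) ^ D" "g W" "C' * (W + 1) ^ D'"]
    by (simp add: power_add ac_simps)
  then show ?thesis unfolding poly_bounded_def by blast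
qed

lemma poly_bounded_add:
  assumes "poly_bounded f" "poly_bounded g"
  shows "poly_bounded (\<lambda>W. f W + g W)"
proof -
  from assms obtain C D C' D' where *: "\<And>W. f W \<le> C * (W + 1) ^ D" "\<And>W. g W \<le> C' * (W + 1) ^ D'"
    unfolding poly_bounded_def by blast
  have "f W + g W \<le> (C + C') * (W + 1) ^ (D + D')" for W
  proof -
    have "C * (W + 1) ^ D \<le> C * (W + 1) ^ (D + D')" "C' * (W + 1) ^ D' \<le> C' * (W + 1) ^ (D + D')"
      by (intro mult_left_mono power_increasing; simp)+
    then show ?thesis using *[of W] unfolding distrib_right by linarith
  qed
  then show ?thesis unfolding poly_bounded_def by blast
qed

lemmas poly_bounded_intros = poly_bounded_const poly_bounded_id poly_bounded_add poly_bounded_mult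

text \<open>The expression is fixed and only \<open>W\<close> varies; each nested \<open>Sum\<close>
  contributes one factor \<open>W\<close>.\<close>

lemma poly_bounded_timeE: "poly_bounded (timeE e)"
  by (induction e) (simp_all only: timeE.simps[abs_def] poly_bounded_intros)

lemma poly_bounded_timeC: "poly_bounded (timeC c)"
  by (induction c) (simp_all only: timeC.simps[abs_def] poly_bounded_intros poly_bounded_timeE)

section \<open>Copying the input in and the output out\<close>

lemma exec_count:
  assumes step: "\<And>i \<sigma>. i < n \<Longrightarrow> P i \<sigma> \<Longrightarrow> \<exists>t \<sigma>'. exec c \<sigma> t \<sigma>' \<and> t \<le> b \<and> P (Suc i) \<sigma>'"
    and cond: "\<And>i \<sigma>. i \<le> n \<Longrightarrow> P i \<sigma> \<Longrightarrow> aval a \<sigma> = n - i"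
    and start: "P 0 \<sigma>"
  shows "\<exists>t \<sigma>'. exec (While a c) \<sigma> t \<sigma>' \<and> t \<le> n * (acost a + 1 + b) + acost a + 1 \<and> P n \<sigma>'"
proof -
  have "\<exists>t \<sigma>'. exec (While a c) \<sigma> t \<sigma>' \<and> t \<le> k * (acost a + 1 + b) + acost a + 1 \<and> P n \<sigma>'"
    if "P (n - k) \<sigma>" "k \<le> n" for k \<sigma>
    using that
  proof (induction k arbitrary: \<sigma>)
    case 0
    then have "exec (While a c) \<sigma> (acost a + 1) \<sigma>"
      using cond[of n \<sigma>] by (intro exec.WhileFalse) simp
    then show ?case using 0 by (intro exI[of _ "acost a + 1"] exI[of _ \<sigma>]) simp
  next
    case (Suc k)
    have n: "n - Suc k < n" "Suc (n - Suc k) = n - k" using Suc.prems(2) by auto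
    obtain t \<sigma>1 where 1: "exec c \<sigma> t \<sigma>1" "t \<le> b" "P (n - k) \<sigma>1"
      using step[OF n(1) Suc.prems(1)] unfolding n(2) by blast
    obtain u \<sigma>2 where 2: "exec (While a c) \<sigma>1 u \<sigma>2" "u \<le> k * (acost a + 1 + b) + acost a + 1" "P n \<sigma>2"
      using Suc.IH[OF 1(3)] Suc.prems(2) by auto
    have "exec (While a c) \<sigma> (acost a + 1 + t + u) \<sigma>2"
      using cond[OF _ Suc.prems(1)] Suc.prems(2) by (intro exec.WhileTrue[OF _ 1(1) 2(1)]) simp
    then show ?case
      using 1 2 by (intro exI[of _ "acost a + 1 + t + u"] exI[of _ \<sigma>2]) simp
  qed
  from this[of n \<sigma>] start show ?thesis by simp
qed

definition times :: "nat \<Rightarrow> aexp \<Rightarrow> aexp" where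
  "times k a = (Plus a ^^ k) (Const 0)"

lemma aval_times [simp]: "aval (times k a) \<sigma> = k * aval a \<sigma>"
  by (induction k) (simp_all add: times_def)

text \<open>The input length \<open>n + 2 + 2 r m\<close>, computed from the two counts stored in
  the input; each clause occupies \<open>2 r\<close> cells.\<close>

definition in_base :: "nat \<Rightarrow> aexp" where
  "in_base r = Plus (Plus (Mem (Const 0)) (Const 2))
     (times (2 * r) (Mem (Plus (Mem (Const 0)) (Const 1))))"

definition copy_in :: com where
  "copy_in = While (Minus (Reg base) (Reg (temp 0)))
     (Seq (Store (addr Inp (temp 0)) (Mem (Reg (temp 0))))
       (Assign (temp 0) (Plus (Reg (temp 0)) (Const 1))))"

text \<open>Twice the input length is copied, enough for the answer bit, an assignment and the
  encoding of a subformula.\<close>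

definition copy_out :: com where
  "copy_out = While (Minus (Plus (Reg base) (Reg base)) (Reg (temp 0)))
     (Seq (Store (Reg (temp 0)) (Mem (addr Out (temp 0))))
       (Assign (temp 0) (Plus (Reg (temp 0)) (Const 1))))"

text \<open>The arrays live above the input: cell \<open>i\<close> of array \<open>a\<close> has address \<open>base + 8 i + code a\<close>,
  where \<open>base\<close> is the length of the input. Copying the output down in ascending order never
  overwrites a cell that is still to be read.\<close>

definition prog :: "nat \<Rightarrow> cm \<Rightarrow> com" where
  "prog r c = Seq (Assign base (in_base r)) (Seq copy_in (Seq (compileC 0 c)
     (Seq (Assign (temp 0) (Const 0)) copy_out)))"

definition time_prog :: "nat \<Rightarrow> cm \<Rightarrow> nat \<Rightarrow> nat" where
  "time_prog r c W = W * 120 + (timeC c W + (acost (in_base r) + 20))"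

lemma poly_bounded_time_prog: "poly_bounded (time_prog r c)"
  by (simp only: time_prog_def[abs_def] poly_bounded_intros poly_bounded_timeC)

definition input :: "nat list \<Rightarrow> nat \<Rightarrow> nat" where
  "input w i = (if i < length w then w ! i else 0)"

definition start :: "nat list \<Rightarrow> st" where
  "start w = (\<lambda>_. 0, \<lambda>a. if a = Inp then input w else (\<lambda>_. 0))"

lemma exec_copy_in:
  assumes "fst \<sigma> = (\<lambda>_. 0)(base := length w)" "snd \<sigma> = input w"
  shows "\<exists>t \<sigma>'. exec copy_in \<sigma> t \<sigma>' \<and> t \<le> length w * 50 + 4 \<and> rel (start w) \<sigma>' \<and> fst \<sigma>' base = length w"
proof -
  let ?L = "length w"
  let ?P = "\<lambda>i \<tau>. fst \<tau> (temp 0) = i \<and> fst \<tau> base = ?L \<and> (\<forall>x. fst \<tau> (vname x) = 0) \<and>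
    (\<forall>j<?L. snd \<tau> j = input w j) \<and>
    (\<forall>a j. snd \<tau> (?L + (8 * j + code a)) = (if a = Inp \<and> j < i then input w j else 0))"
  have *: "\<exists>t \<tau>'. exec (Seq (Store (addr Inp (temp 0)) (Mem (Reg (temp 0))))
       (Assign (temp 0) (Plus (Reg (temp 0)) (Const 1)))) \<tau> t \<tau>' \<and> t \<le> 26 \<and> ?P (Suc i) \<tau>'"
    if "i < ?L" "?P i \<tau>" for i \<tau>
  proof -
    from that have t: "fst \<tau> (temp 0) = i" "fst \<tau> base = ?L" "\<And>x. fst \<tau> (vname x) = 0"
      "\<And>j. j < ?L \<Longrightarrow> snd \<tau> j = input w j"
      "\<And>a j. snd \<tau> (?L + (8 * j + code a)) = (if a = Inp \<and> j < i then input w j else 0)"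
      by blast+
    let ?\<tau>1 = "(fst \<tau>, (snd \<tau>)(aval (addr Inp (temp 0)) \<tau> := aval (Mem (Reg (temp 0))) \<tau>))"
    let ?m = "(snd \<tau>)(?L + (8 * i + code Inp) := input w i)"
    let ?\<tau>2 = "((fst \<tau>)(temp 0 := Suc i), ?m)"
    have "?\<tau>1 = (fst \<tau>, ?m)"
      using t(4)[OF that(1)] by (simp add: t(1,2))
    then have "exec (Store (addr Inp (temp 0)) (Mem (Reg (temp 0)))) \<tau> 22 (fst \<tau>, ?m)"
      using exec.Store[of "addr Inp (temp 0)" "Mem (Reg (temp 0))" \<tau>] by simp
    then have "exec (Seq (Store (addr Inp (temp 0)) (Mem (Reg (temp 0))))
       (Assign (temp 0) (Plus (Reg (temp 0)) (Const 1)))) \<tau> (22 + 4) ?\<tau>2"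
      by (rule exec.Seq, intro exec_Assign) (simp_all add: t(1))
    moreover have "?P (Suc i) ?\<tau>2"
      unfolding fst_conv snd_conv fun_upd_apply add_left_cancel addr_inj
      using t(5) by (intro conjI allI impI) (auto simp: t(1-4) less_Suc_eq simp del: code.simps)
    ultimately show ?thesis
      by (intro exI[of _ "22 + 4"] exI[of _ ?\<tau>2]) simp
  qed
  have "?P 0 \<sigma>"
    using assms by (auto simp: input_def)
  then have "\<exists>t \<sigma>'. exec copy_in \<sigma> t \<sigma>' \<and>
      t \<le> ?L * (acost (Minus (Reg base) (Reg (temp 0))) + 1 + 26) +
        acost (Minus (Reg base) (Reg (temp 0))) + 1 \<and> ?P ?L \<sigma>'"
    unfolding copy_in_def by (intro exec_count[where P = ?P] *) simp_all
  then obtain t \<sigma>' where 1: "exec copy_in \<sigma> t \<sigma>'" "t \<le> ?L * 30 + 4" "?P ?L \<sigma>'"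
    by (elim exE conjE) simp
  moreover have "rel (start w) \<sigma>'"
    using 1(3) by (auto simp: rel_def start_def input_def)
  ultimately show ?thesis by (intro exI[of _ t] exI[of _ \<sigma>']) simp
qed

lemma exec_copy_out:
  assumes "fst \<sigma> (temp 0) = 0" "fst \<sigma> base = L" "rel s \<sigma>"
  shows "\<exists>t \<sigma>'. exec copy_out \<sigma> t \<sigma>' \<and> t \<le> L * 70 + 6 \<and> (\<forall>i<2 * L. snd \<sigma>' i = snd s Out i)"
proof -
  let ?P = "\<lambda>i \<tau>. fst \<tau> (temp 0) = i \<and> fst \<tau> base = L \<and>
    (\<forall>j<i. snd \<tau> j = snd s Out j) \<and>
    (\<forall>j\<ge>i. snd \<tau> (L + (8 * j + code Out)) = snd s Out j)"
  have *: "\<exists>t \<tau>'. exec (Seq (Store (Reg (temp 0)) (Mem (addr Out (temp 0))))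
       (Assign (temp 0) (Plus (Reg (temp 0)) (Const 1)))) \<tau> t \<tau>' \<and> t \<le> 26 \<and> ?P (Suc i) \<tau>'"
    if "i < 2 * L" "?P i \<tau>" for i \<tau>
  proof -
    from that have t: "fst \<tau> (temp 0) = i" "fst \<tau> base = L" "\<And>j. j < i \<Longrightarrow> snd \<tau> j = snd s Out j"
      "\<And>j. i \<le> j \<Longrightarrow> snd \<tau> (L + (8 * j + code Out)) = snd s Out j"
      by blast+
    let ?\<tau>1 = "(fst \<tau>, (snd \<tau>)(aval (Reg (temp 0)) \<tau> := aval (Mem (addr Out (temp 0))) \<tau>))"
    let ?\<tau>2 = "((fst \<tau>)(temp 0 := Suc i), (snd \<tau>)(i := snd s Out i))"
    have "?\<tau>1 = (fst \<tau>, (snd \<tau>)(i := snd s Out i))"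
      using t(4)[of i] by (simp add: t)
    then have "exec (Store (Reg (temp 0)) (Mem (addr Out (temp 0)))) \<tau> 22 (fst \<tau>, (snd \<tau>)(i := snd s Out i))"
      using exec.Store[of "Reg (temp 0)" "Mem (addr Out (temp 0))" \<tau>] by simp
    then have "exec (Seq (Store (Reg (temp 0)) (Mem (addr Out (temp 0))))
       (Assign (temp 0) (Plus (Reg (temp 0)) (Const 1)))) \<tau> (22 + 4) ?\<tau>2"
      by (rule exec.Seq, intro exec_Assign) (simp_all add: t(1))
    \<comment> \<open>If the cell written, \<open>i\<close>, is cell \<open>j\<close> of
      \<open>Out\<close>, then \<open>L + 8 j + code Out = i\<close> forces \<open>j < i\<close>,
      and that cell has been copied already.\<close>
    moreover have "?P (Suc i) ?\<tau>2"
      using t(3,4) by (intro conjI allI impI) (auto simp: t(1,2) less_Suc_eq)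
    ultimately show ?thesis
      by (intro exI[of _ "22 + 4"] exI[of _ ?\<tau>2]) simp
  qed
  have "?P 0 \<sigma>"
    using assms by (auto simp: rel_def simp del: code.simps)
  then have "\<exists>t \<sigma>'. exec copy_out \<sigma> t \<sigma>' \<and>
      t \<le> 2 * L * (acost (Minus (Plus (Reg base) (Reg base)) (Reg (temp 0))) + 1 + 26) +
        acost (Minus (Plus (Reg base) (Reg base)) (Reg (temp 0))) + 1 \<and> ?P (2 * L) \<sigma>'"
    unfolding copy_out_def by (intro exec_count[where P = ?P] *) simp_all
  then obtain t \<sigma>' where "exec copy_out \<sigma> t \<sigma>'" "t \<le> 2 * L * 32 + 6" "?P (2 * L) \<sigma>'"
    by (elim exE conjE) simp
  then show ?thesis by (intro exI[of _ t] exI[of _ \<sigma>']) simp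
qed

lemma exec_prog:
  assumes L: "input w 0 + 2 + 2 * r * input w (input w 0 + 1) = length w"
    and ok: "ok W c (start w)" and W: "length w \<le> W"
  shows "\<exists>t \<sigma>'. exec (prog r c) (\<lambda>_. 0, input w) t \<sigma>' \<and> t \<le> time_prog r c W \<and>
    (\<forall>i<2 * length w. snd \<sigma>' i = snd (den c (start w)) Out i)"
proof -
  let ?L = "length w"
  let ?\<sigma>1 = "((\<lambda>_. 0)(base := ?L), input w)"
  have 1: "exec (Assign base (in_base r)) (\<lambda>_. 0, input w) (acost (in_base r) + 1) ?\<sigma>1"
    using L by (intro exec_Assign) (simp_all add: in_base_def)
  from exec_copy_in[of ?\<sigma>1 w] obtain t2 \<sigma>2 where
    2: "exec copy_in ?\<sigma>1 t2 \<sigma>2" "t2 \<le> ?L * 50 + 4" "rel (start w) \<sigma>2" "fst \<sigma>2 base = ?L"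
    by auto
  from exec_compileC[OF 2(3) ok, of 0] obtain t3 \<sigma>3 where
    3: "exec (compileC 0 c) \<sigma>2 t3 \<sigma>3" "t3 \<le> timeC c W" "rel (den c (start w)) \<sigma>3" "fst \<sigma>3 base = ?L"
    using 2(4) by auto
  let ?\<sigma>4 = "((fst \<sigma>3)(temp 0 := 0), snd \<sigma>3)"
  have 4: "exec (Assign (temp 0) (Const 0)) \<sigma>3 2 ?\<sigma>4"
    by (rule exec_Assign) simp_all
  have "rel (den c (start w)) ?\<sigma>4"
    using rel_keeps[OF 3(3) keeps_upd[of 0 0]] by simp
  then obtain t5 \<sigma>5 where
    5: "exec copy_out ?\<sigma>4 t5 \<sigma>5" "t5 \<le> ?L * 70 + 6" "\<forall>i<2 * ?L. snd \<sigma>5 i = snd (den c (start w)) Out i"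
    using exec_copy_out[of ?\<sigma>4 ?L "den c (start w)"] 3(4) by auto
  have "exec (prog r c) (\<lambda>_. 0, input w) (acost (in_base r) + 1 + (t2 + (t3 + (2 + t5)))) \<sigma>5"
    unfolding prog_def
    by (rule exec.Seq[OF 1 exec.Seq[OF 2(1) exec.Seq[OF 3(1) exec.Seq[OF 4 5(1)]]]])
  moreover have "acost (in_base r) + 1 + (t2 + (t3 + (2 + t5))) \<le> time_prog r c W"
    using 2(2) 3(2) 5(2) W unfolding time_prog_def by linarith
  ultimately show ?thesis using 5(3) by blast
qed

section \<open>Formulas as tables of literals\<close>

lemma nth_concat_uniform:
  assumes "\<And>x. x \<in> set xss \<Longrightarrow> length x = L" "j < length xss" "k < L"
  shows "concat xss ! (L * j + k) = xss ! j ! k"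
  using assms
proof (induction xss arbitrary: j)
  case (Cons x xss)
  show ?case
  proof (cases j)
    case 0
    then show ?thesis using Cons.prems by (simp add: nth_append)
  next
    case (Suc i)
    have "concat (x # xss) ! (L * j + k) = concat xss ! (L * i + k)"
      using Cons.prems(1)[of x] by (simp add: Suc nth_append)
    also have "\<dots> = xss ! i ! k"
      using Cons.prems Suc by (intro Cons.IH) auto
    finally show ?thesis using Suc by simp
  qed
qed simp

lemma length_concat_uniform:
  "(\<And>x. x \<in> set xss \<Longrightarrow> length x = L) \<Longrightarrow> length (concat xss) = L * length xss"
  by (induction xss) auto

text \<open>A clause has only one literal on each variable, so testing for the positive literal
  recovers the sign.\<close>

lemma literal_sign:
  fixes c :: clause
  assumes "inj_on fst c" "l \<in> c"
  shows "((fst l, True) \<in> c) = snd l"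
  using assms(2) inj_onD[OF assms(1), of l "(fst l, True)"] by (cases l; cases "snd l") auto

lemma clause_eq_signs:
  fixes c :: clause
  assumes "inj_on fst c"
  shows "(\<lambda>v. (v, (v, True) \<in> c)) ` fst ` c = c"
  unfolding image_image by (simp add: literal_sign[OF assms])

lemma
  assumes "c \<in> all_clauses r V"
  shows length_encode_clause: "length (encode_clause c) = 2 * r"
    and vars_encode_clause: "fst ` c = (\<lambda>k. encode_clause c ! (2 * k)) ` {..<r}"
    and sign_encode_clause: "k < r \<Longrightarrow>
      encode_clause c ! (2 * k + 1) = of_bool ((encode_clause c ! (2 * k), True) \<in> c)"
proof -
  define ys where "ys = sorted_list_of_set (fst ` c)"
  have ys: "length ys = r" "set ys = fst ` c"
    using assms by (auto simp: ys_def all_clauses_def card_image)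
  have enc: "encode_clause c = concat (map (\<lambda>v. [v, of_bool ((v, True) \<in> c)]) ys)"
    by (simp add: encode_clause_def ys_def)
  show "length (encode_clause c) = 2 * r"
    unfolding enc by (subst length_concat_uniform[of _ 2]) (auto simp: ys)
  have nth: "encode_clause c ! (2 * k) = ys ! k \<and>
      encode_clause c ! (2 * k + 1) = of_bool ((ys ! k, True) \<in> c)" if "k < r" for k
  proof -
    let ?l = "map (\<lambda>v. [v, of_bool ((v, True) \<in> c) :: nat]) ys"
    have "concat ?l ! (2 * k + i) = ?l ! k ! i" if "i < 2" for i
      using that \<open>k < r\<close> ys by (intro nth_concat_uniform) auto
    from this[of 0] this[of 1] show ?thesis
      using that ys unfolding enc by simp
  qed
  then show "k < r \<Longrightarrow>
      encode_clause c ! (2 * k + 1) = of_bool ((encode_clause c ! (2 * k), True) \<in> c)"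
    by simp
  have "fst ` c = (\<lambda>k. ys ! k) ` {..<r}"
    using ys by (metis atLeast0LessThan atLeast_upt list.set_map map_nth)
  also have "\<dots> = (\<lambda>k. encode_clause c ! (2 * k)) ` {..<r}"
    using nth by auto
  finally show "fst ` c = (\<lambda>k. encode_clause c ! (2 * k)) ` {..<r}" .
qed

text \<open>Even positions give the variables and odd positions their signs; with one literal per
  variable these determine the clause.\<close>

lemma inj_on_encode_clause: "inj_on encode_clause (all_clauses r V)"
proof (rule inj_onI)
  fix c d assume cd: "c \<in> all_clauses r V" "d \<in> all_clauses r V" and eq: "encode_clause c = encode_clause d"
  have v: "fst ` c = fst ` d"
    using vars_encode_clause[OF cd(1)] vars_encode_clause[OF cd(2)] eq by simp
  have "((v, True) \<in> c) = ((v, True) \<in> d)" if v': "v \<in> fst ` c" for v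
  proof -
    obtain k where "k < r" "v = encode_clause c ! (2 * k)"
      using v' unfolding vars_encode_clause[OF cd(1)] by blast
    then show ?thesis
      using sign_encode_clause[OF cd(1), of k] sign_encode_clause[OF cd(2), of k] eq
      by (metis of_bool_eq_iff)
  qed
  then have "(\<lambda>v. (v, (v, True) \<in> c)) ` fst ` c = (\<lambda>v. (v, (v, True) \<in> d)) ` fst ` d"
    unfolding v[symmetric] by (intro image_cong) auto
  then show "c = d"
    using clause_eq_signs[of c] clause_eq_signs[of d] cd by (simp add: all_clauses_def)
qed

definition merge :: "'v set \<Rightarrow> ('v \<Rightarrow> bool) \<Rightarrow> ('v \<Rightarrow> bool) \<Rightarrow> 'v \<Rightarrow> bool" where
  "merge C \<rho> \<sigma> = (\<lambda>x. if x \<in> C then \<rho> x else \<sigma> x)"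

section \<open>A formula seen through the positions in its encoding\<close>

locale sat_instance =
  fixes r :: nat and F :: formula
  assumes wf: "sat_formula r F" and r_pos: "r \<ge> 1"
begin

definition xs :: "nat list" where "xs = sorted_list_of_set (vars F)"
definition n :: nat where "n = length xs"
definition cs :: "nat list list" where "cs = sorted_list_of_set (encode_clause ` clauses F)"
definition m :: nat where "m = length cs"
definition inp :: "nat \<Rightarrow> nat" where "inp = input (encode F)"
definition lit_var :: "nat \<Rightarrow> nat \<Rightarrow> nat" where "lit_var j k = cs ! j ! (2 * k)"
definition lit_sign :: "nat \<Rightarrow> nat \<Rightarrow> nat" where "lit_sign j k = cs ! j ! (2 * k + 1)"
definition clause_vars :: "nat \<Rightarrow> nat set" where "clause_vars j = lit_var j ` {..<r}"
definition sat :: "(nat \<Rightarrow> bool) \<Rightarrow> nat \<Rightarrow> bool" where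
  "sat \<sigma> j \<longleftrightarrow> (\<exists>k<r. of_bool (\<sigma> (lit_var j k)) = lit_sign j k)"
definition count_sat :: "nat set \<Rightarrow> (nat \<Rightarrow> bool) \<Rightarrow> nat" where
  "count_sat J \<sigma> = card {j \<in> J. sat \<sigma> j}"
definition sat_all :: "nat set \<Rightarrow> bool" where
  "sat_all J \<longleftrightarrow> (\<exists>\<sigma>. \<forall>j\<in>J. sat \<sigma> j)"
text \<open>The machine addresses clauses by their position in the sorted list of encodings; this is
  the bridge back to sets of literals.\<close>

definition clause_at :: "nat \<Rightarrow> clause" where
  "clause_at j = the_inv_into (clauses F) encode_clause (cs ! j)"
definition component :: "nat \<Rightarrow> nat set" where
  "component v = reach clause_vars {..<m} {v}"

lemma finite_vars: "finite (vars F)" and clauses_subset: "clauses F \<subseteq> all_clauses r (vars F)"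
  using wf by (auto simp: sat_formula_def)

lemma finite_clauses: "finite (clauses F)"
  using clauses_subset finite_all_clauses[OF finite_vars] finite_subset by blast

lemma inj_encode: "inj_on encode_clause (clauses F)"
  using inj_on_encode_clause clauses_subset inj_on_subset by blast

lemma set_xs: "set xs = vars F" and distinct_xs: "distinct xs" and sorted_xs: "sorted xs"
  using finite_vars by (auto simp: xs_def)

lemma card_vars: "card (vars F) = n"
  using distinct_card[OF distinct_xs] by (simp add: n_def set_xs)

lemma set_cs: "set cs = encode_clause ` clauses F" and distinct_cs: "distinct cs" and sorted_cs: "sorted cs"
  using finite_clauses by (auto simp: cs_def)

lemma card_clauses: "card (clauses F) = m"
  using distinct_card[OF distinct_cs] card_image[OF inj_encode] by (simp add: m_def set_cs)

lemma clause_at_in: "j < m \<Longrightarrow> clause_at j \<in> clauses F" and encode_clause_at: "j < m \<Longrightarrow> encode_clause (clause_at j) = cs ! j"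
proof -
  assume "j < m"
  then have "cs ! j \<in> encode_clause ` clauses F"
    using set_cs nth_mem by (auto simp: m_def)
  then show "clause_at j \<in> clauses F" "encode_clause (clause_at j) = cs ! j"
    unfolding clause_at_def
    by (auto simp: the_inv_into_f_f[OF inj_encode])
qed

lemma clause_at_in_all_clauses: "j < m \<Longrightarrow> clause_at j \<in> all_clauses r (vars F)"
  using clause_at_in clauses_subset by blast

lemma bij_clause_at: "bij_betw clause_at {..<m} (clauses F)"
proof (rule bij_betw_imageI)
  show "inj_on clause_at {..<m}"
    using encode_clause_at distinct_cs by (intro inj_onI) (metis lessThan_iff m_def nth_eq_iff_index_eq)
  show "clause_at ` {..<m} = clauses F"
  proof
    show "clauses F \<subseteq> clause_at ` {..<m}"
    proof
      fix c assume c: "c \<in> clauses F"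
      then obtain j where "j < m" "cs ! j = encode_clause c"
        using set_cs by (metis imageI in_set_conv_nth m_def)
      then have "clause_at j = c"
        using inj_onD[OF inj_encode, of "clause_at j" c] clause_at_in encode_clause_at c by simp
      then show "c \<in> clause_at ` {..<m}" using \<open>j < m\<close> by blast
    qed
  qed (auto simp: clause_at_in)
qed

lemma length_cs: "j < m \<Longrightarrow> length (cs ! j) = 2 * r"
  using length_encode_clause[OF clause_at_in_all_clauses] encode_clause_at by simp

lemma vars_clause_at: "j < m \<Longrightarrow> fst ` clause_at j = clause_vars j"
  using vars_encode_clause[OF clause_at_in_all_clauses] encode_clause_at by (simp add: clause_vars_def lit_var_def)

lemma clause_vars_subset: "j < m \<Longrightarrow> clause_vars j \<subseteq> vars F"
  using vars_clause_at clause_at_in_all_clauses by (force simp: all_clauses_def)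

lemma lit_var_in: "j < m \<Longrightarrow> k < r \<Longrightarrow> lit_var j k \<in> vars F"
  using clause_vars_subset by (auto simp: clause_vars_def)

lemma satisfies_clause_at:
  assumes "j < m"
  shows "satisfies \<sigma> (clause_at j) \<longleftrightarrow> sat \<sigma> j"
proof -
  have inj: "inj_on fst (clause_at j)" using clause_at_in_all_clauses[OF assms] by (simp add: all_clauses_def)
  have "satisfies \<sigma> (clause_at j) \<longleftrightarrow> (\<exists>l\<in>clause_at j. \<sigma> (fst l) = snd l)"
    by (simp add: satisfies_def case_prod_beta)
  also have "\<dots> \<longleftrightarrow> (\<exists>l\<in>clause_at j. \<sigma> (fst l) = ((fst l, True) \<in> clause_at j))"
    by (rule bex_cong[OF refl]) (subst literal_sign[OF inj], assumption, rule refl)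
  also have "\<dots> \<longleftrightarrow> (\<exists>v\<in>fst ` clause_at j. \<sigma> v = ((v, True) \<in> clause_at j))"
    by blast
  also have "\<dots> \<longleftrightarrow> sat \<sigma> j"
    using sign_encode_clause[OF clause_at_in_all_clauses[OF assms]] encode_clause_at[OF assms]
    unfolding vars_clause_at[OF assms] by (auto simp: sat_def clause_vars_def lit_var_def lit_sign_def)
  finally show ?thesis .
qed

lemma num_satisfied_count_sat: "num_satisfied F \<sigma> = count_sat {..<m} \<sigma>"
proof -
  have "{c \<in> clauses F. satisfies \<sigma> c} = clause_at ` {j \<in> {..<m}. sat \<sigma> j}"
    unfolding bij_betw_imp_surj_on[OF bij_clause_at, symmetric] using satisfies_clause_at by auto
  moreover have "inj_on clause_at {j \<in> {..<m}. sat \<sigma> j}"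
    using bij_clause_at by (auto simp: bij_betw_def intro: inj_on_subset)
  ultimately show ?thesis
    by (simp add: num_satisfied_def count_sat_def card_image)
qed

lemma satisfiable_clause_at_image: "J \<subseteq> {..<m} \<Longrightarrow> satisfiable (Formula V (clause_at ` J)) \<longleftrightarrow> sat_all J"
  using satisfies_clause_at by (fastforce simp: satisfiable_def sat_all_def)

lemma satisfiable_iff: "satisfiable F \<longleftrightarrow> sat_all {..<m}"
  using satisfiable_clause_at_image[of "{..<m}" "vars F"] bij_clause_at by (simp add: bij_betw_def)

lemma sat_all_mono: "sat_all J \<Longrightarrow> I \<subseteq> J \<Longrightarrow> sat_all I"
  by (auto simp: sat_all_def)

lemma count_sat_eq_card_iff:
  assumes "finite J"
  shows "count_sat J \<sigma> = card J \<longleftrightarrow> (\<forall>j\<in>J. sat \<sigma> j)"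
proof
  assume "count_sat J \<sigma> = card J"
  then show "\<forall>j\<in>J. sat \<sigma> j"
    using assms card_subset_eq[of J "{j \<in> J. sat \<sigma> j}"] by (auto simp: count_sat_def)
next
  assume "\<forall>j\<in>J. sat \<sigma> j"
  then have "{j \<in> J. sat \<sigma> j} = J" by blast
  then show "count_sat J \<sigma> = card J" by (simp add: count_sat_def)
qed

lemma count_sat_le_card: "finite J \<Longrightarrow> count_sat J \<sigma> \<le> card J"
  by (auto simp: count_sat_def intro: card_mono)

text \<open>Maximisation thereby decides satisfiability, which settles both the answer bit and each
  attempted deletion.\<close>

lemma count_sat_max_eq_card_iff:
  assumes "finite J" "\<And>\<tau>. count_sat J \<tau> \<le> count_sat J \<sigma>"
  shows "count_sat J \<sigma> = card J \<longleftrightarrow> sat_all J"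
  using count_sat_eq_card_iff[OF assms(1)] count_sat_le_card[OF assms(1)] assms(2)
  by (metis le_antisym sat_all_def)

lemma sat_cong: "(\<And>x. x \<in> clause_vars j \<Longrightarrow> \<sigma> x = \<tau> x) \<Longrightarrow> sat \<sigma> j = sat \<tau> j"
  by (auto simp: sat_def clause_vars_def)

lemma closed_component: "closed_under clause_vars {..<m} (component v)"
  unfolding component_def by (rule closed_under_reach)

lemma component_self: "v \<in> component v"
  using reach_superset[of "{v}" clause_vars "{..<m}"] by (simp add: component_def)

lemma component_eq: "component v = reach (image fst) (clauses F) {v}"
proof -
  have "closed_under clause_vars {..<m} T = closed_under (image fst) (clauses F) T" for T
    unfolding bij_betw_imp_surj_on[OF bij_clause_at, symmetric] closed_under_def by (simp add: vars_clause_at)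
  then show ?thesis by (simp add: component_def reach_def)
qed

text \<open>A clause that meets a closed set lies inside it and every other clause avoids it, so the
  two assignments are judged on disjoint sets of clauses.\<close>

lemma count_sat_merge:
  assumes C: "closed_under clause_vars {..<m} C" and J: "J \<subseteq> {..<m}"
  shows "count_sat J (merge C \<rho> \<sigma>) =
    count_sat {j \<in> J. clause_vars j \<inter> C \<noteq> {}} \<rho> + count_sat {j \<in> J. clause_vars j \<inter> C = {}} \<sigma>"
proof -
  have "sat (merge C \<rho> \<sigma>) j = sat \<rho> j" if "j \<in> J" "clause_vars j \<inter> C \<noteq> {}" for j
    using that C J by (intro sat_cong) (auto simp: closed_under_def merge_def)
  moreover have "sat (merge C \<rho> \<sigma>) j = sat \<sigma> j" if "j \<in> J" "clause_vars j \<inter> C = {}" for j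
    using that by (intro sat_cong) (auto simp: merge_def)
  ultimately have "{j \<in> J. sat (merge C \<rho> \<sigma>) j} =
      {j \<in> {j \<in> J. clause_vars j \<inter> C \<noteq> {}}. sat \<rho> j} \<union> {j \<in> {j \<in> J. clause_vars j \<inter> C = {}}. sat \<sigma> j}"
    by blast
  moreover have "finite J" using J finite_subset by blast
  ultimately show ?thesis
    unfolding count_sat_def by (simp only:) (intro card_Un_disjoint; auto)
qed

text \<open>The exchange argument: by the splitting above, optimality of \<sigma> on
  \<open>C\<close> concerns only the clauses that meet \<open>C\<close>, and their part of the count
  does not depend on the values outside \<open>C\<close>.\<close>

lemma count_sat_le_merge_optimum:
  assumes C: "closed_under clause_vars {..<m} C" and J: "J \<subseteq> {..<m}"
    and opt: "\<And>\<rho>. count_sat J (merge C \<rho> \<sigma>) \<le> count_sat J \<sigma>"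
  shows "count_sat J \<tau> \<le> count_sat J (merge C \<sigma> \<tau>)"
proof -
  have "merge C \<sigma> \<sigma> = \<sigma>" "merge C \<tau> \<tau> = \<tau>" by (auto simp: merge_def)
  then show ?thesis
    using opt[of \<tau>] count_sat_merge[OF C J, of \<tau> \<sigma>] count_sat_merge[OF C J, of \<sigma> \<sigma>]
      count_sat_merge[OF C J, of \<tau> \<tau>] count_sat_merge[OF C J, of \<sigma> \<tau>] by simp
qed

lemma encode_eq: "encode F = n # xs @ m # concat cs"
  by (simp add: encode_def card_vars card_clauses flip: xs_def cs_def)

lemma length_encode: "length (encode F) = n + 2 + 2 * r * m"
proof -
  have "length (concat cs) = 2 * r * m"
    unfolding m_def by (rule length_concat_uniform) (metis in_set_conv_nth length_cs m_def)
  then show ?thesis by (simp add: encode_eq n_def)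
qed

lemma inp_0: "inp 0 = n"
  by (simp add: inp_def input_def encode_eq)

lemma inp_x: "i < n \<Longrightarrow> inp (Suc i) = xs ! i"
  by (simp add: inp_def input_def encode_eq n_def nth_append)

lemma inp_m: "inp (Suc n) = m"
  by (simp add: inp_def input_def encode_eq n_def nth_append)

lemma inp_c:
  assumes "j < m" "k < 2 * r"
  shows "inp (n + 2 + (2 * r * j + k)) = cs ! j ! k"
proof -
  have "2 * r * j + k < 2 * r * Suc j" using assms by simp
  also have "\<dots> \<le> 2 * r * m" using assms by (intro mult_left_mono) auto
  finally have "inp (n + 2 + (2 * r * j + k)) = concat cs ! (2 * r * j + k)"
    unfolding inp_def input_def length_encode by (simp add: encode_eq n_def nth_append)
  also have "\<dots> = cs ! j ! k"
    using assms by (intro nth_concat_uniform) (auto simp: m_def[symmetric] in_set_conv_nth length_cs)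
  finally show ?thesis .
qed

end

section \<open>The program\<close>

definition nE :: ex where "nE = Arr Inp (Cst 0)"
definition mE :: ex where "mE = Arr Inp (Add nE (Cst 1))"
definition xE :: "ex \<Rightarrow> ex" where "xE e = Arr Inp (Add e (Cst 1))"
text \<open>Truncated subtraction supplies the tests: \<open>1 - (1 - e)\<close> normalises truth
  values, and the two differences in \<open>eqE\<close> vanish together only for equal
  values.\<close>

definition boolE :: "ex \<Rightarrow> ex" where "boolE e = Sub (Cst 1) (Sub (Cst 1) e)"
definition eqE :: "ex \<Rightarrow> ex \<Rightarrow> ex" where "eqE e f = Sub (Cst 1) (Add (Sub e f) (Sub f e))"
text \<open>The clauses are preceded by two counts and \<open>n\<close> variables; the sum
  multiplies the clause position \<open>vJ\<close> by \<open>2 r\<close>.\<close>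

definition posE :: "nat \<Rightarrow> ex \<Rightarrow> ex" where
  "posE r e = Add (Add nE (Cst 2)) (Add (Sum vD (Cst (2 * r)) (Var vJ)) e)"
definition lvE :: "nat \<Rightarrow> ex" where
  "lvE r = Arr Inp (posE r (Add (Var vK) (Var vK)))"
definition lsE :: "nat \<Rightarrow> ex" where
  "lsE r = Arr Inp (posE r (Add (Add (Var vK) (Var vK)) (Cst 1)))"
definition satE :: "nat \<Rightarrow> ex" where
  "satE r = boolE (Sum vK (Cst r) (eqE (Arr Val (lvE r)) (lsE r)))"
definition numE :: "nat \<Rightarrow> ex" where
  "numE r = Sum vJ mE (Sum vD (boolE (Arr Act (Var vJ))) (satE r))"
definition activeE :: ex where
  "activeE = Sum vJ mE (boolE (Arr Act (Var vJ)))"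
text \<open>A count of occurrences, of which only positivity matters.\<close>

definition usedE :: "nat \<Rightarrow> ex" where
  "usedE r = Sum vJ mE (Sum vD (boolE (Arr Act (Var vJ)))
     (Sum vK (Cst r) (eqE (lvE r) (xE (Var vU)))))"
text \<open>Division by two as a count: \<open>2 d + 1 < q\<close> holds exactly for
  \<open>d < q div 2\<close>.\<close>

definition halfE :: ex where
  "halfE = Sum vD (Var vQ) (boolE (Sub (Var vQ) (Add (Add (Var vD) (Var vD)) (Cst 1))))"

definition ifC :: "ex \<Rightarrow> cm \<Rightarrow> cm" where "ifC e c = For vD (boolE e) c"

definition pushC :: "ex \<Rightarrow> cm" where
  "pushC e = Put Out (Var vP) e ;; Set vP (Add (Var vP) (Cst 1))"

text \<open>\<open>Act\<close> is deliberately not consulted: deleted clauses still propagate flags,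
  so the components are those of the whole formula.\<close>

definition passC :: "nat \<Rightarrow> cm" where
  "passC r = For vJ mE (ifC (Sum vK (Cst r) (Arr Flag (lvE r)))
     (For vK (Cst r) (Put Flag (lvE r) (Cst 1))))"

definition closeC :: "nat \<Rightarrow> cm" where
  "closeC r = For vU nE (Put Flag (xE (Var vU)) (Cst 0)) ;;
     Put Flag (xE (Var vI)) (Cst 1) ;; For vL nE (passC r)"

definition sizeC :: cm where
  "sizeC = Set vM (Cst 1) ;;
     For vU nE (ifC (Arr Flag (xE (Var vU))) (Set vM (Add (Var vM) (Var vM))))"

definition decodeC :: cm where
  "decodeC = For vU nE (ifC (Arr Flag (xE (Var vU)))
     (Put Val (xE (Var vU)) (Sub (Var vQ) (Add halfE halfE)) ;; Set vQ halfE))"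

text \<open>The added 1 turns the test into "at least \<open>vB\<close>". Ties are accepted, so with
  \<open>vB = 0\<close> the first trial always sets \<open>vR\<close>, even if it satisfies no
  active clause.\<close>

definition tryC :: "nat \<Rightarrow> cm" where
  "tryC r = Set vQ (Var vT) ;; decodeC ;;
     ifC (Sub (Add (numE r) (Cst 1)) (Var vB)) (Set vB (numE r) ;; Set vR (Var vT))"

definition optimizeC :: "nat \<Rightarrow> cm" where
  "optimizeC r = closeC r ;; sizeC ;; Set vB (Cst 0) ;; Set vR (Cst 0) ;;
     For vT (Var vM) (tryC r) ;; Set vQ (Var vR) ;; decodeC"

definition coreC :: "nat \<Rightarrow> cm" where
  "coreC r = For vI nE (optimizeC r)"

text \<open>Written before any deletion is tried, since the later maximisations overwrite
  \<open>Val\<close>.\<close>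

definition headC :: "nat \<Rightarrow> cm" where
  "headC r = pushC (eqE (numE r) mE) ;; For vU nE (pushC (Arr Val (xE (Var vU))))"

definition dropC :: "nat \<Rightarrow> cm" where
  "dropC r = Put Act (Var vG) (Cst 0) ;; coreC r ;;
     ifC (eqE (numE r) activeE) (Put Act (Var vG) (Cst 1))"

text \<open>Only variables occurring in active clauses are listed: dropping an idle variable would
  leave an unsatisfiable proper subformula.\<close>

definition tailC :: "nat \<Rightarrow> cm" where
  "tailC r = pushC (Sum vU nE (boolE (usedE r))) ;;
     For vU nE (ifC (usedE r) (pushC (xE (Var vU)))) ;;
     pushC activeE ;;
     For vJ mE (ifC (Arr Act (Var vJ)) (For vK (Cst (2 * r)) (pushC (Arr Inp (posE r (Var vK))))))"

text \<open>There is no branch on satisfiability. The subformula is always printed; for a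
  satisfiable formula the required output is a prefix that ends before it.\<close>

definition mainC :: "nat \<Rightarrow> cm" where
  "mainC r = For vJ mE (Put Act (Var vJ) (Cst 1)) ;; coreC r ;; headC r ;;
     For vG mE (dropC r) ;; tailC r"

section \<open>Frame rules and loop invariants\<close>

primrec writesA :: "cm \<Rightarrow> arr set" where
  "writesA (Set x e) = {}"
| "writesA (Put a e f) = {a}"
| "writesA (c ;; d) = writesA c \<union> writesA d"
| "writesA (For x e c) = writesA c"

primrec writesV :: "cm \<Rightarrow> var set" where
  "writesV (Set x e) = {x}"
| "writesV (Put a e f) = {}"
| "writesV (c ;; d) = writesV c \<union> writesV d"
| "writesV (For x e c) = insert x (writesV c)"

lemma loop_induct:
  assumes "P 0 s" "\<And>i t. i < k \<Longrightarrow> P i t \<Longrightarrow> P (Suc i) (f i t)"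
  shows "P k (loop f k s)"
  using assms by (induction k) auto

lemma frameA: "a \<notin> writesA c \<Longrightarrow> snd (den c s) a = snd s a"
proof (induction c arbitrary: s)
  case (For x e c)
  then show ?case
    by (simp, intro loop_induct[where P = "\<lambda>i t. snd t a = snd s a"]) simp_all
qed auto

lemma frameV: "x \<notin> writesV c \<Longrightarrow> fst (den c s) x = fst s x"
proof (induction c arbitrary: s)
  case (For y e c)
  then show ?case
    by (simp, intro loop_induct[where P = "\<lambda>i t. fst t x = fst s x"]) simp_all
qed auto

lemma den_For:
  assumes "ev e s = k" "P 0 s" "\<And>i t. i < k \<Longrightarrow> P i t \<Longrightarrow> P (Suc i) (den c (setv x i t))"
  shows "P k (den (For x e c) s)"
  unfolding den.simps assms(1) using assms(2,3) by (rule loop_induct)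

text \<open>The invariant is carried along because loop bounds inside the body may depend on the
  state reached so far.\<close>

lemma ok_For:
  assumes "okE W e s" "ev e s = k" "k \<le> W" "P 0 s"
    "\<And>i t. i < k \<Longrightarrow> P i t \<Longrightarrow> ok W c (setv x i t) \<and> P (Suc i) (den c (setv x i t))"
  shows "ok W (For x e c) s"
proof -
  let ?l = "\<lambda>i. loop (\<lambda>i s. den c (setv x i s)) i s"
  have "P i (?l i)" if "i \<le> k" for i
    using assms(4,5) that by (intro loop_induct[where P = P]) simp_all
  then show ?thesis using assms(1-3,5) by simp
qed

lemma ev_boolE [simp]: "ev (boolE e) s = (if ev e s = 0 then 0 else 1)"
  by (simp add: boolE_def)

lemma ev_eqE [simp]: "ev (eqE e f) s = (if ev e s = ev f s then 1 else 0)"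
  by (simp add: eqE_def)

lemma ev_halfE [simp]: "ev halfE s = fst s vQ div 2"
proof -
  have "ev halfE s = (\<Sum>i<fst s vQ. if fst s vQ \<le> Suc (i + i) then 0 else 1)"
    by (simp add: halfE_def)
  also have "\<dots> = (\<Sum>i<fst s vQ. of_bool (i < fst s vQ div 2))"
    by (intro sum.cong) auto
  also have "\<dots> = card ({..<fst s vQ} \<inter> {i. i < fst s vQ div 2})"
    by simp
  also have "{..<fst s vQ} \<inter> {i. i < fst s vQ div 2} = {..<fst s vQ div 2}"
    by auto
  finally show ?thesis by simp
qed

lemma den_ifC: "den (ifC e c) s = (if ev e s = 0 then s else den c (setv vD 0 s))"
  by (simp add: ifC_def)

lemma ok_ifC: "okE W e s \<Longrightarrow> 1 \<le> W \<Longrightarrow> (ev e s \<noteq> 0 \<Longrightarrow> ok W c (setv vD 0 s)) \<Longrightarrow> ok W (ifC e c) s"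
  by (simp add: ifC_def) (simp add: boolE_def)

lemma wr_ifC [simp]: "writesA (ifC e c) = writesA c" "writesV (ifC e c) = insert vD (writesV c)"
  by (simp_all add: ifC_def)

lemma wr_pushC [simp]: "writesA (pushC e) = {Out}" "writesV (pushC e) = {vP}"
  by (simp_all add: pushC_def)

lemma wr_passC [simp]: "writesA (passC r) = {Flag}" "writesV (passC r) = {vJ, vD, vK}"
  by (auto simp: passC_def)

lemma wr_closeC [simp]: "writesA (closeC r) = {Flag}" "writesV (closeC r) = {vU, vL, vJ, vD, vK}"
  by (auto simp: closeC_def)

lemma wr_sizeC [simp]: "writesA sizeC = {}" "writesV sizeC = {vM, vU, vD}"
  by (auto simp: sizeC_def)

lemma wr_decodeC [simp]: "writesA decodeC = {Val}" "writesV decodeC = {vU, vD, vQ}"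
  by (auto simp: decodeC_def)

lemma wr_tryC [simp]: "writesA (tryC r) = {Val}" "writesV (tryC r) = {vU, vD, vQ, vB, vR}"
  by (auto simp: tryC_def)

lemma wr_optimizeC [simp]: "writesA (optimizeC r) = {Flag, Val}"
    "writesV (optimizeC r) = {vU, vL, vJ, vD, vK, vM, vB, vR, vT, vQ}"
  by (auto simp: optimizeC_def)

lemma wr_coreC [simp]: "writesA (coreC r) = {Flag, Val}"
    "writesV (coreC r) = {vI, vU, vL, vJ, vD, vK, vM, vB, vR, vT, vQ}"
  by (auto simp: coreC_def)

definition out :: "st \<Rightarrow> nat list" where
  "out s = map (snd s Out) [0..<fst s vP]"

lemma out_pushC: "out (den (pushC e) s) = out s @ [ev e s]"
  by (simp add: out_def pushC_def)

lemma out_setv [simp]: "x \<noteq> vP \<Longrightarrow> out (setv x i s) = out s"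
  by (simp add: out_def)

lemma out_frame: "Out \<notin> writesA c \<Longrightarrow> vP \<notin> writesV c \<Longrightarrow> out (den c s) = out s"
  by (simp add: out_def frameA frameV)

text \<open>Bounds that are small for syntactic reasons. The exceptions in the program are the trial
  loop, bounded by \<open>vM\<close>, and \<open>halfE\<close>, bounded by \<open>vQ\<close>; these
  are treated separately.\<close>

definition stdB :: "nat \<Rightarrow> ex \<Rightarrow> bool" where
  "stdB r e \<longleftrightarrow> e = nE \<or> e = mE \<or> (\<exists>k\<le>2 * r. e = Cst k) \<or> (\<exists>f. e = boolE f)"

primrec stdE :: "nat \<Rightarrow> ex \<Rightarrow> bool" where
  "stdE r (Cst k) = True"
| "stdE r (Var x) = True"
| "stdE r (Arr a e) = stdE r e"
| "stdE r (Add e f) = (stdE r e \<and> stdE r f)"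
| "stdE r (Sub e f) = (stdE r e \<and> stdE r f)"
| "stdE r (Sum x e f) = (stdB r e \<and> stdE r e \<and> stdE r f)"

primrec stdC :: "nat \<Rightarrow> cm \<Rightarrow> bool" where
  "stdC r (Set x e) = stdE r e"
| "stdC r (Put a e f) = (stdE r e \<and> stdE r f)"
| "stdC r (c ;; d) = (stdC r c \<and> stdC r d)"
| "stdC r (For x e c) = (stdB r e \<and> stdE r e \<and> stdC r c)"

lemma stdB_intros [simp]: "stdB r nE" "stdB r mE" "k \<le> 2 * r \<Longrightarrow> stdB r (Cst k)" "stdB r (boolE e)"
  by (auto simp: stdB_def)

lemma stdE_basic [simp]: "stdE r nE" "stdE r mE" "stdE r (xE e) = stdE r e"
    "stdE r (boolE e) = stdE r e" "stdE r (eqE e f) = (stdE r e \<and> stdE r f)"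
  by (auto simp: nE_def mE_def xE_def boolE_def eqE_def)

lemma stdE_clause [simp]: "stdE r (posE r e) = stdE r e" "stdE r (lvE r)" "stdE r (lsE r)"
  by (simp_all add: posE_def lvE_def lsE_def)

lemma stdE_formula [simp]: "stdE r (satE r)" "stdE r (numE r)" "stdE r activeE" "stdE r (usedE r)"
  by (simp_all add: satE_def numE_def activeE_def usedE_def)

lemma stdC_ifC [simp]: "stdC r (ifC e c) = (stdE r e \<and> stdC r c)"
  by (simp add: ifC_def)

lemma stdC_closeC: "stdC r (closeC r)" and stdC_sizeC: "stdC r sizeC"
  by (simp_all add: closeC_def passC_def sizeC_def)

lemma stdC_headC: "stdC r (headC r)" and stdC_tailC: "stdC r (tailC r)"
  by (simp_all add: headC_def tailC_def pushC_def)

section \<open>Correctness of the maximisation\<close>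

text \<open>The assignment \<open>\<rho>\<close> restricted to \<open>C\<close>, as the number whose binary digits \<open>decodeC\<close> reads off.\<close>

fun index :: "(nat \<Rightarrow> bool) \<Rightarrow> nat set \<Rightarrow> nat list \<Rightarrow> nat" where
  "index \<rho> C [] = 0"
| "index \<rho> C (y # ys) =
     (if y \<in> C then of_bool (\<rho> y) + 2 * index \<rho> C ys else index \<rho> C ys)"

lemma index_less: "distinct ys \<Longrightarrow> index \<rho> C ys < 2 ^ card (C \<inter> set ys)"
proof (induction ys)
  case (Cons y ys)
  then show ?case
    by (cases "\<rho> y") (auto simp: Int_insert_right)
qed simp

lemma index_cong: "(\<And>y. y \<in> set ys \<Longrightarrow> \<rho> y = \<sigma> y) \<Longrightarrow> index \<rho> C ys = index \<sigma> C ys"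
  by (induction ys) auto

text \<open>Together with \<open>index_less\<close> and \<open>index_inj\<close>, for
  \<open>C\<close> inside \<open>ys\<close>: the numbers below \<open>2 ^ |C|\<close> enumerate the
  assignments on \<open>C\<close>, so the trial loop misses none.\<close>

lemma index_surj: "distinct ys \<Longrightarrow> t < 2 ^ card (C \<inter> set ys) \<Longrightarrow> \<exists>\<rho>. index \<rho> C ys = t"
proof (induction ys arbitrary: t)
  case (Cons y ys)
  show ?case
  proof (cases "y \<in> C")
    case True
    then have "t div 2 < 2 ^ card (C \<inter> set ys)"
      using Cons.prems by (simp add: Int_insert_right)
    then obtain \<rho> where \<rho>: "index \<rho> C ys = t div 2"
      using Cons by auto
    have "index (\<rho>(y := odd t)) C ys = index \<rho> C ys"
      using Cons.prems by (intro index_cong) auto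
    then have "index (\<rho>(y := odd t)) C (y # ys) = t"
      using True \<rho> by (simp add: mod_2_eq_odd[symmetric])
    then show ?thesis by blast
  next
    case False
    then show ?thesis using Cons by auto
  qed
qed simp

lemma index_inj: "index \<rho> C ys = index \<sigma> C ys \<Longrightarrow> y \<in> C \<Longrightarrow> y \<in> set ys \<Longrightarrow> \<rho> y = \<sigma> y"
proof (induction ys)
  case (Cons z ys)
  have "\<rho> z = \<sigma> z \<and> index \<rho> C ys = index \<sigma> C ys" if "z \<in> C"
    using Cons.prems(1) that by (cases "\<rho> z"; cases "\<sigma> z") (simp_all, presburger+)
  then show ?case using Cons by (cases "z \<in> C") auto
qed simp

context sat_instance
begin

definition good :: "st \<Rightarrow> bool" where
  "good s \<longleftrightarrow> snd s Inp = inp"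

text \<open>An equation of functions, also outside the variables of the formula: \<open>Val\<close>
  starts at zero and receives only bits.\<close>

definition val_is :: "st \<Rightarrow> (nat \<Rightarrow> bool) \<Rightarrow> bool" where
  "val_is s \<sigma> \<longleftrightarrow> snd s Val = (\<lambda>x. of_bool (\<sigma> x))"

text \<open>The restriction to \<open>vars F\<close> matches what \<open>closeC\<close>
  clears.\<close>

definition flagged :: "st \<Rightarrow> nat set" where
  "flagged s = {x \<in> vars F. snd s Flag x \<noteq> 0}"

definition active :: "st \<Rightarrow> nat set" where
  "active s = {j. j < m \<and> snd s Act j \<noteq> 0}"

lemma setv_invariant [simp]:
  "good (setv x i s) = good s" "val_is (setv x i s) = val_is s"
  "flagged (setv x i s) = flagged s" "active (setv x i s) = active s"
  by (auto simp: good_def val_is_def flagged_def active_def)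

lemma good_den [simp]: "Inp \<notin> writesA c \<Longrightarrow> good s \<Longrightarrow> good (den c s)"
  by (simp add: good_def frameA)

lemma active_den: "Act \<notin> writesA c \<Longrightarrow> active (den c s) = active s"
  by (simp add: active_def frameA)

lemma flagged_den: "Flag \<notin> writesA c \<Longrightarrow> flagged (den c s) = flagged s"
  by (simp add: flagged_def frameA)

lemma val_is_den: "Val \<notin> writesA c \<Longrightarrow> val_is (den c s) = val_is s"
  by (auto simp: val_is_def frameA)

lemma finite_active: "finite (active s)" and active_subset: "active s \<subseteq> {..<m}"
  by (auto simp: active_def)

lemma ev_nE [simp]: "good s \<Longrightarrow> ev nE s = n"
  by (simp add: nE_def good_def inp_0)

lemma ev_mE [simp]: "good s \<Longrightarrow> ev mE s = m"
  using ev_nE[of s] by (simp add: mE_def good_def inp_m)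

lemma ev_xE [simp]: "good s \<Longrightarrow> ev e s < n \<Longrightarrow> ev (xE e) s = xs ! ev e s"
  by (simp add: xE_def good_def inp_x)

lemma ev_posE: "good s \<Longrightarrow> ev (posE r e) s = n + 2 + (2 * r * fst s vJ + ev e s)"
  by (simp add: posE_def)

lemma ev_lvE [simp]: "good s \<Longrightarrow> fst s vJ < m \<Longrightarrow> fst s vK < r \<Longrightarrow>
    ev (lvE r) s = lit_var (fst s vJ) (fst s vK)"
  using inp_c[of "fst s vJ" "2 * fst s vK"] by (simp add: lvE_def ev_posE lit_var_def mult_2) (simp add: good_def)

lemma ev_lsE [simp]: "good s \<Longrightarrow> fst s vJ < m \<Longrightarrow> fst s vK < r \<Longrightarrow>
    ev (lsE r) s = lit_sign (fst s vJ) (fst s vK)"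
  using inp_c[of "fst s vJ" "2 * fst s vK + 1"] by (simp add: lsE_def ev_posE lit_sign_def mult_2) (simp add: good_def)

lemma ev_satE [simp]:
  assumes "good s" "val_is s \<sigma>" "fst s vJ < m"
  shows "ev (satE r) s = of_bool (sat \<sigma> (fst s vJ))"
proof -
  have "ev (Sum vK (Cst r) (eqE (Arr Val (lvE r)) (lsE r))) s =
      (\<Sum>k<r. of_bool (of_bool (\<sigma> (lit_var (fst s vJ) k)) = lit_sign (fst s vJ) k))"
    using assms by (simp add: val_is_def of_bool_def del: of_bool_eq_iff)
  also have "\<dots> = 0 \<longleftrightarrow> \<not> sat \<sigma> (fst s vJ)"
    by (subst sum_eq_0_iff) (auto simp: sat_def)
  finally show ?thesis by (simp add: satE_def)
qed

lemma sum_if_eq_card: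
  fixes k :: nat
  shows "(\<Sum>j<k. if P j then 0 else (1 :: nat)) = card {j. j < k \<and> \<not> P j}"
proof (induction k)
  case (Suc k)
  have "{j. j < Suc k \<and> \<not> P j} =
      (if P k then {j. j < k \<and> \<not> P j} else insert k {j. j < k \<and> \<not> P j})"
    by (auto simp: less_Suc_eq)
  then show ?case using Suc by simp
qed simp

lemma ev_numE [simp]:
  assumes "good s" "val_is s \<sigma>"
  shows "ev (numE r) s = count_sat (active s) \<sigma>"
proof -
  have "ev (numE r) s = (\<Sum>j<m. ev (Sum vD (boolE (Arr Act (Var vJ))) (satE r)) (setv vJ j s))"
    using assms by (simp add: numE_def)
  also have "\<dots> = (\<Sum>j<m. if snd s Act j = 0 \<or> \<not> sat \<sigma> j then 0 else 1)"
  proof (rule sum.cong[OF refl])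
    fix j assume "j \<in> {..<m}"
    then show "ev (Sum vD (boolE (Arr Act (Var vJ))) (satE r)) (setv vJ j s) =
        (if snd s Act j = 0 \<or> \<not> sat \<sigma> j then 0 else 1)"
      using assms ev_satE[of _ \<sigma>] by simp
  qed
  also have "\<dots> = count_sat (active s) \<sigma>"
    unfolding sum_if_eq_card count_sat_def active_def by (rule arg_cong[of _ _ card]) auto
  finally show ?thesis .
qed

lemma ev_activeE [simp]: "good s \<Longrightarrow> ev activeE s = card (active s)"
  by (simp add: activeE_def sum_if_eq_card active_def)

lemma ev_usedE:
  assumes "good s" "fst s vU < n"
  shows "ev (usedE r) s \<noteq> 0 \<longleftrightarrow> xs ! fst s vU \<in> (\<Union>j\<in>active s. clause_vars j)"
proof -
  have "ev (usedE r) s = (\<Sum>j<m. if snd s Act j = 0 then 0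
      else (\<Sum>k<r. if lit_var j k = xs ! fst s vU then 1 else 0))"
    unfolding usedE_def using assms by (auto intro!: sum.cong)
  also have "\<dots> = 0 \<longleftrightarrow> (\<forall>j<m. snd s Act j \<noteq> 0 \<longrightarrow> (\<forall>k<r. lit_var j k \<noteq> xs ! fst s vU))"
    by (auto simp: Ball_def)
  also have "\<dots> \<longleftrightarrow> xs ! fst s vU \<notin> (\<Union>j\<in>active s. clause_vars j)"
    unfolding active_def clause_vars_def UN_iff image_iff mem_Collect_eq lessThan_iff Bex_def by metis
  finally show ?thesis by argo
qed

lemma xs_in: "i < n \<Longrightarrow> xs ! i \<in> vars F"
  using set_xs nth_mem by (auto simp: n_def)

lemma in_vars_nth: "x \<in> vars F \<Longrightarrow> \<exists>i<n. x = xs ! i"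
  unfolding set_xs[symmetric] n_def by (metis in_set_conv_nth)

lemma insert_take_xs: "i < n \<Longrightarrow> set (take (Suc i) xs) = insert (xs ! i) (set (take i xs))"
  by (simp add: take_Suc_conv_app_nth n_def)

lemma xs_notin_take: "i < n \<Longrightarrow> xs ! i \<notin> set (take i xs)"
  using distinct_xs distinct_take[of xs "Suc i"] by (simp add: take_Suc_conv_app_nth n_def)

text \<open>Progress is measured against the flags at the start of the pass. Flags set during the
  pass may carry it further, but never beyond a closed set \<open>C\<close>.\<close>

lemma den_passC:
  assumes "good s" "flagged s \<subseteq> C" and C: "closed_under clause_vars {..<m} C"
  shows "flagged s \<subseteq> flagged (den (passC r) s) \<and> flagged (den (passC r) s) \<subseteq> C \<and>
    (\<forall>j<m. clause_vars j \<inter> flagged s \<noteq> {} \<longrightarrow> clause_vars j \<subseteq> flagged (den (passC r) s))"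
proof -
  let ?P = "\<lambda>i t. good t \<and> flagged s \<subseteq> flagged t \<and> flagged t \<subseteq> C \<and>
    (\<forall>j<i. clause_vars j \<inter> flagged s \<noteq> {} \<longrightarrow> clause_vars j \<subseteq> flagged t)"
  have "?P m (den (passC r) s)"
    unfolding passC_def
  proof (rule den_For[where P = ?P])
    fix j t assume j: "j < m" and P: "?P j t"
    let ?t = "setv vJ j t"
    let ?e = "Sum vK (Cst r) (Arr Flag (lvE r))"
    let ?c = "For vK (Cst r) (Put Flag (lvE r) (Cst 1))"
    have e: "ev ?e ?t = 0 \<longleftrightarrow> clause_vars j \<inter> flagged t = {}"
      using P j lit_var_in[OF j] by (auto simp: flagged_def clause_vars_def)
    show "?P (Suc j) (den (ifC ?e ?c) ?t)"
    proof (cases "clause_vars j \<inter> flagged t = {}")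
      case True
      then have "den (ifC ?e ?c) ?t = ?t" using e by (simp add: den_ifC del: den.simps ev.simps)
      then show ?thesis using P True by (auto simp: less_Suc_eq)
    next
      case False
      then have "den (ifC ?e ?c) ?t = den ?c (setv vD 0 ?t)" using e by (simp add: den_ifC del: den.simps ev.simps)
      moreover have "good (den ?c (setv vD 0 ?t)) \<and> fst (den ?c (setv vD 0 ?t)) vJ = j \<and>
          flagged (den ?c (setv vD 0 ?t)) = flagged t \<union> lit_var j ` {..<r}"
      proof (rule den_For[where P = "\<lambda>k u. good u \<and> fst u vJ = j \<and> flagged u = flagged t \<union> lit_var j ` {..<k}"])
        fix k u assume k: "k < r" and u: "good u \<and> fst u vJ = j \<and> flagged u = flagged t \<union> lit_var j ` {..<k}"
        have "flagged (den (Put Flag (lvE r) (Cst 1)) (setv vK k u)) = insert (lit_var j k) (flagged u)"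
          using u j k lit_var_in[OF j k] by (auto simp: flagged_def)
        then show "good (den (Put Flag (lvE r) (Cst 1)) (setv vK k u)) \<and>
            fst (den (Put Flag (lvE r) (Cst 1)) (setv vK k u)) vJ = j \<and>
            flagged (den (Put Flag (lvE r) (Cst 1)) (setv vK k u)) = flagged t \<union> lit_var j ` {..<Suc k}"
          using u by (auto simp: lessThan_Suc simp del: den.simps) simp
      qed (use P in simp_all)
      ultimately obtain u where u: "den (ifC ?e ?c) ?t = u" "good u" "flagged u = flagged t \<union> clause_vars j"
        by (simp add: clause_vars_def del: den.simps)
      have "clause_vars j \<subseteq> C" using C j False P by (auto simp: closed_under_def)
      then show ?thesis
        using P unfolding u(1) by (auto simp: u(2,3) less_Suc_eq)
    qed
  qed (use assms in simp_all)
  then show ?thesis by simp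
qed

lemma flagged_closeC:
  assumes "good s" "fst s vI < n"
  shows "flagged (den (closeC r) s) = component (xs ! fst s vI)"
proof -
  define v where "v = xs ! fst s vI"
  have v: "v \<in> vars F" using xs_in assms(2) by (simp add: v_def)
  let ?c1 = "For vU nE (Put Flag (xE (Var vU)) (Cst 0))"
  let ?c2 = "Put Flag (xE (Var vI)) (Cst 1)"
  define s1 where "s1 = den ?c1 s"
  define s2 where "s2 = den ?c2 s1"
  have "good s1 \<and> fst s1 vI = fst s vI \<and> (\<forall>i<n. snd s1 Flag (xs ! i) = 0)"
    unfolding s1_def
  proof (rule den_For[where P = "\<lambda>i t. good t \<and> fst t vI = fst s vI \<and> (\<forall>i'<i. snd t Flag (xs ! i') = 0)"])
    fix i t assume "i < n" "good t \<and> fst t vI = fst s vI \<and> (\<forall>i'<i. snd t Flag (xs ! i') = 0)"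
    moreover from this have "good (den (Put Flag (xE (Var vU)) (Cst 0)) (setv vU i t))"
      by (intro good_den) auto
    ultimately show "good (den (Put Flag (xE (Var vU)) (Cst 0)) (setv vU i t)) \<and>
        fst (den (Put Flag (xE (Var vU)) (Cst 0)) (setv vU i t)) vI = fst s vI \<and>
        (\<forall>i'<Suc i. snd (den (Put Flag (xE (Var vU)) (Cst 0)) (setv vU i t)) Flag (xs ! i') = 0)"
      by (auto simp: less_Suc_eq)
  qed (use assms in simp_all)
  then have s1: "good s1" "fst s1 vI = fst s vI" "\<And>i. i < n \<Longrightarrow> snd s1 Flag (xs ! i) = 0"
    by blast+
  have g2: "good s2" unfolding s2_def by (rule good_den) (simp_all add: s1(1) del: den.simps)
  have "snd s2 Flag = (snd s1 Flag)(v := 1)"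
    using s1 assms(2) by (simp add: v_def s2_def)
  moreover have "snd s1 Flag x = 0" if "x \<in> vars F" for x
    using s1(3) in_vars_nth[OF that] by auto
  ultimately have f2: "flagged s2 = {v}"
    using v by (auto simp: flagged_def)
  let ?C = "component v"
  \<comment> \<open>Until the component is complete, each round adds at least one variable to the
    initial one.\<close>
  let ?P = "\<lambda>i t. good t \<and> v \<in> flagged t \<and> flagged t \<subseteq> ?C \<and> (flagged t = ?C \<or> Suc i \<le> card (flagged t))"
  have "?P n (den (For vL nE (passC r)) s2)"
  proof (rule den_For[where P = ?P])
    fix i t assume "i < n" and P: "?P i t"
    let ?t = "setv vL i t"
    let ?t' = "den (passC r) ?t"
    have p: "flagged t \<subseteq> flagged ?t'" "flagged ?t' \<subseteq> ?C"
      "\<And>j. j < m \<Longrightarrow> clause_vars j \<inter> flagged t \<noteq> {} \<Longrightarrow> clause_vars j \<subseteq> flagged ?t'"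
      using den_passC[of ?t ?C] P closed_component by auto
    have "Suc (Suc i) \<le> card (flagged ?t')" if ne: "flagged ?t' \<noteq> ?C"
    proof -
      have "flagged t \<noteq> ?C" using ne p by blast
      \<comment> \<open>A pass that adds nothing has found a closed set, which contains the
        component by minimality.\<close>
      moreover have "flagged ?t' \<noteq> flagged t"
      proof
        assume eq: "flagged ?t' = flagged t"
        then have "closed_under clause_vars {..<m} (flagged t)"
          using p(3) by (auto simp: closed_under_def)
        then have "?C \<subseteq> flagged t"
          unfolding component_def using P by (intro reach_least) auto
        then show False using ne eq p(2) by blast
      qed
      moreover have "finite (flagged ?t')"
        using finite_vars by (simp add: flagged_def)
      ultimately show ?thesis
        using P p(1) psubset_card_mono[of "flagged ?t'" "flagged t"] by fastforce
    qed
    then show "?P (Suc i) ?t'" using P p by auto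
  qed (use g2 f2 component_self in \<open>simp_all del: den.simps\<close>)
  moreover have "card (flagged t) \<le> n" for t
    unfolding card_vars[symmetric] using finite_vars by (intro card_mono) (auto simp: flagged_def)
  \<comment> \<open>An incomplete component after \<open>n\<close> rounds would have
    \<open>n + 1\<close> flagged variables among \<open>n\<close>.\<close>
  ultimately have "flagged (den (For vL nE (passC r)) s2) = ?C"
    by (metis Suc_n_not_le_n le_trans)
  then show ?thesis by (simp add: closeC_def v_def s1_def s2_def)
qed

lemma vM_sizeC:
  assumes "good s"
  shows "fst (den sizeC s) vM = 2 ^ card (flagged s)"
proof -
  let ?c = "ifC (Arr Flag (xE (Var vU))) (Set vM (Add (Var vM) (Var vM)))"
  let ?P = "\<lambda>i t. good t \<and> flagged t = flagged s \<and>
    fst t vM = 2 ^ card (flagged s \<inter> set (take i xs))"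
  have "?P n (den (For vU nE ?c) (setv vM 1 s))"
  proof (rule den_For[where P = ?P])
    fix i t assume i: "i < n" and P: "?P i t"
    let ?t = "setv vU i t"
    have "snd t Flag (xs ! i) \<noteq> 0 \<longleftrightarrow> xs ! i \<in> flagged s"
      using P xs_in[OF i] by (auto simp: flagged_def)
    then have "fst (den ?c ?t) vM = (if xs ! i \<in> flagged s then 2 * fst t vM else fst t vM)"
      using P i by (auto simp: den_ifC)
    also have "\<dots> = 2 ^ card (flagged s \<inter> set (take (Suc i) xs))"
      using P xs_notin_take[OF i] by (simp add: insert_take_xs[OF i] Int_insert_right)
    finally show "?P (Suc i) (den ?c ?t)"
      using P by (simp add: flagged_den)
  qed (use assms in simp_all)
  moreover have "flagged s \<inter> set (take n xs) = flagged s"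
    by (auto simp: n_def set_xs flagged_def)
  ultimately show ?thesis by (simp add: sizeC_def)
qed

lemma val_is_decodeC:
  assumes "good s" "val_is s \<sigma>" "fst s vQ = index \<rho> (flagged s) xs"
  shows "val_is (den decodeC s) (merge (flagged s) \<rho> \<sigma>)"
proof -
  let ?C = "flagged s"
  let ?c' = "Put Val (xE (Var vU)) (Sub (Var vQ) (Add halfE halfE)) ;; Set vQ halfE"
  let ?c = "ifC (Arr Flag (xE (Var vU))) ?c'"
  \<comment> \<open>After \<open>i\<close> variables, \<open>vQ\<close> is the index of the
    remaining ones and the merge covers the first \<open>i\<close>.\<close>
  let ?P = "\<lambda>i t. good t \<and> flagged t = ?C \<and> fst t vQ = index \<rho> ?C (drop i xs) \<and>
    val_is t (merge (?C \<inter> set (take i xs)) \<rho> \<sigma>)"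
  have "?P n (den decodeC s)"
    unfolding decodeC_def
  proof (rule den_For[where P = ?P])
    fix i t assume i: "i < n" and P: "?P i t"
    let ?t = "setv vU i t"
    let ?x = "xs ! i"
    have drop: "drop i xs = ?x # drop (Suc i) xs"
      using i by (simp add: Cons_nth_drop_Suc n_def)
    have flag: "snd t Flag ?x \<noteq> 0 \<longleftrightarrow> ?x \<in> ?C"
      using P xs_in[OF i] by (auto simp: flagged_def)
    have "fst (den ?c ?t) vQ = index \<rho> ?C (drop (Suc i) xs) \<and>
        val_is (den ?c ?t) (merge (?C \<inter> set (take (Suc i) xs)) \<rho> \<sigma>)"
    proof (cases "?x \<in> ?C")
      case False
      then have "den ?c ?t = ?t" using P i flag by (simp add: den_ifC)
      then show ?thesis
        using P False by (simp add: drop insert_take_xs[OF i])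
    next
      case True
      then have c: "den ?c ?t = den ?c' (setv vD 0 ?t)" using P i flag by (simp add: den_ifC)
      have q: "fst t vQ = of_bool (\<rho> ?x) + 2 * index \<rho> ?C (drop (Suc i) xs)"
        using P True drop by simp
      then have "fst t vQ - (fst t vQ div 2 + fst t vQ div 2) = of_bool (\<rho> ?x)"
        "fst t vQ div 2 = index \<rho> ?C (drop (Suc i) xs)"
        by (cases "\<rho> ?x"; simp)+
      moreover have "(\<lambda>x. of_bool (merge (?C \<inter> set (take i xs)) \<rho> \<sigma> x) :: nat)(?x := of_bool (\<rho> ?x)) =
          (\<lambda>x. of_bool (merge (?C \<inter> set (take (Suc i) xs)) \<rho> \<sigma> x))"
        using True by (auto simp: merge_def insert_take_xs[OF i] fun_eq_iff)
      ultimately show ?thesis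
        unfolding c using P i by (simp add: val_is_def)
    qed
    then show "?P (Suc i) (den ?c ?t)"
      using P by (simp add: flagged_den)
  qed (use assms in \<open>simp_all add: merge_def\<close>)
  moreover have "flagged s \<inter> set (take n xs) = flagged s"
    by (auto simp: n_def set_xs flagged_def)
  ultimately show ?thesis by simp
qed

lemma den_tryC:
  assumes "good s" "val_is s \<sigma>" "fst s vT = index \<rho> (flagged s) xs"
  defines "k \<equiv> count_sat (active s) (merge (flagged s) \<rho> \<sigma>)"
  shows "val_is (den (tryC r) s) (merge (flagged s) \<rho> \<sigma>)"
    and "fst (den (tryC r) s) vB = max k (fst s vB)"
    and "fst (den (tryC r) s) vR = (if fst s vB \<le> k then fst s vT else fst s vR)"
proof -
  let ?s1 = "den decodeC (setv vQ (fst s vT) s)"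
  let ?e = "Sub (Add (numE r) (Cst 1)) (Var vB)"
  let ?c = "Set vB (numE r) ;; Set vR (Var vT)"
  have s1: "good ?s1" "val_is ?s1 (merge (flagged s) \<rho> \<sigma>)" "active ?s1 = active s"
    "fst ?s1 vB = fst s vB" "fst ?s1 vR = fst s vR" "fst ?s1 vT = fst s vT"
    using assms(1-3) val_is_decodeC[of "setv vQ (fst s vT) s" \<sigma> \<rho>]
    by (simp_all add: active_den frameV)
  have "den (tryC r) s = den (ifC ?e ?c) ?s1" by (simp add: tryC_def)
  moreover have "ev ?e ?s1 = 0 \<longleftrightarrow> k < fst s vB"
    using s1 by (auto simp: k_def)
  ultimately show "val_is (den (tryC r) s) (merge (flagged s) \<rho> \<sigma>)"
    and "fst (den (tryC r) s) vB = max k (fst s vB)"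
    and "fst (den (tryC r) s) vR = (if fst s vB \<le> k then fst s vT else fst s vR)"
    using s1 by (auto simp: den_ifC k_def)
qed

end

lemma merge_merge [simp]: "merge C \<rho> (merge C \<rho>' \<sigma>) = merge C \<rho> \<sigma>"
  by (auto simp: merge_def)

context sat_instance
begin

lemma den_try_all:
  assumes "good s" "val_is s \<sigma>" "flagged s = C" "fst s vB = 0"
  defines "k \<equiv> \<lambda>\<rho>. count_sat (active s) (merge C \<rho> \<sigma>)"
    and "s' \<equiv> den (For vT (Var vM) (tryC r)) s"
  assumes M: "fst s vM = 2 ^ card C"
  shows "(\<exists>\<rho>. val_is s' (merge C \<rho> \<sigma>)) \<and> (\<forall>\<rho>. k \<rho> \<le> fst s' vB) \<and>
    (\<exists>\<rho>. index \<rho> C xs = fst s' vR \<and> k \<rho> = fst s' vB)"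
proof -
  have C: "C \<subseteq> set xs" using assms(3) by (auto simp: flagged_def set_xs)
  then have card: "card (C \<inter> set xs) = card C" by (simp add: Int_absorb2)
  \<comment> \<open>\<open>vR\<close> describes an optimum only after the first trial; before it,
    \<open>vB\<close> must be 0 so that this trial is accepted.\<close>
  let ?P = "\<lambda>i t. good t \<and> flagged t = C \<and> active t = active s \<and>
    (\<exists>\<rho>. val_is t (merge C \<rho> \<sigma>)) \<and> (\<forall>\<rho>. index \<rho> C xs < i \<longrightarrow> k \<rho> \<le> fst t vB) \<and>
    (if i = 0 then fst t vB = 0 else \<exists>\<rho>. index \<rho> C xs = fst t vR \<and> k \<rho> = fst t vB)"
  have "?P (2 ^ card C) s'"
    unfolding s'_def
  proof (rule den_For[where P = ?P])
    fix i t assume i: "i < 2 ^ card C" and P: "?P i t"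
    let ?t = "setv vT i t"
    let ?t' = "den (tryC r) ?t"
    obtain \<rho>0 where \<rho>0: "val_is t (merge C \<rho>0 \<sigma>)" using P by blast
    obtain \<rho> where \<rho>: "index \<rho> C xs = i"
      using index_surj[OF distinct_xs, of i C] i card by auto
    have t': "val_is ?t' (merge C \<rho> \<sigma>)" "fst ?t' vB = max (k \<rho>) (fst t vB)"
      "fst ?t' vR = (if fst t vB \<le> k \<rho> then i else fst t vR)"
      using den_tryC[of ?t "merge C \<rho>0 \<sigma>" \<rho>] P \<rho>0 \<rho> by (simp_all add: k_def)
    \<comment> \<open>The count depends on an assignment only through its index, so one
      representative per index covers all.\<close>
    have same: "k \<rho>' = k \<rho>" if "index \<rho>' C xs = i" for \<rho>'
    proof -
      have "merge C \<rho>' \<sigma> = merge C \<rho> \<sigma>"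
        using index_inj[of \<rho>' C xs \<rho>] that \<rho> C by (auto simp: merge_def fun_eq_iff)
      then show ?thesis by (simp add: k_def)
    qed
    have "k \<rho>' \<le> fst ?t' vB" if "index \<rho>' C xs < Suc i" for \<rho>'
    proof (cases "index \<rho>' C xs = i")
      case True
      then show ?thesis using same t'(2) by simp
    next
      case False
      then have "k \<rho>' \<le> fst t vB" using P that by simp
      then show ?thesis using t'(2) by simp
    qed
    moreover have "\<exists>\<rho>. index \<rho> C xs = fst ?t' vR \<and> k \<rho> = fst ?t' vB"
    proof (cases "fst t vB \<le> k \<rho>")
      case True
      then show ?thesis using t' \<rho> by (intro exI[of _ \<rho>]) simp
    next
      case False
      then have "i \<noteq> 0" using P by (intro notI) simp
      then obtain \<rho>' where "index \<rho>' C xs = fst t vR" "k \<rho>' = fst t vB" using P by auto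
      then show ?thesis using t' False by (intro exI[of _ \<rho>']) simp
    qed
    ultimately show "?P (Suc i) ?t'"
      using P t'(1) by (auto simp: flagged_den active_den)
  next
    have "merge C \<sigma> \<sigma> = \<sigma>" by (auto simp: merge_def)
    then have "val_is s (merge C \<sigma> \<sigma>)" using assms(2) by simp
    then show "?P 0 s" using assms(1,3,4) by auto
  qed (simp add: M)
  moreover have "index \<rho> C xs < 2 ^ card C" for \<rho>
    using index_less[OF distinct_xs, of \<rho> C] card by simp
  ultimately show ?thesis by simp
qed

lemma val_is_optimizeC:
  assumes "good s" "val_is s \<sigma>" "fst s vI < n"
  shows "\<exists>\<rho>. val_is (den (optimizeC r) s) (merge (component (xs ! fst s vI)) \<rho> \<sigma>) \<and>
    (\<forall>\<rho>'. count_sat (active s) (merge (component (xs ! fst s vI)) \<rho>' \<sigma>) \<le>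
      count_sat (active s) (merge (component (xs ! fst s vI)) \<rho> \<sigma>))"
proof -
  let ?C = "component (xs ! fst s vI)"
  let ?k = "\<lambda>\<rho>. count_sat (active s) (merge ?C \<rho> \<sigma>)"
  define s1 where "s1 = den (closeC r) s"
  define s3 where "s3 = setv vR 0 (setv vB 0 (den sizeC s1))"
  define s4 where "s4 = den (For vT (Var vM) (tryC r)) s3"
  define s5 where "s5 = setv vQ (fst s4 vR) s4"
  have s1: "good s1" "val_is s1 \<sigma>" "flagged s1 = ?C" "active s1 = active s"
    using assms flagged_closeC[OF assms(1,3)] by (simp_all add: s1_def val_is_den active_den)
  have s3: "good s3" "val_is s3 \<sigma>" "flagged s3 = ?C" "active s3 = active s"
      "fst s3 vB = 0" "fst s3 vM = 2 ^ card ?C"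
    using s1 vM_sizeC[OF s1(1)] by (simp_all add: s3_def val_is_den active_den flagged_den)
  obtain \<rho>0 \<rho> where 4: "val_is s4 (merge ?C \<rho>0 \<sigma>)" "\<And>\<rho>'. ?k \<rho>' \<le> fst s4 vB"
      "index \<rho> ?C xs = fst s4 vR" "?k \<rho> = fst s4 vB"
    using den_try_all[OF s3(1,2,3,5,6)] unfolding s4_def s3(4) by blast
  have s5: "good s5" "val_is s5 (merge ?C \<rho>0 \<sigma>)" "flagged s5 = ?C"
    using s3 4(1) by (simp_all add: s5_def s4_def flagged_den del: den.simps)
  \<comment> \<open>The last trial left some \<open>\<rho>0\<close> on \<open>?C\<close>; decoding
    the best index overwrites it completely, by \<open>merge_merge\<close>.\<close>
  have "val_is (den decodeC s5) (merge ?C \<rho> \<sigma>)"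
    using val_is_decodeC[OF s5(1,2), of \<rho>] s5(3) 4(3) by (simp add: s5_def)
  moreover have "den (optimizeC r) s = den decodeC s5"
    by (simp add: optimizeC_def s5_def s4_def s3_def s1_def)
  ultimately show ?thesis using 4(2,4) by (intro exI[of _ \<rho>]) simp
qed

text \<open>Invariant: pasting the current assignment, on the union \<open>?D i\<close> of the
  components treated so far, into any \<tau> never lowers the count. Overlaps do no harm, so a
  component may be treated once for each of its variables. At the end \<open>?D n\<close> contains
  all variables of the formula, and nothing relevant of \<tau> is left.\<close>

lemma val_is_coreC:
  assumes "good s" "val_is s \<sigma>"
  shows "\<exists>\<sigma>'. val_is (den (coreC r) s) \<sigma>' \<and> (\<forall>\<tau>. count_sat (active s) \<tau> \<le> count_sat (active s) \<sigma>')"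
proof -
  let ?k = "count_sat (active s)"
  let ?D = "\<lambda>i. \<Union>i'<i. component (xs ! i')"
  let ?P = "\<lambda>i t. good t \<and> active t = active s \<and>
    (\<exists>\<sigma>'. val_is t \<sigma>' \<and> (\<forall>\<tau>. ?k \<tau> \<le> ?k (merge (?D i) \<sigma>' \<tau>)))"
  have "?P n (den (coreC r) s)"
    unfolding coreC_def
  proof (rule den_For[where P = ?P])
    fix i t assume i: "i < n" and P: "?P i t"
    let ?t = "setv vI i t"
    let ?C = "component (xs ! i)"
    obtain \<sigma>1 where \<sigma>1: "val_is t \<sigma>1" "\<And>\<tau>. ?k \<tau> \<le> ?k (merge (?D i) \<sigma>1 \<tau>)"
      using P by blast
    obtain \<rho> where \<rho>: "val_is (den (optimizeC r) ?t) (merge ?C \<rho> \<sigma>1)"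
        "\<And>\<rho>'. ?k (merge ?C \<rho>' \<sigma>1) \<le> ?k (merge ?C \<rho> \<sigma>1)"
      using val_is_optimizeC[of ?t \<sigma>1] P \<sigma>1(1) i by auto
    let ?\<sigma>2 = "merge ?C \<rho> \<sigma>1"
    have "?k \<tau> \<le> ?k (merge (?D (Suc i)) ?\<sigma>2 \<tau>)" for \<tau>
    proof -
      have "?k \<tau> \<le> ?k (merge (?D i) \<sigma>1 \<tau>)" by (rule \<sigma>1(2))
      also have "\<dots> \<le> ?k (merge ?C ?\<sigma>2 (merge (?D i) \<sigma>1 \<tau>))"
        using \<rho>(2) by (intro count_sat_le_merge_optimum closed_component active_subset) simp
      \<comment> \<open>\<open>?\<sigma>2\<close> and \<open>\<sigma>1\<close> agree outside
        \<open>?C\<close>, so the nested merges collapse into one.\<close>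
      also have "merge ?C ?\<sigma>2 (merge (?D i) \<sigma>1 \<tau>) = merge (?D (Suc i)) ?\<sigma>2 \<tau>"
        by (auto simp: merge_def lessThan_Suc fun_eq_iff)
      finally show ?thesis .
    qed
    then show "?P (Suc i) (den (optimizeC r) ?t)"
      using P \<rho>(1) by (auto simp: active_den)
  next
    show "?P 0 s" using assms by (auto simp: merge_def)
  qed (use assms in simp)
  then obtain \<sigma>' where \<sigma>': "val_is (den (coreC r) s) \<sigma>'" "\<And>\<tau>. ?k \<tau> \<le> ?k (merge (?D n) \<sigma>' \<tau>)"
    by blast
  have "?k (merge (?D n) \<sigma>' \<tau>) = ?k \<sigma>'" for \<tau>
  proof -
    have "sat (merge (?D n) \<sigma>' \<tau>) j = sat \<sigma>' j" if "j \<in> active s" for j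
    proof (rule sat_cong)
      fix x assume "x \<in> clause_vars j"
      then have "x \<in> vars F" using that clause_vars_subset[of j] by (auto simp: active_def)
      then obtain i where "i < n" "x = xs ! i" using in_vars_nth by blast
      then have "x \<in> ?D n" using component_self by auto
      then show "merge (?D n) \<sigma>' \<tau> x = \<sigma>' x" by (simp add: merge_def)
    qed
    then show ?thesis unfolding count_sat_def by (metis (mono_tags, lifting) Collect_cong)
  qed
  then show ?thesis using \<sigma>' by metis
qed

text \<open>The last conjunct is the one that can be exponential in the input size; it limits
  \<open>vM\<close> and, through the trial numbers, \<open>vQ\<close>.\<close>

definition bound :: "nat \<Rightarrow> bool" where
  "bound W \<longleftrightarrow> 1 \<le> W \<and> n \<le> W \<and> m \<le> W \<and> 2 * r \<le> W \<and> (\<forall>v\<in>vars F. 2 ^ card (component v) \<le> W)"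

lemma ev_stdB_le: "bound W \<Longrightarrow> stdB r e \<Longrightarrow> good s \<Longrightarrow> ev e s \<le> W"
  by (auto simp: stdB_def bound_def)

lemma okE_std: "bound W \<Longrightarrow> stdE r e \<Longrightarrow> good s \<Longrightarrow> okE W e s"
  by (induction e arbitrary: s) (simp_all add: ev_stdB_le)

lemma ok_std: "bound W \<Longrightarrow> stdC r c \<Longrightarrow> Inp \<notin> writesA c \<Longrightarrow> good s \<Longrightarrow> ok W c s"
proof (induction c arbitrary: s)
  case (For x e c)
  show ?case
    by (rule ok_For[where P = "\<lambda>i. good" and k = "ev e s"])
      (use For in \<open>auto simp: okE_std ev_stdB_le\<close>)
qed (auto simp: okE_std)

lemma okE_halfE: "bound W \<Longrightarrow> fst s vQ \<le> W \<Longrightarrow> okE W halfE s"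
  by (simp add: halfE_def boolE_def)

text \<open>Halving never increases \<open>vQ\<close>, so its initial bound persists for every use
  of \<open>halfE\<close>.\<close>

lemma ok_decodeC:
  assumes "bound W" "good s" "fst s vQ \<le> W"
  shows "ok W decodeC s"
proof -
  let ?c' = "Put Val (xE (Var vU)) (Sub (Var vQ) (Add halfE halfE)) ;; Set vQ halfE"
  let ?c = "ifC (Arr Flag (xE (Var vU))) ?c'"
  let ?P = "\<lambda>i t. good t \<and> fst t vQ \<le> W"
  show ?thesis
    unfolding decodeC_def
  proof (rule ok_For[where P = ?P])
    fix i t assume i: "i < n" and P: "?P i t"
    let ?t = "setv vU i t"
    have "ok W ?c ?t"
    proof (rule ok_ifC)
      have "okE W (xE (Var vU)) (setv vD 0 ?t)" "okE W (Arr Flag (xE (Var vU))) ?t"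
        using P assms(1) by (intro okE_std; simp)+
      then show "ok W ?c' (setv vD 0 ?t)" "okE W (Arr Flag (xE (Var vU))) ?t"
        using P assms(1) by (simp_all add: okE_halfE)
    qed (use assms(1) in \<open>simp add: bound_def\<close>)
    moreover have "fst (den ?c ?t) vQ \<le> W"
      using P div_le_dividend[of "fst t vQ" 2] by (auto simp: den_ifC simp del: div_le_dividend)
    ultimately show "ok W ?c ?t \<and> ?P (Suc i) (den ?c ?t)"
      using P by simp
  qed (use assms in \<open>auto simp: okE_std bound_def\<close>)
qed

lemma ok_tryC:
  assumes "bound W" "good s" "fst s vT \<le> W"
  shows "ok W (tryC r) s"
proof -
  let ?s1 = "den decodeC (setv vQ (fst s vT) s)"
  have "ok W decodeC (setv vQ (fst s vT) s)"
    using assms by (intro ok_decodeC) simp_all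
  moreover have "ok W (ifC (Sub (Add (numE r) (Cst 1)) (Var vB)) (Set vB (numE r) ;; Set vR (Var vT))) ?s1"
    using assms by (intro ok_std) simp_all
  ultimately show ?thesis by (simp add: tryC_def)
qed

lemma ok_optimizeC:
  assumes W: "bound W" and "good s" "fst s vI < n"
  shows "ok W (optimizeC r) s"
proof -
  let ?C = "component (xs ! fst s vI)"
  define s1 where "s1 = den (closeC r) s"
  define s3 where "s3 = setv vR 0 (setv vB 0 (den sizeC s1))"
  define s4 where "s4 = den (For vT (Var vM) (tryC r)) s3"
  define s5 where "s5 = setv vQ (fst s4 vR) s4"
  have s1: "good s1" "flagged s1 = ?C"
    using assms flagged_closeC[OF assms(2,3)] by (simp_all add: s1_def)
  have s3: "good s3" "fst s3 vM = 2 ^ card ?C" "fst s3 vR = 0"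
    using s1 vM_sizeC[OF s1(1)] by (simp_all add: s3_def)
  have M: "fst s3 vM \<le> W"
    using W xs_in[OF assms(3)] by (simp add: s3(2) bound_def)
  \<comment> \<open>\<open>vR\<close> is 0 or a trial number below \<open>vM\<close>; this limits
    the digits read by the final decoding.\<close>
  have "good s4 \<and> fst s4 vR \<le> W"
    unfolding s4_def
  proof (rule den_For[where P = "\<lambda>i t. good t \<and> fst t vR \<le> W" and k = "fst s3 vM"])
    fix i t assume i: "i < fst s3 vM" and P: "good t \<and> fst t vR \<le> W"
    let ?s1 = "den decodeC (setv vQ i (setv vT i t))"
    have "fst ?s1 vR = fst t vR" "fst ?s1 vT = i"
      by (simp_all add: frameV)
    then have "fst (den (tryC r) (setv vT i t)) vR \<le> W"
      using P i M by (simp add: tryC_def den_ifC)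
    then show "good (den (tryC r) (setv vT i t)) \<and> fst (den (tryC r) (setv vT i t)) vR \<le> W"
      using P by simp
  qed (use s3 in simp_all)
  then have "ok W decodeC s5"
    using W by (intro ok_decodeC) (simp_all add: s5_def)
  moreover have "ok W (For vT (Var vM) (tryC r)) s3"
    by (rule ok_For[where P = "\<lambda>i. good" and k = "fst s3 vM"])
      (use W M s3 in \<open>auto intro!: ok_tryC\<close>)
  moreover have "ok W (closeC r) s" "ok W sizeC s1"
    using W assms(2) s1(1) by (auto intro!: ok_std stdC_closeC stdC_sizeC)
  ultimately show ?thesis
    by (simp add: optimizeC_def s1_def s3_def s4_def s5_def)
qed

lemma ok_coreC:
  assumes "bound W" "good s"
  shows "ok W (coreC r) s"
  unfolding coreC_def
  by (rule ok_For[where P = "\<lambda>i. good" and k = n])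
    (use assms in \<open>auto intro!: ok_optimizeC simp: okE_std bound_def\<close>)

lemma ok_dropC:
  assumes "bound W" "good s"
  shows "ok W (dropC r) s"
proof -
  let ?s1 = "den (Put Act (Var vG) (Cst 0)) s"
  have "good ?s1" using assms by (intro good_den) simp_all
  moreover from this have "good (den (coreC r) ?s1)" by simp
  ultimately show ?thesis
    using assms(1) ok_coreC[of W ?s1]
      ok_std[of W "ifC (eqE (numE r) activeE) (Put Act (Var vG) (Cst 1))" "den (coreC r) ?s1"]
    by (simp add: dropC_def)
qed

lemma wr_dropC [simp]: "writesA (dropC r) = {Act, Flag, Val}"
    "writesV (dropC r) = insert vD (writesV (coreC r))"
  by (auto simp: dropC_def)

lemma ok_mainC:
  assumes "bound W" "good s"
  shows "ok W (mainC r) s"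
proof -
  let ?c1 = "For vJ mE (Put Act (Var vJ) (Cst 1))"
  let ?c4 = "For vG mE (dropC r)"
  define s1 where "s1 = den ?c1 s"
  define s2 where "s2 = den (coreC r) s1"
  define s3 where "s3 = den (headC r) s2"
  define s4 where "s4 = den ?c4 s3"
  have g1: "good s1" unfolding s1_def using assms by (intro good_den) simp_all
  have g2: "good s2" unfolding s2_def using g1 by simp
  have g3: "good s3" unfolding s3_def using g2 by (intro good_den) (simp_all add: headC_def)
  have g4: "good s4" unfolding s4_def using g3 by (intro good_den) simp_all
  have "ok W ?c1 s" using assms by (intro ok_std) simp_all
  moreover have "ok W (coreC r) s1" using assms(1) g1 by (rule ok_coreC)
  moreover have "ok W (headC r) s2"
    using assms(1) g2 by (intro ok_std stdC_headC) (simp_all add: headC_def)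
  moreover have "ok W ?c4 s3"
    by (rule ok_For[where P = "\<lambda>i. good" and k = m])
      (use assms(1) g3 in \<open>auto intro!: ok_dropC simp: okE_std bound_def\<close>)
  moreover have "ok W (tailC r) s4"
    using assms(1) g4 by (intro ok_std stdC_tailC) (simp_all add: tailC_def)
  ultimately show ?thesis
    by (simp add: mainC_def s1_def s2_def s3_def s4_def)
qed

end

section \<open>Output and minimal unsatisfiable subformula\<close>

text \<open>Entries kept in input order are already in the order of the encoding, so the program
  never sorts.\<close>

lemma sorted_list_of_set_nths:
  assumes "sorted ys" "distinct ys"
  shows "sorted_list_of_set (set (nths ys A)) = nths ys A"
  using assms by (intro sorted_list_of_set.idem_if_sorted_distinct) (auto simp: sorted_nths distinct_nthsI)

lemma concat_nths_take_Suc: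
  assumes "j < length yss"
  shows "concat (nths (take (Suc j) yss) A) =
    concat (nths (take j yss) A) @ (if j \<in> A then yss ! j else [])"
  using assms by (simp add: take_Suc_conv_app_nth nths_append)

text \<open>\<open>outputs\<close> inspects only as many cells as the expected word has, so surplus
  output is harmless.\<close>

lemma outputs_if_prefix:
  assumes "\<And>i. i < k \<Longrightarrow> snd \<sigma> i = snd s Out i" "out s = w @ w'" "length w \<le> k"
  shows "outputs \<sigma> w"
proof -
  have "snd \<sigma> i = w ! i" if i: "i < length w" for i
  proof -
    have "length w \<le> fst s vP"
      using arg_cong[OF assms(2), of length] by (simp add: out_def)
    then have "snd s Out i = out s ! i" using i by (simp add: out_def)
    then show ?thesis using assms i by (simp add: nth_append)
  qed
  then show ?thesis unfolding outputs_def by (intro nth_equalityI) simp_all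
qed

context sat_instance
begin

lemma length_in_cs: "c \<in> set cs \<Longrightarrow> length c = 2 * r"
  using length_cs by (auto simp: in_set_conv_nth m_def)

lemma wr_headC [simp]: "writesA (headC r) = {Out}" "writesV (headC r) = {vP, vU}"
  by (auto simp: headC_def)

lemma out_headC:
  assumes "good s" "val_is s \<sigma>"
  shows "out (den (headC r) s) =
    out s @ of_bool (count_sat (active s) \<sigma> = m) # encode_assignment F \<sigma>"
proof -
  let ?s1 = "den (pushC (eqE (numE r) mE)) s"
  let ?w = "out s @ [of_bool (count_sat (active s) \<sigma> = m)]"
  let ?P = "\<lambda>i t. good t \<and> val_is t \<sigma> \<and> out t = ?w @ map (\<lambda>v. of_bool (\<sigma> v)) (take i xs)"
  have "?P n (den (For vU nE (pushC (Arr Val (xE (Var vU))))) ?s1)"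
  proof (rule den_For[where P = ?P])
    fix i t assume "i < n" "?P i t"
    then show "?P (Suc i) (den (pushC (Arr Val (xE (Var vU)))) (setv vU i t))"
      by (simp add: val_is_den out_pushC take_Suc_conv_app_nth n_def[symmetric])
         (simp add: val_is_def)
  qed (use assms in \<open>simp_all add: val_is_den out_pushC\<close>)
  then show ?thesis
    by (simp add: headC_def encode_assignment_def n_def flip: xs_def)
qed

lemma out_tailC:
  assumes "good s"
  defines "X \<equiv> \<Union>j\<in>active s. clause_vars j"
  shows "out (den (tailC r) s) = out s @ card X # filter (\<lambda>x. x \<in> X) xs @
    card (active s) # concat (nths cs (active s))"
proof -
  let ?push = "pushC (Arr Inp (posE r (Var vK)))"
  let ?c1 = "pushC (Sum vU nE (boolE (usedE r)))"
  let ?c2 = "For vU nE (ifC (usedE r) (pushC (xE (Var vU))))"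
  let ?c3 = "pushC activeE"
  let ?c4 = "For vJ mE (ifC (Arr Act (Var vJ)) (For vK (Cst (2 * r)) ?push))"
  define s1 where "s1 = den ?c1 s"
  define s2 where "s2 = den ?c2 s1"
  define s3 where "s3 = den ?c3 s2"
  have X: "X \<subseteq> vars F" using clause_vars_subset by (auto simp: X_def active_def)
  have used: "ev (usedE r) (setv vU i t) = 0 \<longleftrightarrow> xs ! i \<notin> X"
    if "good t" "active t = active s" "i < n" for i t
  proof -
    have "ev (usedE r) (setv vU i t) \<noteq> 0 \<longleftrightarrow> xs ! i \<in> X"
      using ev_usedE[of "setv vU i t"] that unfolding X_def by simp
    then show ?thesis by argo
  qed
  have "ev (Sum vU nE (boolE (usedE r))) s = (\<Sum>i<n. if xs ! i \<notin> X then 0 else 1)"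
    using assms(1) used by simp
  also have "\<dots> = card {i. i < length xs \<and> xs ! i \<in> X}"
    unfolding sum_if_eq_card by (simp add: n_def)
  also have "\<dots> = length (filter (\<lambda>x. x \<in> X) xs)"
    by (rule length_filter_conv_card[symmetric])
  also have "\<dots> = card (set (filter (\<lambda>x. x \<in> X) xs))"
    using distinct_xs by (simp only: distinct_card distinct_filter)
  also have "set (filter (\<lambda>x. x \<in> X) xs) = X" using X by (auto simp: set_xs)
  finally have s1: "good s1" "active s1 = active s" "out s1 = out s @ [card X]"
    using assms(1) by (simp_all add: s1_def active_den out_pushC del: ev.simps)
  let ?P = "\<lambda>i t. good t \<and> active t = active s \<and>
    out t = out s1 @ filter (\<lambda>x. x \<in> X) (take i xs)"
  have "?P n s2"
    unfolding s2_def
  proof (rule den_For[where P = ?P])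
    fix i t assume i: "i < n" and P: "?P i t"
    then have "out (den (ifC (usedE r) (pushC (xE (Var vU)))) (setv vU i t)) =
        out t @ (if xs ! i \<in> X then [xs ! i] else [])"
      using used[of t i] by (simp add: den_ifC out_pushC)
    then show "?P (Suc i) (den (ifC (usedE r) (pushC (xE (Var vU)))) (setv vU i t))"
      using P i by (simp add: active_den take_Suc_conv_app_nth n_def)
  qed (use s1 in simp_all)
  then have s2: "good s2" "active s2 = active s" "out s2 = out s1 @ filter (\<lambda>x. x \<in> X) xs"
    by (simp_all add: n_def)
  have s3: "good s3" "active s3 = active s" "out s3 = out s2 @ [card (active s)]"
    using s2(1,2) by (simp_all add: s3_def active_den out_pushC)
  let ?Q = "\<lambda>j t. good t \<and> active t = active s \<and> out t = out s3 @ concat (nths (take j cs) (active s))"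
  have "?Q m (den ?c4 s3)"
  proof (rule den_For[where P = ?Q])
    fix j t assume j: "j < m" and Q: "?Q j t"
    let ?t = "setv vJ j t"
    let ?c = "For vK (Cst (2 * r)) ?push"
    have act: "snd t Act j \<noteq> 0 \<longleftrightarrow> j \<in> active s"
      using Q j by (auto simp: active_def)
    have "good (den ?c (setv vD 0 ?t)) \<and> fst (den ?c (setv vD 0 ?t)) vJ = j \<and>
        out (den ?c (setv vD 0 ?t)) = out t @ take (2 * r) (cs ! j)"
    proof (rule den_For[where P = "\<lambda>k u. good u \<and> fst u vJ = j \<and> out u = out t @ take k (cs ! j)"])
      fix k u assume k: "k < 2 * r" and u: "good u \<and> fst u vJ = j \<and> out u = out t @ take k (cs ! j)"
      let ?u = "setv vK k u"
      have "ev (Arr Inp (posE r (Var vK))) ?u = cs ! j ! k"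
        using u inp_c[OF j k] by (simp add: ev_posE) (simp add: good_def)
      then show "good (den ?push ?u) \<and> fst (den ?push ?u) vJ = j \<and>
          out (den ?push ?u) = out t @ take (Suc k) (cs ! j)"
        using u k length_cs[OF j] by (simp add: out_pushC frameV take_Suc_conv_app_nth del: ev.simps)
    qed (use Q in simp_all)
    then have "out (den (ifC (Arr Act (Var vJ)) ?c) ?t) = out t @ (if j \<in> active s then cs ! j else [])"
      using act length_cs[OF j] by (auto simp: den_ifC simp del: den.simps)
    then show "?Q (Suc j) (den (ifC (Arr Act (Var vJ)) ?c) ?t)"
      using Q j by (simp add: active_den concat_nths_take_Suc m_def del: den.simps)
  qed (use s3 in simp_all)
  then have "out (den ?c4 s3) = out s3 @ concat (nths cs (active s))"
    by (simp add: m_def)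
  then show ?thesis
    using s1(3) s2(3) s3(3) by (simp add: tailC_def s1_def s2_def s3_def)
qed

section \<open>Deleting clauses down to a minimal unsatisfiable subformula\<close>

lemma den_dropC:
  assumes "good s" "val_is s \<sigma>" "fst s vG < m"
  shows "\<exists>\<sigma>'. val_is (den (dropC r) s) \<sigma>'"
    and "active (den (dropC r) s) = (if sat_all (active s - {fst s vG}) then insert (fst s vG) (active s)
      else active s - {fst s vG})"
proof -
  let ?g = "fst s vG"
  define s1 where "s1 = den (Put Act (Var vG) (Cst 0)) s"
  define s2 where "s2 = den (coreC r) s1"
  have s1: "good s1" "val_is s1 \<sigma>" "active s1 = active s - {?g}" "fst s1 vG = ?g"
    using assms by (auto simp: s1_def good_def val_is_def active_def)
  obtain \<sigma>' where \<sigma>': "val_is s2 \<sigma>'" "\<And>\<tau>. count_sat (active s1) \<tau> \<le> count_sat (active s1) \<sigma>'"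
    using val_is_coreC[OF s1(1,2)] unfolding s2_def by blast
  have s2: "good s2" "active s2 = active s1" "fst s2 vG = ?g"
    using s1 by (simp_all add: s2_def active_den frameV)
  have "ev (eqE (numE r) activeE) s2 = (if sat_all (active s1) then 1 else 0)"
    using s2 \<sigma>' count_sat_max_eq_card_iff[OF finite_active, of s1 \<sigma>'] by simp
  then have den: "den (dropC r) s = (if sat_all (active s1)
      then den (Put Act (Var vG) (Cst 1)) (setv vD 0 s2) else s2)"
    by (simp add: dropC_def s1_def[symmetric] s2_def[symmetric] den_ifC del: ev_eqE)
       (simp add: s1_def s2_def)
  show "\<exists>\<sigma>'. val_is (den (dropC r) s) \<sigma>'"
    unfolding den using \<sigma>'(1) by (auto simp: val_is_def)
  have "active (den (Put Act (Var vG) (Cst 1)) (setv vD 0 s2)) = insert ?g (active s2)"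
    using s2(3) assms(3) by (auto simp: active_def)
  then show "active (den (dropC r) s) = (if sat_all (active s - {?g}) then insert ?g (active s)
      else active s - {?g})"
    unfolding den using s1(3) s2(2) by (auto simp del: den.simps)
qed

text \<open>Each clause is tested only once. If the rest was satisfiable without it, it remains
  indispensable, because satisfiability passes to the smaller sets left by later deletions.\<close>

lemma active_shrink:
  assumes "good s" "val_is s \<sigma>" "active s = {..<m}" "\<not> sat_all {..<m}"
  defines "A \<equiv> active (den (For vG mE (dropC r)) s)"
  shows "\<not> sat_all A \<and> (\<forall>i\<in>A. sat_all (A - {i}))"
proof -
  let ?P = "\<lambda>g t. good t \<and> (\<exists>\<sigma>. val_is t \<sigma>) \<and> {g..<m} \<subseteq> active t \<and> \<not> sat_all (active t) \<and>
    (\<forall>i\<in>active t. i < g \<longrightarrow> sat_all (active t - {i}))"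
  have "?P m (den (For vG mE (dropC r)) s)"
  proof (rule den_For[where P = ?P])
    fix g t assume g: "g < m" and P: "?P g t"
    let ?t' = "den (dropC r) (setv vG g t)"
    obtain \<tau> where \<tau>: "val_is t \<tau>" using P by blast
    have val: "\<exists>\<sigma>. val_is ?t' \<sigma>"
      and act: "active ?t' = (if sat_all (active t - {g}) then insert g (active t) else active t - {g})"
      using den_dropC[of "setv vG g t" \<tau>] P \<tau> g by simp_all
    have "g \<in> active t" using P g by auto
    have good: "good ?t'" using P by simp
    show "?P (Suc g) ?t'"
    proof (cases "sat_all (active t - {g})")
      case True
      then have "active ?t' = active t" using act \<open>g \<in> active t\<close> by auto
      then show ?thesis using val good P True by (auto simp: less_Suc_eq)
    next
      case False
      then have "active ?t' = active t - {g}" using act by simp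
      moreover have "sat_all (active t - {g} - {i})" if "i \<in> active t" "i < g" for i
        using P that sat_all_mono[of "active t - {i}" "active t - {g} - {i}"] by auto
      ultimately show ?thesis using val good P False by (auto simp: less_Suc_eq)
    qed
  next
    show "?P 0 s" using assms(1,2,4) by (auto simp: assms(3))
  qed (simp add: assms(1))
  moreover have "i < m" if "i \<in> A" for i using that by (simp add: A_def active_def)
  ultimately show ?thesis unfolding A_def by simp
qed

text \<open>A proper subformula that lacks a clause is satisfiable by \<open>min\<close>. One that
  lacks only variables cannot exist: each variable of \<open>G\<close> occurs in a clause, and a
  subformula must contain the variables of its clauses.\<close>

lemma minimal_unsat_clause_at_image:
  assumes A: "A \<subseteq> {..<m}" and unsat: "\<not> sat_all A" and min: "\<And>i. i \<in> A \<Longrightarrow> sat_all (A - {i})"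
  defines "G \<equiv> Formula (\<Union>j\<in>A. clause_vars j) (clause_at ` A)"
  shows "minimal_unsat_subformula r G F"
proof -
  have vars: "fst ` clause_at j = clause_vars j" if "j \<in> A" for j
    using vars_clause_at A that by auto
  have "finite (vars G)"
    using finite_subset[OF A] by (simp add: G_def clause_vars_def)
  moreover have "clause_at j \<in> all_clauses r (vars G)" if "j \<in> A" for j
  proof -
    have "fst ` clause_at j \<subseteq> vars G" using that vars[OF that] by (auto simp: G_def)
    then show ?thesis using clause_at_in_all_clauses[of j] A that by (auto simp: all_clauses_def)
  qed
  ultimately have "sat_formula r G" by (auto simp: sat_formula_def G_def)
  moreover have "vars G \<subseteq> vars F" "clauses G \<subseteq> clauses F"
    using A clause_vars_subset clause_at_in by (auto simp: G_def)
  ultimately have "subformula r G F" by (simp add: subformula_def)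
  moreover have "\<not> satisfiable G"
    unfolding G_def using satisfiable_clause_at_image[OF A] unsat by blast
  moreover have "satisfiable H" if H: "subformula r H G" "H \<noteq> G" for H
  proof (cases "clauses H = clauses G")
    case True
    have "vars H \<subseteq> vars G" using H by (simp add: subformula_def)
    moreover have "clause_vars j \<subseteq> vars H" if "j \<in> A" for j
    proof -
      have "clause_at j \<in> clauses H" using True that by (simp add: G_def)
      then have "clause_at j \<in> all_clauses r (vars H)"
        using H(1) by (auto simp: subformula_def sat_formula_def)
      then show ?thesis using vars[OF that] by (simp add: all_clauses_def)
    qed
    then have "vars G \<subseteq> vars H" by (auto simp: G_def)
    ultimately have "H = G" using True by (simp add: formula.expand)
    with H(2) show ?thesis by simp
  next
    case False
    have sub: "clauses H \<subseteq> clause_at ` A" using H(1) by (simp add: subformula_def G_def)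
    then obtain i where i: "i \<in> A" "clause_at i \<notin> clauses H"
      using False by (auto simp: G_def)
    then have "clauses H \<subseteq> clause_at ` (A - {i})" using sub by auto
    moreover have "satisfiable (Formula {} (clause_at ` (A - {i})))"
      using satisfiable_clause_at_image[of "A - {i}"] A min[OF i(1)] by auto
    ultimately show ?thesis by (auto simp: satisfiable_def)
  qed
  ultimately show ?thesis by (simp add: minimal_unsat_subformula_def)
qed

lemma encode_clause_at_image:
  assumes A: "A \<subseteq> {..<m}"
  defines "X \<equiv> \<Union>j\<in>A. clause_vars j"
  shows "encode (Formula X (clause_at ` A)) =
    card X # filter (\<lambda>x. x \<in> X) xs @ card A # concat (nths cs A)"
proof -
  have "X = set (filter (\<lambda>x. x \<in> X) xs)"
    using A clause_vars_subset by (auto simp: X_def set_xs)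
  then have 1: "sorted_list_of_set X = filter (\<lambda>x. x \<in> X) xs"
    using sorted_xs distinct_xs
    by (metis distinct_filter sorted_wrt_filter sorted_list_of_set.idem_if_sorted_distinct)
  have "encode_clause ` clause_at ` A = (\<lambda>j. cs ! j) ` A"
    unfolding image_image using A encode_clause_at by (intro image_cong) auto
  also have "\<dots> = set (nths cs A)"
    using A by (auto simp: set_nths m_def)
  finally have 2: "sorted_list_of_set (encode_clause ` clause_at ` A) = nths cs A"
    using sorted_list_of_set_nths[OF sorted_cs distinct_cs] by simp
  have "card (clause_at ` A) = card A"
    using bij_clause_at A by (intro card_image) (auto simp: bij_betw_def intro: inj_on_subset)
  then show ?thesis by (simp add: encode_def 1 2)
qed

lemma out_mainC:
  assumes "good s" "val_is s \<sigma>" "out s = []"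
  shows "\<exists>\<sigma> G. max_sat_assignment F \<sigma> \<and> (\<not> satisfiable F \<longrightarrow> minimal_unsat_subformula r G F) \<and>
    out (den (mainC r) s) = of_bool (satisfiable F) # encode_assignment F \<sigma> @ encode G \<and>
    length (out (den (mainC r) s)) \<le> 2 * length (encode F)"
proof -
  let ?c1 = "For vJ mE (Put Act (Var vJ) (Cst 1))"
  let ?c4 = "For vG mE (dropC r)"
  define s1 where "s1 = den ?c1 s"
  define s2 where "s2 = den (coreC r) s1"
  define s3 where "s3 = den (headC r) s2"
  define s4 where "s4 = den ?c4 s3"
  have "good s1 \<and> (\<forall>j<m. snd s1 Act j = 1)"
    unfolding s1_def
  proof (rule den_For[where P = "\<lambda>i t. good t \<and> (\<forall>j<i. snd t Act j = 1)"])
    fix i t assume "i < m" "good t \<and> (\<forall>j<i. snd t Act j = 1)"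
    then show "good (den (Put Act (Var vJ) (Cst 1)) (setv vJ i t)) \<and>
        (\<forall>j<Suc i. snd (den (Put Act (Var vJ) (Cst 1)) (setv vJ i t)) Act j = 1)"
      by (auto simp: good_def)
  qed (use assms in simp_all)
  moreover have "val_is s1 \<sigma>" "out s1 = []"
    using assms(2,3) by (simp_all add: s1_def val_is_den out_frame del: den.simps)
  ultimately have s1: "good s1" "val_is s1 \<sigma>" "active s1 = {..<m}" "out s1 = []"
    by (auto simp: active_def)
  obtain \<sigma>' where \<sigma>': "val_is s2 \<sigma>'" "\<And>\<tau>. count_sat {..<m} \<tau> \<le> count_sat {..<m} \<sigma>'"
    using val_is_coreC[OF s1(1,2)] unfolding s2_def s1(3) by blast
  have s2: "good s2" "active s2 = {..<m}" "out s2 = []"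
    using s1 by (simp_all add: s2_def active_den out_frame)
  have max: "max_sat_assignment F \<sigma>'"
    using \<sigma>'(2) by (simp add: max_sat_assignment_def num_satisfied_count_sat)
  have "count_sat {..<m} \<sigma>' = m \<longleftrightarrow> satisfiable F"
    using count_sat_max_eq_card_iff[of "{..<m}" \<sigma>'] \<sigma>'(2) by (simp add: satisfiable_iff)
  then have s3: "good s3" "val_is s3 \<sigma>'" "active s3 = {..<m}"
      "out s3 = of_bool (satisfiable F) # encode_assignment F \<sigma>'"
    using out_headC[OF s2(1) \<sigma>'(1)] s2 \<sigma>'(1)
    by (simp_all add: s3_def active_den val_is_den)
  have s4: "good s4" "out s4 = out s3"
    using s3 by (simp_all add: s4_def out_frame del: den.simps)
  let ?A = "active s4"
  let ?X = "\<Union>j\<in>?A. clause_vars j"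
  let ?G = "Formula ?X (clause_at ` ?A)"
  have min: "minimal_unsat_subformula r ?G F" if "\<not> satisfiable F"
    using active_shrink[OF s3(1-3)] that
    by (intro minimal_unsat_clause_at_image active_subset) (auto simp: s4_def satisfiable_iff)
  have out: "out (den (mainC r) s) =
      of_bool (satisfiable F) # encode_assignment F \<sigma>' @ encode ?G"
    unfolding encode_clause_at_image[OF active_subset]
    using out_tailC[OF s4(1)] s4(2) s3(4)
    by (simp add: mainC_def s1_def s2_def s3_def s4_def)
  have "length (nths cs ?A) \<le> m"
    using card_mono[of "{..<m}" "{j. j < m \<and> j \<in> ?A}"] by (auto simp: length_nths m_def)
  then have "length (concat (nths cs ?A)) \<le> 2 * r * m"
    by (subst length_concat_uniform[of _ "2 * r"]) (auto dest: in_set_nthsD length_in_cs)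
  moreover have "length (filter (\<lambda>x. x \<in> ?X) xs) \<le> n"
    by (simp add: n_def)
  moreover have "length (encode_assignment F \<sigma>') = n"
    by (simp add: encode_assignment_def n_def flip: xs_def)
  ultimately have "length (out (den (mainC r) s)) \<le> 2 * length (encode F)"
    unfolding out encode_clause_at_image[OF active_subset] length_encode by simp
  then show ?thesis using max min out by blast
qed

lemma exec_mainC:
  assumes "bound W" "length (encode F) \<le> W"
  shows "\<exists>t s. exec (prog r (mainC r)) (initial_state F) t s \<and> t \<le> time_prog r (mainC r) W \<and>
    correct_output r F s"
proof -
  let ?s = "start (encode F)"
  have good: "good ?s" by (simp add: good_def start_def inp_def)
  have "val_is ?s (\<lambda>_. False)" "out ?s = []"
    by (simp_all add: val_is_def start_def out_def)
  from out_mainC[OF good this] obtain \<sigma> G where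
    main: "max_sat_assignment F \<sigma>" "\<not> satisfiable F \<longrightarrow> minimal_unsat_subformula r G F"
      "out (den (mainC r) ?s) = of_bool (satisfiable F) # encode_assignment F \<sigma> @ encode G"
      "length (out (den (mainC r) ?s)) \<le> 2 * length (encode F)"
    by (elim exE conjE) (rule that)
  have init: "initial_state F = (\<lambda>_. 0, input (encode F))"
    by (auto simp: initial_state_def input_def)
  have "input (encode F) 0 + 2 + 2 * r * input (encode F) (input (encode F) 0 + 1) = length (encode F)"
    using inp_0 inp_m by (simp add: length_encode flip: inp_def)
  from exec_prog[OF this ok_mainC[OF assms(1) good] assms(2)] obtain t s where
    ex: "exec (prog r (mainC r)) (initial_state F) t s" "t \<le> time_prog r (mainC r) W"
      "\<And>i. i < 2 * length (encode F) \<Longrightarrow> snd s i = snd (den (mainC r) ?s) Out i"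
    unfolding init by blast
  have outs: "outputs s w" if "out (den (mainC r) ?s) = w @ w'" for w w'
    using outputs_if_prefix[OF ex(3) that] main(4) that by simp
  have "correct_output r F s"
  proof (cases "satisfiable F")
    case True
    then have "outputs s (1 # encode_assignment F \<sigma>)"
      using main(3) by (intro outs[of _ "encode G"]) simp
    then show ?thesis using True main(1) unfolding correct_output_def by auto
  next
    case False
    then have "outputs s (0 # encode_assignment F \<sigma> @ encode G)"
      using main(3) by (intro outs[of _ "[]"]) simp
    then show ?thesis using False main(1,2) unfolding correct_output_def by auto
  qed
  with ex(1,2) show ?thesis by (intro exI conjI)
qed

end

section \<open>Expected running time\<close>

lemma running_time_eq: "exec P (initial_state F) t s \<Longrightarrow> running_time P F = t"
  unfolding running_time_def using exec_deterministic by blast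

lemma (in sat_instance) solve:
  assumes time_prog: "\<And>W. time_prog r (mainC r) W \<le> C * (W + 1) ^ D"
  shows "\<exists>t s. exec (prog r (mainC r)) (initial_state F) t s \<and> correct_output r F s \<and>
    t \<le> C * (2 * (length (encode F) + 2 * r + 1)) ^ D *
      (1 + (\<Sum>v\<in>vars F. (2 ^ D) ^ card (component v)))"
proof -
  \<comment> \<open>The inserted 1 makes the maximum meaningful when there are no variables, and
    reappears as the summand 1 in the bound.\<close>
  define E :: nat where "E = Max (insert 1 ((\<lambda>v. 2 ^ card (component v)) ` vars F))"
  define a where "a = length (encode F) + 2 * r + 1"
  have fin: "finite (insert 1 ((\<lambda>v. 2 ^ card (component v)) ` vars F))"
    using finite_vars by simp
  have E1: "1 \<le> E" unfolding E_def using fin by (intro Max_ge) auto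
  have Ev: "2 ^ card (component v) \<le> E" if "v \<in> vars F" for v
    unfolding E_def using fin that by (intro Max_ge) auto
  have aE: "a \<le> a * E" "E \<le> a * E" 
    using E1 mult_le_mono[of a a 1 E] mult_le_mono[of 1 a E E] by (simp_all add: a_def)
  \<comment> \<open>The product dominates both the input size and the number of trials, and its
    \<open>D\<close>-th power splits into a polynomial factor and \<open>E ^ D\<close>.\<close>
  have "bound (a * E)"
    unfolding bound_def
  proof (intro conjI ballI)
    have "1 \<le> a" "2 * r \<le> a" "n \<le> a" by (simp_all add: a_def length_encode)
    moreover have "m \<le> 2 * r * m" using r_pos mult_le_mono[of 1 "2 * r" m m] by simp
    then have "m \<le> a" unfolding a_def length_encode by linarith
    ultimately show "1 \<le> a * E" "n \<le> a * E" "m \<le> a * E" "2 * r \<le> a * E"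
      using aE(1) by linarith+
    show "2 ^ card (component v) \<le> a * E" if "v \<in> vars F" for v
      using Ev[OF that] aE(2) by linarith
  qed
  moreover have "length (encode F) \<le> a * E" using aE(1) by (simp add: a_def)
  ultimately obtain t s where ts: "exec (prog r (mainC r)) (initial_state F) t s"
      "t \<le> time_prog r (mainC r) (a * E)" "correct_output r F s"
    using exec_mainC by blast
  have "E \<in> insert 1 ((\<lambda>v. 2 ^ card (component v)) ` vars F)"
    unfolding E_def using fin by (intro Max_in) auto
  then have ED: "E ^ D \<le> 1 + (\<Sum>v\<in>vars F. (2 ^ D) ^ card (component v))"
  proof
    assume "E \<in> (\<lambda>v. 2 ^ card (component v)) ` vars F"
    then obtain v where v: "v \<in> vars F" "E = 2 ^ card (component v)" by blast
    then have "E ^ D = (2 ^ D) ^ card (component v)"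
      by (simp add: mult.commute flip: power_mult)
    also have "\<dots> \<le> (\<Sum>v\<in>vars F. (2 ^ D) ^ card (component v))"
      using finite_vars v(1) by (intro member_le_sum) auto
    finally show ?thesis by simp
  qed simp
  have "t \<le> C * (a * E + 1) ^ D" using ts(2) time_prog order_trans by blast
  also have "\<dots> \<le> C * (2 * a * E) ^ D"
    using aE(2) E1 by (intro mult_left_mono power_mono) linarith+
  also have "\<dots> = C * (2 * a) ^ D * E ^ D"
    by (simp only: power_mult_distrib ac_simps)
  also have "\<dots> \<le> C * (2 * a) ^ D * (1 + (\<Sum>v\<in>vars F. (2 ^ D) ^ card (component v)))"
    using ED by (intro mult_left_mono) simp_all
  finally show ?thesis using ts(1,3) unfolding a_def by blast
qed

lemma random_sat_support:
  assumes "F \<in> set_pmf (random_sat r n p)"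
  shows "vars F = {..<n}" "clauses F \<subseteq> all_clauses r {..<n}"
  using assms by (auto simp: random_sat_def)

lemma finite_set_random_sat: "finite (set_pmf (random_sat r n p))"
proof (rule finite_subset)
  show "set_pmf (random_sat r n p) \<subseteq> Formula {..<n} ` Pow (all_clauses r {..<n})"
    by (auto simp: random_sat_def)
qed (simp add: finite_all_clauses)

text \<open>The base of the power is \<open>2 * (n + 2 r (2 n) ^ r + 2 r + 3)\<close>, from the
  longest possible input; the last factor is \<open>1 + n * 3 * 2 ^ D\<close>, from the expected sum
  over the components.\<close>

definition time_poly :: "nat \<Rightarrow> nat \<Rightarrow> nat \<Rightarrow> real poly" where
  "time_poly r C D =
     smult (real C) ((smult 2 ([:real (2 * r + 3), 1:] + smult (real (2 * r)) ([:0, 2:] ^ r))) ^ D) *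
     [:1, 3 * 2 ^ D:]"

lemma expected_running_time_le:
  fixes \<alpha> :: real
  assumes time_prog: "\<And>W. time_prog r (mainC r) W \<le> C * (W + 1) ^ D"
    and "r \<ge> 1" "n \<ge> 1" "0 < \<alpha>" "\<alpha> \<le> threshold r D"
  shows "measure_pmf.expectation (random_sat r n (\<alpha> / real n ^ (r - 1)))
    (\<lambda>F. real (running_time (prog r (mainC r)) F)) \<le> poly (time_poly r C D) (real n)"
proof -
  let ?M = "random_sat r n (\<alpha> / real n ^ (r - 1))"
  let ?c = "\<lambda>F v. (2 ^ D) ^ card (reach (image fst) (clauses F) {v})"
  \<comment> \<open>The factor independent of \<open>F\<close>: it assumes the maximal number of
    clauses, so only component sizes remain random.\<close>
  define B where "B = C * (2 * (n + 2 + 2 * r * (2 * n) ^ r + 2 * r + 1)) ^ D"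
  have int: "integrable ?M f" for f :: "formula \<Rightarrow> real"
    by (rule integrable_measure_pmf_finite[OF finite_set_random_sat])
  have "real (running_time (prog r (mainC r)) F) \<le> real B * (1 + (\<Sum>v<n. ?c F v))"
    if F: "F \<in> set_pmf ?M" for F
  proof -
    interpret sat_instance r F
      using random_sat_support[OF F] assms(2) by unfold_locales (simp_all add: sat_formula_def)
    obtain t s where ts: "exec (prog r (mainC r)) (initial_state F) t s"
      "t \<le> C * (2 * (length (encode F) + 2 * r + 1)) ^ D *
        (1 + (\<Sum>v\<in>vars F. (2 ^ D) ^ card (component v)))"
      using solve[OF time_prog] by blast
    have "card (clauses F) \<le> (2 * n) ^ r"
      using card_mono[OF finite_all_clauses random_sat_support(2)[OF F]] card_all_clauses_le[of r n]
      by simp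
    moreover have "card (vars F) = n" using random_sat_support(1)[OF F] by simp
    ultimately have "length (encode F) \<le> n + 2 + 2 * r * (2 * n) ^ r"
      by (simp add: length_encode card_vars card_clauses)
    then have "C * (2 * (length (encode F) + 2 * r + 1)) ^ D \<le> B"
      unfolding B_def by (intro mult_left_mono power_mono) simp_all
    with ts(2) have "t \<le> B * (1 + (\<Sum>v\<in>vars F. (2 ^ D) ^ card (component v)))"
      using mult_right_mono order_trans by blast
    then have "t \<le> B * (1 + (\<Sum>v<n. ?c F v))"
      by (simp add: component_eq random_sat_support(1)[OF F])
    then have "real t \<le> real (B * (1 + (\<Sum>v<n. ?c F v)))"
      by (simp only: of_nat_le_iff)
    then show ?thesis using running_time_eq[OF ts(1)] by (simp add: distrib_left)
  qed
  then have "measure_pmf.expectation ?M (\<lambda>F. real (running_time (prog r (mainC r)) F)) \<le>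
      measure_pmf.expectation ?M (\<lambda>F. real B * (1 + (\<Sum>v<n. ?c F v)))"
    by (intro integral_mono_AE int) (simp add: AE_measure_pmf_iff)
  also have "\<dots> = real B * (1 + (\<Sum>v<n. measure_pmf.expectation ?M (\<lambda>F. ?c F v)))"
    using Bochner_Integration.integral_add[OF int[of "\<lambda>_. 1"] int[of "\<lambda>F. \<Sum>v<n. ?c F v"]]
      Bochner_Integration.integral_sum[where I = "{..<n}" and f = "\<lambda>v F. ?c F v", OF int] by simp
  also have "\<dots> \<le> real B * (1 + (\<Sum>v<n. 3 * 2 ^ D))"
    using expectation_component_le[OF assms(2-5)]
    by (intro mult_left_mono add_left_mono sum_mono) simp_all
  also have "\<dots> = poly (time_poly r C D) (real n)"
    by (simp add: B_def time_poly_def algebra_simps)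
  finally show ?thesis .
qed

theorem theorem24:
  fixes r :: nat
  assumes "r \<ge> 3"
  shows "\<exists>\<alpha>\<^sub>0 :: real. \<alpha>\<^sub>0 > 0 \<and>
    (\<forall>\<alpha>. 0 < \<alpha> \<and> \<alpha> \<le> \<alpha>\<^sub>0 \<longrightarrow>
      (\<exists>P. solves_sat r P \<and>
        (\<exists>q :: real poly. \<forall>n \<ge> 1.
          measure_pmf.expectation (random_sat r n (\<alpha> / real n ^ (r - 1)))
            (\<lambda>F. real (running_time P F)) \<le> poly q (real n))))"
proof -
  \<comment> \<open>\<open>D\<close> comes from the program alone and may therefore determine the
    threshold; the same program then serves every admissible \<alpha>.\<close>
  obtain C D where time_prog: "\<And>W. time_prog r (mainC r) W \<le> C * (W + 1) ^ D"
    using poly_bounded_time_prog[of r "mainC r"] unfolding poly_bounded_def by blast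
  have "solves_sat r (prog r (mainC r))"
    unfolding solves_sat_def
  proof (intro allI impI)
    fix F assume "sat_formula r F"
    then interpret sat_instance r F using assms by unfold_locales simp_all
    show "\<exists>t s. exec (prog r (mainC r)) (initial_state F) t s \<and> correct_output r F s"
      using solve[OF time_prog] by blast
  qed
  moreover have "threshold r D > 0" using assms by (simp add: threshold_def)
  moreover have "r \<ge> 1" using assms by simp
  ultimately show ?thesis
    using expected_running_time_le[OF time_prog] by blast
qed

end
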